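(* Let $m\ge2$, $1<q<p<\infty$, $p_i\in(1,\infty)$ for $i\in\{1,\dots,m\}$, and $\frac1p=\frac1{p_1}+\cdots+\frac1{p_m}$. Let $T$ be an $m$-linear non-degenerate Calder\'on--Zygmund operator and let $b\in L^1_{\rm loc}(\mathbb{R}^n)$ be real-valued. If the commutator $[b,T]_1$ is bounded from $L^{p_1}(\mathbb{R}^n)\times\cdots\times L^{p_m}(\mathbb{R}^n)$ to $L^q(\mathbb{R}^n)$, then $b\in\dot L^r(\mathbb{R}^n)$ with $\frac1r:=\frac1q-\frac1p$.
   Context: Let $\Delta=\{(x,y_1,\dots,y_m):x=y_1=\cdots=y_m\}$. A multilinear Calder\'on--Zygmund kernel is $K:(\mathbb{R}^n)^{m+1}\setminus\Delta\to\mathbb{C}$ with $|K(x,y_1,\dots,y_m)|\le C(\sum_{i=1}^m|x-y_i|)^{-mn}$ and, whenever $h\in\mathbb{R}^n$ with $|h|\le\frac12\max_i|x-y_i|$, $|K(x+h,y_1,\dots,y_m)-K(x,y_1,\dots,y_m)|+\sum_{i=1}^m|K(x,y_1,\dots,y_i+h,\dots,y_m)-K(x,y_1,\dots,y_m)|\le \frac{C}{(\sum_i|x-y_i|)^{mn}}\omega\!\left(\frac{|h|}{\sum_i|x-y_i|}\right)$, with $\omega:[0,1)\to[0,\infty)$ increasing, $\omega(0)=0$, $\int_0^1\frac{\omega(t)}{t}dt<\infty$. An $m$-linear Calder\'on--Zygmund operator $T$ is an $m$-linear operator bounded from $L^{q_1}\times\cdots\times L^{q_m}$ to $L^{s}$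 for some $q_i\in(1,\infty]$ with $\frac1s=\sum_i\frac1{q_i}\in(0,\infty)$, with a multilinear Calder\'on--Zygmund kernel $K$ such that $T(f_1,\dots,f_m)(x)=\int_{\mathbb{R}^{mn}}K(x,y_1,\dots,y_m)\prod_i f_i(y_i)\,dy$ for $f_i\in C_c^\infty$ and $x\notin\bigcap_i\operatorname{supp}f_i$. It is non-degenerate if moreover $\omega(t)\to0$ as $t\to0^+$ and there is $c_0>0$ such that for every $y\in\mathbb{R}^n$ and $\rho>0$ there exists $x$ with $|x-y|\ge\rho$ and $|K(x,y,\dots,y)|\ge\frac1{c_0\rho^{mn}}$. The commutator is $[b,T]_1(f_1,\dots,f_m):=bT(f_1,\dots,f_m)-T(bf_1,f_2,\dots,f_m)$. $\dot L^r(\mathbb{R}^n)$ is the set of $b\in L^r_{\rm loc}$ with $\inf_c\|b-c\|_{L^r}<\infty$.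
   Formalization: Since T(b f_1, f_2, …) is undefined for b merely in L^1_loc, it is additionally assumed that T is given by the kernel integral for all integrable, compactly supported f_i at every x outside the intersection of their supports (not only for C_c^∞ functions). *)

theory Defs
  imports "HOL-Analysis.Analysis"
begin

text \<open>Throughout, \<open>'a::euclidean_space\<close> plays the role of \<open>R^n\<close>, with \<open>n = DIM('a)\<close>.
  An m-tuple of functions is modelled as \<open>f :: nat \<Rightarrow> 'a \<Rightarrow> complex\<close>, only the
  entries \<open>f 0, ..., f (m-1)\<close> being relevant; a point of \<open>(R^n)^m\<close> is \<open>y :: nat \<Rightarrow> 'a\<close>.\<close>

definition in_Lp :: "real \<Rightarrow> ('a::euclidean_space \<Rightarrow> 'b::real_normed_vector) \<Rightarrow> bool" where
  "in_Lp p f \<longleftrightarrow> f \<in> borel_measurable lebesgue \<and>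
     (\<integral>\<^sup>+ x. ennreal (norm (f x) powr p) \<partial>lebesgue) < \<infinity>"

definition Lp_norm :: "real \<Rightarrow> ('a::euclidean_space \<Rightarrow> 'b::real_normed_vector) \<Rightarrow> real" where
  "Lp_norm p f = (enn2real (\<integral>\<^sup>+ x. ennreal (norm (f x) powr p) \<partial>lebesgue)) powr (1 / p)"

definition in_Linf :: "('a::euclidean_space \<Rightarrow> 'b::real_normed_vector) \<Rightarrow> bool" where
  "in_Linf f \<longleftrightarrow> f \<in> borel_measurable lebesgue \<and> (\<exists>C. AE x in lebesgue. norm (f x) \<le> C)"

definition Linf_norm :: "('a::euclidean_space \<Rightarrow> 'b::real_normed_vector) \<Rightarrow> real" where
  "Linf_norm f = Inf {C. 0 \<le> C \<and> (AE x in lebesgue. norm (f x) \<le> C)}"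

definition in_Lq :: "ereal \<Rightarrow> ('a::euclidean_space \<Rightarrow> 'b::real_normed_vector) \<Rightarrow> bool" where
  "in_Lq q f = (if q = \<infinity> then in_Linf f else in_Lp (real_of_ereal q) f)"

definition Lq_norm :: "ereal \<Rightarrow> ('a::euclidean_space \<Rightarrow> 'b::real_normed_vector) \<Rightarrow> real" where
  "Lq_norm q f = (if q = \<infinity> then Linf_norm f else Lp_norm (real_of_ereal q) f)"

definition inv_exp :: "ereal \<Rightarrow> real" where
  "inv_exp q = (if q = \<infinity> then 0 else 1 / real_of_ereal q)"

definition in_Lp_loc :: "real \<Rightarrow> ('a::euclidean_space \<Rightarrow> 'b::real_normed_vector) \<Rightarrow> bool" where
  "in_Lp_loc p f \<longleftrightarrow> f \<in> borel_measurable lebesgue \<and>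
     (\<forall>K. compact K \<longrightarrow> (\<integral>\<^sup>+ x\<in>K. ennreal (norm (f x) powr p) \<partial>lebesgue) < \<infinity>)"

text \<open>Homogeneous space \<open>\<dot>L^r\<close>: \<open>b \<in> L^r_loc\<close> and \<open>inf_c \<parallel>b - c\<parallel>_r < \<infinity>\<close>,
  i.e. \<open>b - c \<in> L^r\<close> for some constant \<open>c\<close>.\<close>

definition in_dot_Lp :: "real \<Rightarrow> ('a::euclidean_space \<Rightarrow> real) \<Rightarrow> bool" where
  "in_dot_Lp r b \<longleftrightarrow> in_Lp_loc r b \<and> (\<exists>c::real. in_Lp r (\<lambda>x. b x - c))"

definition partial_dir :: "'a::euclidean_space \<Rightarrow> ('a \<Rightarrow> complex) \<Rightarrow> 'a \<Rightarrow> complex" where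
  "partial_dir v f x = frechet_derivative f (at x) v"

definition smooth_fun :: "('a::euclidean_space \<Rightarrow> complex) \<Rightarrow> bool" where
  "smooth_fun f \<longleftrightarrow> (\<forall>vs. set vs \<subseteq> Basis \<longrightarrow> (\<forall>x. fold partial_dir vs f differentiable (at x)))"

definition fsupp :: "('a::euclidean_space \<Rightarrow> complex) \<Rightarrow> 'a set" where
  "fsupp f = closure {x. f x \<noteq> 0}"

definition Cc_inf :: "('a::euclidean_space \<Rightarrow> complex) \<Rightarrow> bool" where
  "Cc_inf f \<longleftrightarrow> smooth_fun f \<and> compact (fsupp f)"

definition L1c :: "('a::euclidean_space \<Rightarrow> complex) \<Rightarrow> bool" where
  "L1c f \<longleftrightarrow> in_Lp 1 f \<and> compact (fsupp f)"

definition ssum_dist :: "nat \<Rightarrow> 'a::euclidean_space \<Rightarrow> (nat \<Rightarrow> 'a) \<Rightarrow> real" where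
  "ssum_dist m x y = (\<Sum>i<m. dist x (y i))"

definition off_diag :: "nat \<Rightarrow> 'a::euclidean_space \<Rightarrow> (nat \<Rightarrow> 'a) \<Rightarrow> bool" where
  "off_diag m x y \<longleftrightarrow> \<not> (\<forall>i<m. y i = x)"

definition modulus :: "(real \<Rightarrow> real) \<Rightarrow> bool" where
  "modulus \<omega> \<longleftrightarrow> mono_on {0..<1} \<omega> \<and> \<omega> 0 = 0 \<and> (\<forall>t\<in>{0..<1}. 0 \<le> \<omega> t) \<and>
     set_integrable lborel {0<..<1} (\<lambda>t. \<omega> t / t)"

definition mCZ_kernel ::
  "nat \<Rightarrow> ('a::euclidean_space \<Rightarrow> (nat \<Rightarrow> 'a) \<Rightarrow> complex) \<Rightarrow> (real \<Rightarrow> real) \<Rightarrow> bool" where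
  "mCZ_kernel m K \<omega> \<longleftrightarrow> modulus \<omega> \<and>
     (\<forall>x y y'. (\<forall>i<m. y i = y' i) \<longrightarrow> K x y = K x y') \<and>
     (\<exists>C. (\<forall>x y. off_diag m x y \<longrightarrow>
              norm (K x y) \<le> C / ssum_dist m x y ^ (m * DIM('a))) \<and>
          (\<forall>x y h. off_diag m x y \<longrightarrow> norm h \<le> 1/2 * Max ((\<lambda>i. dist x (y i)) ` {..<m}) \<longrightarrow>
              norm (K (x + h) y - K x y) + (\<Sum>i<m. norm (K x (y(i := y i + h)) - K x y))
                \<le> C / ssum_dist m x y ^ (m * DIM('a)) * \<omega> (norm h / ssum_dist m x y)))"

definition multilinear_op :: "nat \<Rightarrow> ((nat \<Rightarrow> 'a::euclidean_space \<Rightarrow> complex) \<Rightarrow> 'a \<Rightarrow> complex) \<Rightarrow> bool" where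
  "multilinear_op m T \<longleftrightarrow> (\<forall>i<m. \<forall>f g h c.
     T (f(i := (\<lambda>x. g x + h x))) = (\<lambda>x. T (f(i := g)) x + T (f(i := h)) x) \<and>
     T (f(i := (\<lambda>x. c * g x))) = (\<lambda>x. c * T (f(i := g)) x))"

definition bounded_op :: "nat \<Rightarrow> (nat \<Rightarrow> ereal) \<Rightarrow> real \<Rightarrow>
    ((nat \<Rightarrow> 'a::euclidean_space \<Rightarrow> complex) \<Rightarrow> 'a \<Rightarrow> complex) \<Rightarrow> bool" where
  "bounded_op m q s T \<longleftrightarrow> (\<exists>C. \<forall>f. (\<forall>i<m. in_Lq (q i) (f i)) \<longrightarrow>
     in_Lp s (T f) \<and> Lp_norm s (T f) \<le> C * (\<Prod>i<m. Lq_norm (q i) (f i)))"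

definition kernel_integral :: "nat \<Rightarrow> ('a::euclidean_space \<Rightarrow> (nat \<Rightarrow> 'a) \<Rightarrow> complex) \<Rightarrow>
    (nat \<Rightarrow> 'a \<Rightarrow> complex) \<Rightarrow> 'a \<Rightarrow> complex" where
  "kernel_integral m K f x =
     (\<integral> y. K x y * (\<Prod>i<m. f i (y i)) \<partial>(PiM {..<m} (\<lambda>_. (lebesgue :: 'a measure))))"

definition mCZO :: "nat \<Rightarrow> (nat \<Rightarrow> ereal) \<Rightarrow> real \<Rightarrow>
    ((nat \<Rightarrow> 'a::euclidean_space \<Rightarrow> complex) \<Rightarrow> 'a \<Rightarrow> complex) \<Rightarrow>
    ('a \<Rightarrow> (nat \<Rightarrow> 'a) \<Rightarrow> complex) \<Rightarrow> (real \<Rightarrow> real) \<Rightarrow> bool" where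
  "mCZO m q s T K \<omega> \<longleftrightarrow>
     (\<forall>i<m. 1 < q i) \<and> 0 < s \<and> 1 / s = (\<Sum>i<m. inv_exp (q i)) \<and>
     multilinear_op m T \<and> bounded_op m q s T \<and> mCZ_kernel m K \<omega> \<and>
     (\<forall>f x. (\<forall>i<m. Cc_inf (f i)) \<longrightarrow> x \<notin> (\<Inter>i<m. fsupp (f i)) \<longrightarrow>
        T f x = kernel_integral m K f x)"

definition nondeg_mCZO :: "nat \<Rightarrow> (nat \<Rightarrow> ereal) \<Rightarrow> real \<Rightarrow>
    ((nat \<Rightarrow> 'a::euclidean_space \<Rightarrow> complex) \<Rightarrow> 'a \<Rightarrow> complex) \<Rightarrow>
    ('a \<Rightarrow> (nat \<Rightarrow> 'a) \<Rightarrow> complex) \<Rightarrow> (real \<Rightarrow> real) \<Rightarrow> bool" where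
  "nondeg_mCZO m q s T K \<omega> \<longleftrightarrow> mCZO m q s T K \<omega> \<and> (\<omega> \<longlongrightarrow> 0) (at_right 0) \<and>
     (\<exists>c0>0. \<forall>y \<rho>. 0 < \<rho> \<longrightarrow>
        (\<exists>x. dist x y \<ge> \<rho> \<and> norm (K x (\<lambda>_. y)) \<ge> 1 / (c0 * \<rho> ^ (m * DIM('a)))))"

definition kernel_rep_L1c :: "nat \<Rightarrow> ((nat \<Rightarrow> 'a::euclidean_space \<Rightarrow> complex) \<Rightarrow> 'a \<Rightarrow> complex) \<Rightarrow>
    ('a \<Rightarrow> (nat \<Rightarrow> 'a) \<Rightarrow> complex) \<Rightarrow> bool" where
  "kernel_rep_L1c m T K \<longleftrightarrow>
     (\<forall>f x. (\<forall>i<m. L1c (f i)) \<longrightarrow> x \<notin> (\<Inter>i<m. fsupp (f i)) \<longrightarrow>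
        T f x = kernel_integral m K f x)"

definition commutator1 :: "('a::euclidean_space \<Rightarrow> real) \<Rightarrow>
    ((nat \<Rightarrow> 'a \<Rightarrow> complex) \<Rightarrow> 'a \<Rightarrow> complex) \<Rightarrow> (nat \<Rightarrow> 'a \<Rightarrow> complex) \<Rightarrow> 'a \<Rightarrow> complex" where
  "commutator1 b T f = (\<lambda>x. complex_of_real (b x) * T f x
                             - T (f(0 := (\<lambda>y. complex_of_real (b y) * f 0 y))) x)"

definition comm_bounded :: "nat \<Rightarrow> (nat \<Rightarrow> real) \<Rightarrow> real \<Rightarrow> ('a::euclidean_space \<Rightarrow> real) \<Rightarrow>
    ((nat \<Rightarrow> 'a \<Rightarrow> complex) \<Rightarrow> 'a \<Rightarrow> complex) \<Rightarrow> bool" where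
  "comm_bounded m p q b T \<longleftrightarrow> (\<exists>C. \<forall>f. (\<forall>i<m. Cc_inf (f i)) \<longrightarrow>
     in_Lp q (commutator1 b T f) \<and>
     Lp_norm q (commutator1 b T f) \<le> C * (\<Prod>i<m. Lp_norm (p i) (f i)))"

end

theory Submission
  imports Defs
begin

text \<open>
  On a cube, non-degeneracy provides a companion cube of comparable size and distance on which \<open>K\<close> is almost
  constant. Splitting both at a median of \<open>b\<close>, one finds \<open>g\<close> and test functions \<open>f\<^sub>i\<close> with
  \<open>\<integral>\<bar>b - \<alpha>\<bar> \<le> C Re \<integral> g [b,T]\<^sub>1(f\<^sub>1,\<dots>,f\<^sub>m)\<close>, the integral on the left being over the cube.

  For a Carleson family of cubes \<open>Q\<close> of side \<open>l\<^sub>Q\<close> with weights \<open>t\<^sub>Q\<close>, choose signs so that a single tuple of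
  signed sums of test functions dominates the sum of these pairings. Boundedness of the commutator, Hoelder's
  inequality and the Carleson embedding then give
  \<open>\<Sum> t\<^sub>Q powr (r - 1) * \<integral>\<^sub>Q \<bar>b - \<alpha>\<^sub>Q\<bar> \<le> C (\<Sum> t\<^sub>Q powr r * l\<^sub>Q ^ n) powr (1 - 1/r)\<close>.

  Apply this to the Calderon--Zygmund cubes of \<open>\<bar>b - b\<^sub>0\<bar>\<close> inside a cube, \<open>b\<^sub>0\<close> being the mean of \<open>b\<close>, at heights
  \<open>t\<^sub>Q\<close> growing geometrically. The left side dominates the energy \<open>A = \<Sum> t\<^sub>Q powr r * l\<^sub>Q ^ n\<close>, so
  \<open>A \<le> C A powr (1 - 1/r)\<close> and \<open>A\<close> is bounded independently of the cube and of the number of generations. As \<open>A\<close>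
  controls the \<open>L\<^sup>r\<close> norm of the dyadic means of \<open>\<bar>b - b\<^sub>0\<bar>\<close>, Fatou's lemma bounds \<open>b - b\<^sub>0\<close> in \<open>L\<^sup>r\<close> of the cube.
  Finally the cube exhausts the space, along which the means \<open>b\<^sub>0\<close> stay bounded.
\<close>

section \<open>Smooth bumps and approximation\<close>

text \<open>Boundedness is available only on smooth compactly supported tuples, while the natural
  test function in the first argument is the indicator of the rough set where \<open>b\<close> lies
  on one side of a median. It is replaced by a smooth function living on twice the cube; as
  \<open>b\<close> is merely locally integrable, the error is measured in L^1 with weight 1 + |b|,
  and the sup bound 2 must survive because the Carleson embedding uses it. The other arguments never
  meet \<open>b\<close>, so a fixed bump serves there. The median is that of \<open>b\<close> on the
  companion ball: whichever side dominates on the cube, at least half of the ball lies on the other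
  one.

  The powers of the heights come from one identity: with 1/q + 1/q' = 1 one has 1/q' + 1/p = 1 -
  1/r, so t^(r-1) splits as t^(r/q') times the product of the t^(r/p_i), and each factor, summed
  over the family in its own Lebesgue space, is controlled by the same energy, the sum of t^r times
  the volumes. Passing from E \<le> C E^(1-1/r) to a bound on E needs E finite beforehand, which is
  why only finitely many generations of cells enter and the limit is taken last.\<close>

definition exp_flat :: "nat \<Rightarrow> real \<Rightarrow> real" where
  "exp_flat k t = (if 0 < t then exp (- 1 / t) / t ^ k else 0)"

lemma exp_flat_nonneg: "0 \<le> exp_flat k t"
  by (simp add: exp_flat_def)

text \<open>A single term of the exponential series at 1/t, the one of degree \<open>Suc k\<close>,
  is enough. The linear rate is what the difference quotient at 0 needs.\<close>

lemma exp_flat_le: "exp_flat k t \<le> fact (Suc k) * \<bar>t\<bar>"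
proof (cases "0 < t")
  case True
  have "(1 / t) ^ Suc k /\<^sub>R fact (Suc k) \<le> exp (1 / t)"
    using sum_le_suminf[OF summable_exp_generic[of "1/t"], of "{Suc k}"] True
    by (simp add: exp_def)
  moreover have "(1 / t) ^ Suc k /\<^sub>R fact (Suc k) = 1 / (fact (Suc k) * t ^ Suc k)"
    by (simp add: power_divide divide_inverse power_inverse)
  moreover have "0 < fact (Suc k) * t ^ Suc k" using True by simp
  ultimately have "1 \<le> exp (1/t) * (fact (Suc k) * t ^ Suc k)"
    by (metis divide_le_eq)
  then have "exp (-1/t) \<le> fact (Suc k) * t ^ Suc k"
    using True by (simp add: exp_minus field_simps)
  then show ?thesis
    using True by (simp add: exp_flat_def field_simps)
next
  case False
  then show ?thesis by (simp only: exp_flat_def if_False) (intro mult_nonneg_nonneg fact_ge_zero abs_ge_zero)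
qed

text \<open>The factor \<open>t ^ k\<close> in \<open>exp_flat\<close> makes the family closed under
  differentiation, up to linear combinations, so higher derivatives come for free. At 0 the
  difference quotient of one member is the next member, which tends to 0.\<close>

lemma has_real_derivative_exp_flat:
  "(exp_flat k has_real_derivative (exp_flat (k + 2) t - k * exp_flat (k + 1) t)) (at t)"
proof -
  consider "t > 0" | "t < 0" | "t = 0" by linarith
  then show ?thesis
  proof cases
    case 1
    have "((\<lambda>t. exp (- 1 / t) / t ^ k) has_real_derivative
        (exp_flat (k + 2) t - k * exp_flat (k + 1) t)) (at t)"
      apply (rule derivative_eq_intros refl | use 1 in force)+
      using 1 by (cases k) (auto simp: exp_flat_def field_simps power2_eq_square)
    then show ?thesis
      by (rule has_field_derivative_transform_within_open[where S = "{0<..}"])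
        (use 1 in \<open>auto simp: exp_flat_def\<close>)
  next
    case 2
    have "((\<lambda>t. 0) has_real_derivative (exp_flat (k + 2) t - k * exp_flat (k + 1) t)) (at t)"
      using 2 by (auto simp: exp_flat_def)
    then show ?thesis
      by (rule has_field_derivative_transform_within_open[where S = "{..<0}"])
        (use 2 in \<open>auto simp: exp_flat_def\<close>)
  next
    case 3
    have "(exp_flat (Suc k) \<longlongrightarrow> 0) (at 0)"
    proof (rule tendsto_sandwich[where f = "\<lambda>_. 0" and h = "\<lambda>t. fact (Suc (Suc k)) * \<bar>t\<bar>"])
      show "((\<lambda>t::real. fact (Suc (Suc k)) * \<bar>t\<bar>) \<longlongrightarrow> 0) (at 0)"
        by (auto intro!: tendsto_eq_intros)
    qed (auto intro!: always_eventually exp_flat_nonneg exp_flat_le simp del: fact_Suc)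
    moreover have "(exp_flat k (0 + h) - exp_flat k 0) / h = exp_flat (Suc k) h" for h
      by (simp add: exp_flat_def)
    ultimately show ?thesis
      unfolding DERIV_def 3 by (simp del: add_0) (simp add: exp_flat_def[of _ 0])
  qed
qed

text \<open>\<open>smooth_fun\<close> asks for all iterated partial derivatives. A set generated by
  a few functions, closed under sums and products and under directional derivatives, gives this by
  induction on the list of directions, while being rich enough to contain the bumps and all
  polynomials.\<close>

inductive_set smooth_alg :: "('a::euclidean_space \<Rightarrow> real) set" where
  const: "(\<lambda>x. c) \<in> smooth_alg"
| coord: "(\<lambda>x. x \<bullet> v) \<in> smooth_alg"
| flat: "(\<lambda>x. exp_flat k (x \<bullet> v + c)) \<in> smooth_alg"
| add: "f \<in> smooth_alg \<Longrightarrow> g \<in> smooth_alg \<Longrightarrow> (\<lambda>x. f x + g x) \<in> smooth_alg"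
| mult: "f \<in> smooth_alg \<Longrightarrow> g \<in> smooth_alg \<Longrightarrow> (\<lambda>x. f x * g x) \<in> smooth_alg"

lemma smooth_alg_has_derivative:
  assumes "f \<in> smooth_alg"
  shows "\<exists>D. (\<forall>v. D v \<in> smooth_alg) \<and> (\<forall>x. (f has_derivative (\<lambda>v. D v x)) (at x))"
  using assms
proof induction
  case (const c)
  show ?case
    by (intro exI[of _ "\<lambda>v x. 0"] conjI allI smooth_alg.const has_derivative_const)
next
  case (coord v)
  show ?case
    by (intro exI[of _ "\<lambda>h x. h \<bullet> v"] conjI allI smooth_alg.const
        bounded_linear_imp_has_derivative bounded_linear_inner_left)
next
  case (flat k v c)
  have "((\<lambda>x. exp_flat k (x \<bullet> v + c)) has_derivative
      (\<lambda>h. (h \<bullet> v) * (exp_flat (k + 2) (x \<bullet> v + c) + (- real k) * exp_flat (k + 1) (x \<bullet> v + c)))) (at x)" for x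
  proof -
    have "((\<lambda>x. x \<bullet> v + c) has_derivative (\<lambda>h. h \<bullet> v)) (at x)"
      by (auto intro!: derivative_eq_intros)
    from has_derivative_compose[OF this
        has_real_derivative_exp_flat[of k, unfolded has_field_derivative_def]]
    show ?thesis by (simp add: mult.commute)
  qed
  moreover have "(\<lambda>x. (h \<bullet> v) * (exp_flat (k + 2) (x \<bullet> v + c)
          + (- real k) * exp_flat (k + 1) (x \<bullet> v + c))) \<in> smooth_alg" for h
    by (intro smooth_alg.intros)
  ultimately show ?case
    by (intro exI[of _ "\<lambda>h x. (h \<bullet> v) * (exp_flat (k + 2) (x \<bullet> v + c)
          + (- real k) * exp_flat (k + 1) (x \<bullet> v + c))"]) blast
next
  case (add f g)
  then obtain D E where "\<And>v. D v \<in> smooth_alg" "\<And>x. (f has_derivative (\<lambda>v. D v x)) (at x)"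
    "\<And>v. E v \<in> smooth_alg" "\<And>x. (g has_derivative (\<lambda>v. E v x)) (at x)" by metis
  then show ?case
    by (intro exI[of _ "\<lambda>v x. D v x + E v x"]) (simp add: smooth_alg.add has_derivative_add)
next
  case (mult f g)
  then obtain D E where "\<And>v. D v \<in> smooth_alg" "\<And>x. (f has_derivative (\<lambda>v. D v x)) (at x)"
    "\<And>v. E v \<in> smooth_alg" "\<And>x. (g has_derivative (\<lambda>v. E v x)) (at x)" by metis
  with mult.hyps show ?case
    by (intro exI[of _ "\<lambda>v x. f x * E v x + D v x * g x"])
      (auto simp: smooth_alg.add smooth_alg.mult intro!: has_derivative_mult)
qed

lemma continuous_on_smooth_alg: "f \<in> smooth_alg \<Longrightarrow> continuous_on S f"
  by (metis smooth_alg_has_derivative has_derivative_continuous continuous_at_imp_continuous_on)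

lemma smooth_fun_smooth_alg:
  assumes "f \<in> smooth_alg"
  shows "smooth_fun (\<lambda>x. complex_of_real (f x))"
proof -
  have "\<exists>g\<in>smooth_alg. fold partial_dir vs (\<lambda>x. complex_of_real (f x)) = (\<lambda>x. complex_of_real (g x))" for vs
    using assms
  proof (induction vs arbitrary: f)
    case (Cons v vs)
    obtain D where D: "\<And>v. D v \<in> smooth_alg" "\<And>x. (f has_derivative (\<lambda>v. D v x)) (at x)"
      using smooth_alg_has_derivative[OF Cons.prems] by metis
    have "((\<lambda>x. complex_of_real (f x)) has_derivative (\<lambda>v. complex_of_real (D v x))) (at x)" for x
      by (rule has_derivative_of_real[OF D(2)])
    then have "partial_dir v (\<lambda>x. complex_of_real (f x)) = (\<lambda>x. complex_of_real (D v x))"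
      unfolding partial_dir_def by (metis frechet_derivative_at)
    with Cons.IH[OF D(1)] show ?case by simp
  qed auto
  moreover have "(\<lambda>x. complex_of_real (g x)) differentiable (at x)" if "g \<in> smooth_alg" for g x
    using smooth_alg_has_derivative[OF that] has_derivative_of_real
    unfolding differentiable_def by blast
  ultimately show ?thesis
    unfolding smooth_fun_def by metis
qed

lemma smooth_alg_sum:
  assumes "\<And>i. i \<in> I \<Longrightarrow> f i \<in> smooth_alg"
  shows "(\<lambda>x. \<Sum>i\<in>I. f i x) \<in> smooth_alg"
  using assms
  by (induction I rule: infinite_finite_induct) (simp_all add: smooth_alg.const smooth_alg.add)

lemma smooth_alg_prod:
  assumes "\<And>i. i \<in> I \<Longrightarrow> f i \<in> smooth_alg"
  shows "(\<lambda>x. \<Prod>i\<in>I. f i x) \<in> smooth_alg"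
  using assms
  by (induction I rule: infinite_finite_induct) (simp_all add: smooth_alg.const smooth_alg.mult)

lemma smooth_alg_real_polynomial_function:
  assumes "real_polynomial_function p"
  shows "p \<in> smooth_alg"
  using assms
proof induction
  case (linear f)
  have "f = (\<lambda>x. x \<bullet> (\<Sum>i\<in>Basis. f i *\<^sub>R i))"
  proof
    fix x
    interpret bounded_linear f by fact
    have "f x = f (\<Sum>i\<in>Basis. (x \<bullet> i) *\<^sub>R i)" by (simp add: euclidean_representation)
    also have "\<dots> = x \<bullet> (\<Sum>i\<in>Basis. f i *\<^sub>R i)"
      by (simp add: sum scale inner_sum_right mult.commute)
    finally show "f x = x \<bullet> (\<Sum>i\<in>Basis. f i *\<^sub>R i)" .
  qed
  then show ?case by (metis smooth_alg.coord)
qed (simp_all add: smooth_alg.const smooth_alg.add smooth_alg.mult)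

section \<open>Cubes, bumps and smooth approximation of indicators\<close>

definition cube :: "'a::euclidean_space \<Rightarrow> real \<Rightarrow> 'a set" where
  "cube c l = {x. \<forall>i\<in>Basis. \<bar>(x - c) \<bullet> i\<bar> \<le> l / 2}"

text \<open>Each coordinate s of (x - c) / l contributes
  \<open>exp_flat 0 (1 + s) * exp_flat 0 (1 - s)\<close>, as in \<open>bump_alt\<close>; for
  positive \<open>l\<close> the product is positive exactly in the interior of
  \<open>cube c (2 * l)\<close>. The arguments are spelled as inner product plus constant to match
  the rule \<open>flat\<close>.\<close>

definition bump :: "'a::euclidean_space \<Rightarrow> real \<Rightarrow> 'a \<Rightarrow> real" where
  "bump c l x = (\<Prod>i\<in>Basis. exp_flat 0 (x \<bullet> (i /\<^sub>R l) + (1 - (c \<bullet> i) / l))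
     * exp_flat 0 (x \<bullet> (- i /\<^sub>R l) + (1 + (c \<bullet> i) / l)))"

text \<open>On \<open>cube c l\<close> the rescaled coordinates are at most 1/2 in modulus, so each
  of the two factors per coordinate is at least exp(-2). The bound depends on the dimension alone,
  not on centre or side.\<close>

definition bump_min :: "'a::euclidean_space itself \<Rightarrow> real" where
  "bump_min _ = exp (- 4) ^ DIM('a)"

lemma cube_eq_cbox: "cube c l = cbox (c - (l/2) *\<^sub>R One) (c + (l/2) *\<^sub>R One)"
proof -
  have "\<bar>u - v\<bar> \<le> l / 2 \<longleftrightarrow> v - l / 2 \<le> u \<and> u \<le> v + l / 2" for u v :: real by linarith
  then show ?thesis
    by (simp add: cube_def cbox_def inner_diff_left inner_add_left set_eq_iff)
qed

lemma compact_cube: "compact (cube c l)"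
  by (simp add: cube_eq_cbox)

lemma measure_cube: "l \<ge> 0 \<Longrightarrow> measure lebesgue (cube c l) = l ^ DIM('a)" for c :: "'a::euclidean_space"
  by (simp add: cube_eq_cbox content_cbox_if box_eq_empty inner_diff_left inner_add_left
      not_less algebra_simps)

lemma cube_subset_cball:
  fixes c :: "'a::euclidean_space"
  shows "cube c (2 * l) \<subseteq> cball c (real DIM('a) * l)"
proof
  fix x assume x: "x \<in> cube c (2 * l)"
  have "norm (x - c) \<le> (\<Sum>i\<in>Basis. \<bar>(x - c) \<bullet> i\<bar>)" by (rule norm_le_l1)
  also have "\<dots> \<le> (\<Sum>i\<in>(Basis::'a set). l)" using x by (intro sum_mono) (auto simp: cube_def)
  finally show "x \<in> cball c (real DIM('a) * l)" by (simp add: dist_norm norm_minus_commute)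
qed

lemma cube_mono: "l \<le> l' \<Longrightarrow> cube c l \<subseteq> cube c l'"
proof
  fix x assume "l \<le> l'" "x \<in> cube c l"
  then show "x \<in> cube c l'" unfolding cube_def by fastforce
qed

lemma exp_flat_0_le: "exp_flat 0 t \<le> 1"
  by (simp add: exp_flat_def)

lemma exp_flat_0_ge: "1/2 \<le> t \<Longrightarrow> exp (-2) \<le> exp_flat 0 t"
  by (simp add: exp_flat_def field_simps)

lemma bump_bounds: "0 \<le> bump c l x" "bump c l x \<le> 1"
  unfolding bump_def
  by (auto intro!: prod_nonneg prod_le_1 mult_nonneg_nonneg mult_le_one
      simp: exp_flat_nonneg exp_flat_0_le)

lemma smooth_alg_bump: "bump c l \<in> smooth_alg"
  unfolding bump_def by (intro smooth_alg_prod smooth_alg.intros)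

lemma bump_alt:
  "bump c l x = (\<Prod>i\<in>Basis. exp_flat 0 (1 + (x - c) \<bullet> i / l) * exp_flat 0 (1 - (x - c) \<bullet> i / l))"
proof -
  have "x \<bullet> (i /\<^sub>R l) + (1 - (c \<bullet> i) / l) = 1 + (x - c) \<bullet> i / l"
    "x \<bullet> (- i /\<^sub>R l) + (1 + (c \<bullet> i) / l) = 1 - (x - c) \<bullet> i / l" for i
    by (simp_all add: inner_diff_left divide_inverse_commute right_diff_distrib)
  then show ?thesis unfolding bump_def by presburger
qed

lemma bump_ge:
  fixes c :: "'a::euclidean_space"
  assumes "0 < l" "x \<in> cube c l"
  shows "bump_min TYPE('a) \<le> bump c l x"
proof -
  have "(\<Prod>i\<in>(Basis::'a set). exp (-2) * exp (-2)) \<le> bump c l x"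
    unfolding bump_alt
  proof (intro prod_mono conjI mult_mono exp_flat_0_ge)
    fix i :: 'a assume "i \<in> Basis"
    then have "\<bar>(x - c) \<bullet> i\<bar> \<le> l / 2" using assms by (auto simp: cube_def)
    then have "\<bar>(x - c) \<bullet> i / l\<bar> \<le> 1 / 2" using assms by (simp add: field_simps)
    then show "1/2 \<le> 1 + (x - c) \<bullet> i / l" "1/2 \<le> 1 - (x - c) \<bullet> i / l"
      unfolding abs_le_iff by linarith+
  qed (auto simp: exp_flat_nonneg)
  moreover have "exp (-2) * exp (-2) = (exp (-4) :: real)"
    by (simp flip: exp_add)
  ultimately show ?thesis by (simp add: bump_min_def)
qed

lemma bump_min_pos: "0 < bump_min TYPE('a::euclidean_space)"
  by (simp add: bump_min_def)

lemma bump_eq_0: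
  assumes "0 < l" "x \<notin> cube c (2 * l)"
  shows "bump c l x = 0"
proof -
  obtain i where i: "i \<in> Basis" "\<bar>(x - c) \<bullet> i\<bar> > l" using assms by (auto simp: cube_def)
  then have "\<bar>(x - c) \<bullet> i / l\<bar> > 1" using assms by (simp add: field_simps)
  then have "exp_flat 0 (1 + (x - c) \<bullet> i / l) * exp_flat 0 (1 - (x - c) \<bullet> i / l) = 0"
    by (auto simp: exp_flat_def)
  then show ?thesis unfolding bump_alt using i(1) by (intro prod_zero) auto
qed

lemma fsupp_subset: "closed S \<Longrightarrow> (\<And>x. x \<notin> S \<Longrightarrow> f x = 0) \<Longrightarrow> fsupp f \<subseteq> S"
  unfolding fsupp_def by (intro closure_minimal subsetI) (metis mem_Collect_eq)

lemma Cc_inf_smooth_alg: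
  assumes "f \<in> smooth_alg" "compact S" "\<And>x. x \<notin> S \<Longrightarrow> f x = 0"
  shows "Cc_inf (\<lambda>x. complex_of_real (f x))"
  unfolding Cc_inf_def
proof
  have "fsupp (\<lambda>x. complex_of_real (f x)) \<subseteq> S"
    using assms by (intro fsupp_subset) (auto simp: compact_imp_closed)
  then show "compact (fsupp (\<lambda>x. complex_of_real (f x)))"
    using compact_Int_closed[OF assms(2), of "fsupp (\<lambda>x. complex_of_real (f x))"]
    by (simp add: inf.absorb2 fsupp_def)
qed (rule smooth_fun_smooth_alg[OF assms(1)])

lemma borel_measurable_lebesgue_continuous:
  fixes f :: "'a::euclidean_space \<Rightarrow> 'b::topological_space"
  assumes "continuous_on UNIV f"
  shows "f \<in> borel_measurable lebesgue"
  using borel_measurable_continuous_onI[OF assms]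
  by (intro measurable_completion) (simp add: measurable_lborel1)

text \<open>Polynomials approximate well on a compact cube but do not vanish outside it. Hence the
  quotient of the indicator by the bump is approximated and the result multiplied by the bump, which
  is bounded below on \<open>F\<close>. Pointwise convergence with a uniform bound becomes
  convergence against the weight \<open>w\<close> by dominated convergence.\<close>

lemma smooth_approx_indicator:
  fixes c :: "'a::euclidean_space"
  assumes l: "0 < l" and F: "F \<in> sets lebesgue" "F \<subseteq> cube c l" and e: "0 < \<epsilon>"
    and w: "integrable lebesgue w" "\<And>x. 0 \<le> w x"
  obtains \<phi> where "\<phi> \<in> smooth_alg" "\<And>x. \<bar>\<phi> x\<bar> \<le> 2" "\<And>x. x \<notin> cube c (2 * l) \<Longrightarrow> \<phi> x = 0"
    "(\<integral>x. \<bar>\<phi> x - indicator F x\<bar> * w x \<partial>lebesgue) < \<epsilon>"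
proof -
  define \<delta> where "\<delta> = bump_min TYPE('a)"
  have \<delta>: "0 < \<delta>" unfolding \<delta>_def by (rule bump_min_pos)
  define S where "S = cube c (2 * l)"
  \<comment> \<open>Cutting the bump off from below makes the division harmless everywhere; on
    \<open>F\<close> the cut-off changes nothing because of \<open>bump_ge\<close>.\<close>
  define M where "M x = max (bump c l x) \<delta>" for x
  have M: "0 < M x" "bump c l x \<le> M x" for x using \<delta> by (auto simp: M_def)
  have contb: "continuous_on UNIV (bump c l)" by (rule continuous_on_smooth_alg[OF smooth_alg_bump])
  then have contM: "continuous_on UNIV M" unfolding M_def by (intro continuous_intros)
  define u where "u x = indicator F x / M x" for x
  have "u \<in> borel_measurable lebesgue"
    unfolding u_def using F borel_measurable_lebesgue_continuous[OF contM] by simp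
  then have "u measurable_on UNIV"
    by (intro lebesgue_measurable_imp_measurable_on_nnreal_UNIV) (auto simp: u_def M(1) less_imp_le)
  then obtain N g where N: "negligible N" and g: "\<And>n. continuous_on UNIV (g n)"
    and lim: "\<And>x. x \<notin> N \<Longrightarrow> (\<lambda>n. g n x) \<longlonglongrightarrow> u x"
    unfolding measurable_on_def by auto
  \<comment> \<open>Clamping to [0, 1/M] keeps bump times \<open>h\<close> at most 1 and leaves the
    limit \<open>u\<close> alone. With a polynomial error of at most 1 the final product stays at
    most 2.\<close>
  define h where "h n x = max 0 (min (g n x) (1 / M x))" for n :: nat and x
  have conth: "continuous_on S (h n)" for n
    unfolding h_def using g contM M(1)
    by (intro continuous_intros) (auto intro: continuous_on_subset simp: less_imp_neq[symmetric])
  have "\<exists>p. real_polynomial_function p \<and> (\<forall>x\<in>S. \<bar>h n x - p x\<bar> < inverse (Suc n))" for n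
    using Stone_Weierstrass_real_polynomial_function[OF _ conth, of "inverse (Suc n)"]
    by (metis S_def compact_cube inverse_positive_iff_positive of_nat_0_less_iff zero_less_Suc)
  then obtain p where p: "\<And>n. real_polynomial_function (p n)"
      "\<And>n x. x \<in> S \<Longrightarrow> \<bar>h n x - p n x\<bar> < inverse (Suc n)" by metis
  define \<phi> where "\<phi> n x = bump c l x * p n x" for n x
  have \<phi>: "\<phi> n \<in> smooth_alg" for n
    unfolding \<phi>_def by (intro smooth_alg.mult smooth_alg_bump smooth_alg_real_polynomial_function p)
  have \<phi>0: "\<phi> n x = 0" if "x \<notin> S" for n x
    using bump_eq_0[OF l that[unfolded S_def]] by (simp add: \<phi>_def)
  have \<phi>2: "\<bar>\<phi> n x\<bar> \<le> 2" for n x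
  proof (cases "x \<in> S")
    case True
    have "inverse (real (Suc n)) \<le> 1" by (simp add: inverse_le_1_iff)
    then have "\<bar>p n x\<bar> \<le> \<bar>h n x\<bar> + 1" using p(2)[OF True, of n] by linarith
    also have "\<bar>h n x\<bar> \<le> 1 / M x" using M(1)[of x] by (simp add: h_def max_def min_def)
    finally have "\<bar>\<phi> n x\<bar> \<le> bump c l x * (1 / M x + 1)"
      unfolding \<phi>_def abs_mult using bump_bounds[of c l x] by (auto intro: mult_left_mono)
    also have "\<dots> = bump c l x / M x + bump c l x" by (simp add: algebra_simps)
    also have "\<dots> \<le> 1 + 1" using M bump_bounds[of c l x] by (intro add_mono) auto
    finally show ?thesis by simp
  qed (simp add: \<phi>0)
  have \<phi>lim: "(\<lambda>n. \<phi> n x) \<longlonglongrightarrow> indicator F x" if "x \<notin> N" for x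
  proof (cases "x \<in> S")
    case True
    have "(\<lambda>n. h n x) \<longlonglongrightarrow> max 0 (min (u x) (1 / M x))"
      unfolding h_def by (intro tendsto_intros lim that)
    also have "max 0 (min (u x) (1 / M x)) = u x"
      using M(1)[of x] by (auto simp: u_def indicator_def)
    finally have "(\<lambda>n. h n x) \<longlonglongrightarrow> u x" .
    moreover have "(\<lambda>n. h n x - p n x) \<longlonglongrightarrow> 0"
      using p(2)[OF True] by (intro Lim_null_comparison[OF _ LIMSEQ_inverse_real_of_nat])
        (auto intro!: always_eventually less_imp_le)
    ultimately have "(\<lambda>n. h n x - (h n x - p n x)) \<longlonglongrightarrow> u x - 0" by (rule tendsto_diff)
    then have "(\<lambda>n. \<phi> n x) \<longlonglongrightarrow> bump c l x * u x"
      unfolding \<phi>_def by (intro tendsto_mult_left) simp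
    also have "bump c l x * u x = indicator F x"
    proof (cases "x \<in> F")
      case True
      then have "\<delta> \<le> bump c l x" using bump_ge[OF l, of x c] F(2) by (auto simp: \<delta>_def)
      then show ?thesis using True \<delta> by (simp add: u_def M_def)
    qed (simp add: u_def)
    finally show ?thesis .
  next
    case False
    moreover have "x \<notin> F" using False F(2) cube_mono[of l "2 * l" c] l by (auto simp: S_def)
    ultimately show ?thesis by (simp add: \<phi>0)
  qed
  have meas: "(\<lambda>x. \<bar>\<phi> n x - indicator F x\<bar> * w x) \<in> borel_measurable lebesgue" for n
    using F borel_measurable_lebesgue_continuous[OF continuous_on_smooth_alg[OF \<phi>[of n]]] w(1)
    by simp
  have "(\<lambda>n. \<integral>x. \<bar>\<phi> n x - indicator F x\<bar> * w x \<partial>lebesgue) \<longlonglongrightarrow> integral\<^sup>L lebesgue (\<lambda>x::'a. 0)"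
  proof (rule integral_dominated_convergence[where w = "\<lambda>x. 3 * w x"])
    show "AE x in lebesgue. (\<lambda>n. \<bar>\<phi> n x - indicator F x\<bar> * w x) \<longlonglongrightarrow> 0"
    proof (rule AE_I')
      show "N \<in> null_sets lebesgue" using N by (simp add: negligible_iff_null_sets)
      show "{x \<in> space lebesgue. \<not> (\<lambda>n. \<bar>\<phi> n x - indicator F x\<bar> * w x) \<longlonglongrightarrow> 0} \<subseteq> N"
        using \<phi>lim by (auto intro!: tendsto_mult_left_zero tendsto_rabs_zero simp: LIM_zero)
    qed
    have "\<bar>\<phi> n x - indicator F x\<bar> \<le> 3" for n x
      using \<phi>2[of n x] by (auto simp: indicator_def)
    then show "AE x in lebesgue. norm (\<bar>\<phi> n x - indicator F x\<bar> * w x) \<le> 3 * w x" for n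
      using w(2) by (auto intro!: mult_right_mono simp: abs_mult)
  qed (use meas w in auto)
  then have "eventually (\<lambda>n. (\<integral>x. \<bar>\<phi> n x - indicator F x\<bar> * w x \<partial>lebesgue) < \<epsilon>) sequentially"
    using e by (simp add: order_tendstoD(2))
  then obtain n where "(\<integral>x. \<bar>\<phi> n x - indicator F x\<bar> * w x \<partial>lebesgue) < \<epsilon>"
    by (auto simp: eventually_sequentially)
  then show ?thesis using that[of "\<phi> n"] \<phi> \<phi>2 \<phi>0 unfolding S_def by blast
qed

section \<open>Carleson embedding\<close>

text \<open>The factor on \<open>b powr t\<close> can be any \<open>\<beta>\<close> above 1 at the
  price of a large factor on the other term: either \<open>a\<close> is at most
  \<open>\<eta> * b\<close>, with \<open>(1 + \<eta>) powr t = \<beta>\<close>, or \<open>b\<close>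
  is at most \<open>a / \<eta>\<close>. A factor close to 1 is essential when sums are built up one
  term at a time.\<close>

lemma powr_add_le_weighted:
  fixes \<beta> t :: real
  assumes "1 < \<beta>" "1 < t"
  obtains C where "0 < C" "\<And>a b. 0 \<le> a \<Longrightarrow> 0 \<le> b \<Longrightarrow> (a + b) powr t \<le> C * a powr t + \<beta> * b powr t"
proof
  define \<eta> where "\<eta> = \<beta> powr (1 / t) - 1"
  have \<eta>: "0 < \<eta>" using assms by (simp add: \<eta>_def)
  have \<beta>: "(1 + \<eta>) powr t = \<beta>" using assms by (simp add: \<eta>_def powr_powr)
  show "0 < (1 + 1 / \<eta>) powr t" using \<eta> by (simp add: add_pos_pos less_imp_neq[symmetric])
  fix a b :: real assume ab: "0 \<le> a" "0 \<le> b"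
  show "(a + b) powr t \<le> (1 + 1 / \<eta>) powr t * a powr t + \<beta> * b powr t"
  proof (cases "a \<le> \<eta> * b")
    case True
    then have "(a + b) powr t \<le> ((1 + \<eta>) * b) powr t"
      using ab assms by (intro powr_mono2) (auto simp: algebra_simps)
    also have "\<dots> = \<beta> * b powr t" using \<beta> \<eta> ab by (simp add: powr_mult)
    finally show ?thesis by (simp add: add_increasing)
  next
    case False
    then have "b \<le> a / \<eta>" using \<eta> by (simp add: field_simps)
    then have "(a + b) powr t \<le> ((1 + 1 / \<eta>) * a) powr t"
      using ab assms by (intro powr_mono2) (auto simp: algebra_simps)
    also have "\<dots> = (1 + 1 / \<eta>) powr t * a powr t" using \<eta> ab by (simp add: powr_mult)
    finally show ?thesis using assms by (simp add: add_increasing2)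
  qed
qed

text \<open>The sets are thought of as listed in order of decreasing size. With
  \<open>N i x\<close> the number of \<open>j \<ge> i\<close> with \<open>x \<in> A j\<close>, the weight \<open>P i = \<beta> ^ N i\<close> has average
  at most 2 over \<open>A i\<close>, and allows \<open>(\<Sum>i. a i)\<^sup>t\<close> to be split into the \<open>a i\<^sup>t\<close>.\<close>

lemma carleson_embedding:
  fixes M :: "'b measure" and \<Lambda> t :: real
  assumes \<Lambda>: "0 \<le> \<Lambda>" and t: "1 < t"
  obtains C where "0 < C"
    "\<And>(n :: nat) A a. \<lbrakk>\<And>i. i < n \<Longrightarrow> A i \<in> fmeasurable M; \<And>i. i < n \<Longrightarrow> 0 \<le> a i;
       \<And>i. i < n \<Longrightarrow> (\<Sum>j\<in>{j\<in>{i..<n}. A j \<inter> A i \<noteq> {}}. measure M (A j)) \<le> \<Lambda> * measure M (A i)\<rbrakk>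
     \<Longrightarrow> integrable M (\<lambda>x. (\<Sum>i<n. a i * indicator (A i) x) powr t) \<and>
        (\<integral>x. (\<Sum>i<n. a i * indicator (A i) x) powr t \<partial>M) \<le> C * (\<Sum>i<n. a i powr t * measure M (A i))"
proof -
  \<comment> \<open>\<open>\<epsilon>\<close> is chosen so that 1 + 2 \<Lambda> \<epsilon> = 2 (1 -
    \<epsilon>), which closes the bound by 2 in the estimate \<open>\<Phi>\<close>;
    \<open>\<beta>\<close> is set so that \<epsilon> = 1 - 1/\<beta>, the relative drop of
    \<open>P\<close> across one set.\<close>
  define \<epsilon> where "\<epsilon> = 1 / (2 * \<Lambda> + 2)"
  define \<beta> where "\<beta> = 1 / (1 - \<epsilon>)"
  have \<epsilon>: "0 < \<epsilon>" "\<epsilon> < 1" "\<epsilon> * (2 * \<Lambda> + 2) = 1" using \<Lambda> by (auto simp: \<epsilon>_def)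
  then have \<beta>: "1 < \<beta>" "\<beta> * (1 - \<epsilon>) = 1" by (auto simp: \<beta>_def)
  then have \<beta>': "\<epsilon> * \<beta> = \<beta> - 1" by (simp add: algebra_simps)
  obtain C where C: "0 < C" "\<And>a b. 0 \<le> a \<Longrightarrow> 0 \<le> b \<Longrightarrow> (a + b) powr t \<le> C * a powr t + \<beta> * b powr t"
    using powr_add_le_weighted[OF \<beta>(1) t] by metis
  show ?thesis
  proof (rule that[of "2 * C"])
    show "0 < 2 * C" using C by simp
    fix n :: nat and A :: "nat \<Rightarrow> 'b set" and a :: "nat \<Rightarrow> real"
    assume A: "\<And>i. i < n \<Longrightarrow> A i \<in> fmeasurable M" and a: "\<And>i. i < n \<Longrightarrow> 0 \<le> a i"
      and carl: "\<And>i. i < n \<Longrightarrow> (\<Sum>j\<in>{j\<in>{i..<n}. A j \<inter> A i \<noteq> {}}. measure M (A j)) \<le> \<Lambda> * measure M (A i)"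
    have As [measurable]: "i < n \<Longrightarrow> A i \<in> sets M" for i using A by blast
    define P where "P i x = (\<Prod>j\<in>{i..<n}. 1 + (\<beta> - 1) * indicator (A j) x)" for i x
    have Pn: "P n x = 1" for x by (simp add: P_def)
    have Pstep: "P i x = (1 + (\<beta> - 1) * indicator (A i) x) * P (Suc i) x" if "i < n" for i x
      unfolding P_def using that by (simp add: prod.atLeast_Suc_lessThan)
    have P1: "1 \<le> P i x" for i x
      unfolding P_def using \<beta> by (intro prod_ge_1) (auto simp: indicator_def)
    have Ple: "P i x \<le> \<beta> ^ n" for i x
    proof -
      have "P i x \<le> (\<Prod>j\<in>{i..<n}. \<beta>)"
        unfolding P_def using \<beta> by (intro prod_mono) (auto simp: indicator_def)
      also have "\<dots> \<le> \<beta> ^ n" using \<beta> by (simp add: power_increasing)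
      finally show ?thesis .
    qed
    have Pmeas [measurable]: "P i \<in> borel_measurable M" for i
      unfolding P_def by (intro borel_measurable_prod) auto
    have intP: "integrable M (\<lambda>x. indicator B x * P j x)" if "B \<in> fmeasurable M" for j B
    proof (rule Bochner_Integration.integrable_bound)
      show "integrable M (\<lambda>x. \<beta> ^ n * indicator B x)" using that by (auto simp: fmeasurable_def)
      show "AE x in M. norm (indicator B x * P j x) \<le> norm (\<beta> ^ n * indicator B x)"
        using P1[of j] Ple[of j] \<beta> order_trans[OF zero_le_one P1]
        by (auto simp: indicator_def)
    qed (use that in \<open>auto simp: fmeasurable_def\<close>)
    \<comment> \<open>The drop from \<open>P i\<close> to \<open>P (Suc i)\<close> is
      \<open>\<epsilon>\<close> times \<open>P i\<close> on \<open>A i\<close> and zero elsewhere;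
      summing the drops expresses the weight through itself at the indices from \<open>i\<close>
      on.\<close>
    have tele: "P i x = 1 + \<epsilon> * (\<Sum>j\<in>{i..<n}. indicator (A j) x * P j x)" if "i \<le> n" for i x
      using that
    proof (induction rule: inc_induct)
      case (step i)
      have "P i x - P (Suc i) x = \<epsilon> * (indicator (A i) x * P i x)"
      proof (cases "x \<in> A i")
        case True
        then have "P i x = \<beta> * P (Suc i) x" using Pstep[OF step.hyps(2), of x] by simp
        then have "P i x - P (Suc i) x = (\<epsilon> * \<beta>) * P (Suc i) x" unfolding \<beta>' by (simp add: algebra_simps)
        then show ?thesis using True \<open>P i x = \<beta> * P (Suc i) x\<close> by simp
      qed (use Pstep[OF step.hyps(2), of x] in simp)
      then show ?case
        unfolding sum.atLeast_Suc_lessThan[OF step.hyps(2)] distrib_left step.IH by linarith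
    qed (simp add: Pn)
    \<comment> \<open>Downward in \<open>i\<close>: sets after \<open>A i\<close> contribute at most
      twice their measure by induction, the Carleson condition sums these, and the term j = i is the
      unknown itself with factor \<open>\<epsilon>\<close>, to be absorbed.\<close>
    have \<Phi>: "(\<integral>x. indicator (A i) x * P i x \<partial>M) \<le> 2 * measure M (A i)" if "i < n" for i
      using that
    proof (induction "n - i" arbitrary: i rule: less_induct)
      case less
      let ?J = "{j\<in>{i..<n}. A j \<inter> A i \<noteq> {}}"
      let ?\<Phi> = "\<lambda>i. \<integral>x. indicator (A i) x * P i x \<partial>M"
      have pw: "indicator (A i) x * P i x
          = indicator (A i) x + \<epsilon> * (\<Sum>j\<in>{i..<n}. indicator (A i \<inter> A j) x * P j x)" for x
      proof (cases "x \<in> A i")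
        case True
        then have "(\<Sum>j\<in>{i..<n}. indicator (A i \<inter> A j) x * P j x) = (\<Sum>j\<in>{i..<n}. indicator (A j) x * P j x)"
          by (intro sum.cong refl) (simp add: indicator_def)
        then show ?thesis using tele[of i x] less.prems True by (simp del: sum_indicator_mult sum_mult_indicator)
      qed simp
      have "(\<integral>x. indicator (A i) x * P i x \<partial>M) =
          (\<integral>x. indicator (A i) x + \<epsilon> * (\<Sum>j\<in>{i..<n}. indicator (A i \<inter> A j) x * P j x) \<partial>M)"
        by (simp only: pw)
      also have "\<dots> = measure M (A i) + \<epsilon> * (\<Sum>j\<in>{i..<n}. \<integral>x. indicator (A i \<inter> A j) x * P j x \<partial>M)"
      proof -
        have iI: "integrable M (\<lambda>x. indicator (A i \<inter> A j) x * P j x)" if "j \<in> {i..<n}" for j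
          using that less.prems A by (intro intP fmeasurable.Int) auto
        have iA: "integrable M (\<lambda>x. indicator (A i) x :: real)"
          using A[OF less.prems] by (simp add: fmeasurable_def less_top)
        have "(\<integral>x. indicator (A i) x + \<epsilon> * (\<Sum>j\<in>{i..<n}. indicator (A i \<inter> A j) x * P j x) \<partial>M)
          = (\<integral>x. indicator (A i) x \<partial>M) + (\<integral>x. \<epsilon> * (\<Sum>j\<in>{i..<n}. indicator (A i \<inter> A j) x * P j x) \<partial>M)"
          by (rule Bochner_Integration.integral_add[OF iA integrable_mult_right[OF Bochner_Integration.integrable_sum[OF iI]]])
        also have "(\<integral>x. \<epsilon> * (\<Sum>j\<in>{i..<n}. indicator (A i \<inter> A j) x * P j x) \<partial>M)
            = \<epsilon> * (\<Sum>j\<in>{i..<n}. \<integral>x. indicator (A i \<inter> A j) x * P j x \<partial>M)"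
          by (simp only: integral_mult_right_zero Bochner_Integration.integral_sum[OF iI])
        also have "(\<integral>x. indicator (A i) x \<partial>M) = measure M (A i)"
          using less.prems by simp
        finally show ?thesis .
      qed
      also have "(\<Sum>j\<in>{i..<n}. \<integral>x. indicator (A i \<inter> A j) x * P j x \<partial>M)
          = (\<Sum>j\<in>?J. \<integral>x. indicator (A i \<inter> A j) x * P j x \<partial>M)"
        by (rule sum.mono_neutral_right) (auto simp: Int_commute)
      also have "\<dots> \<le> (\<Sum>j\<in>?J. ?\<Phi> j)"
        using less.prems A order_trans[OF zero_le_one P1]
        by (intro sum_mono integral_mono intP fmeasurable.Int) (auto simp: indicator_def)
      also have "\<dots> \<le> (\<Sum>j\<in>?J. 2 * measure M (A j) + (if j = i then ?\<Phi> i else 0))"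
        using less.hyps less.prems by (intro sum_mono) (auto simp: diff_less_mono2)
      also have "\<dots> \<le> 2 * (\<Lambda> * measure M (A i)) + ?\<Phi> i"
      proof -
        have "(\<Sum>j\<in>?J. if j = i then ?\<Phi> i else 0) \<le> ?\<Phi> i"
          using order_trans[OF zero_le_one P1]
          by (subst sum.delta) (auto intro!: integral_nonneg)
        then show ?thesis
          using carl[OF less.prems] by (simp add: sum.distrib flip: sum_distrib_left)
      qed
      finally have "?\<Phi> i * (1 - \<epsilon>) \<le> measure M (A i) * (1 + 2 * \<Lambda> * \<epsilon>)"
        using \<epsilon> by (simp add: algebra_simps mult_left_mono)
      also have "1 + 2 * \<Lambda> * \<epsilon> = 2 * (1 - \<epsilon>)" using \<epsilon>(3) by (simp add: algebra_simps)
      finally show ?case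
        using \<epsilon> by (intro mult_right_le_imp_le[of "?\<Phi> i" "1 - \<epsilon>"]) (auto simp: algebra_simps)
    qed
    define T where "T i x = (\<Sum>j<i. a j * indicator (A j) x)" for i x
    have T0: "0 \<le> T i x" if "i \<le> n" for i x
      unfolding T_def using a that by (intro sum_nonneg) auto
    \<comment> \<open>Adding \<open>a i\<close> multiplies the old power by \<open>\<beta>\<close>
      on \<open>A i\<close>, and exactly there the weight falls from \<open>P i\<close> to
      \<open>P i / \<beta>\<close>. The losses therefore never accumulate.\<close>
    have main: "T i x powr t * P i x \<le> C * (\<Sum>j<i. a j powr t * (indicator (A j) x * P j x))" if "i \<le> n" for i x
      using that
    proof (induction i)
      case (Suc i)
      then have i: "i < n" and IH: "T i x powr t * P i x \<le> C * (\<Sum>j<i. a j powr t * (indicator (A j) x * P j x))" by auto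
      show ?case
      proof (cases "x \<in> A i")
        case True
        have P: "P i x = \<beta> * P (Suc i) x" using Pstep[OF i, of x] True by simp
        have "T (Suc i) x powr t * P (Suc i) x = (a i + T i x) powr t * P (Suc i) x"
          using True by (simp add: T_def add.commute)
        also have "\<dots> \<le> (C * a i powr t + \<beta> * T i x powr t) * P (Suc i) x"
          using C(2)[OF a[OF i] T0[of i x]] i P1[of "Suc i" x] by (intro mult_right_mono) auto
        also have "\<dots> = C * a i powr t * P (Suc i) x + T i x powr t * P i x"
          by (simp add: P algebra_simps)
        also have "\<dots> \<le> C * a i powr t * P i x + C * (\<Sum>j<i. a j powr t * (indicator (A j) x * P j x))"
          using C(1) \<beta>(1) P P1[of "Suc i" x] by (intro add_mono IH mult_left_mono) auto
        finally show ?thesis using True by (simp add: algebra_simps)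
      next
        case False
        then show ?thesis using IH Pstep[OF i, of x] by (simp add: T_def)
      qed
    qed (simp add: T_def)
    have bound: "T n x powr t \<le> C * (\<Sum>j<n. a j powr t * (indicator (A j) x * P j x))" for x
      using main[of n x] by (simp add: Pn)
    have int: "integrable M (\<lambda>x. C * (\<Sum>j<n. a j powr t * (indicator (A j) x * P j x)))"
      using A intP by auto
    have int': "integrable M (\<lambda>x. T n x powr t)"
    proof (rule Bochner_Integration.integrable_bound[OF int])
      show "(\<lambda>x. T n x powr t) \<in> borel_measurable M"
        unfolding T_def by measurable
      show "AE x in M. norm (T n x powr t) \<le> norm (C * (\<Sum>j<n. a j powr t * (indicator (A j) x * P j x)))"
        using order_trans[OF bound abs_ge_self] by simp
    qed
    have "(\<integral>x. T n x powr t \<partial>M) \<le> C * (\<Sum>j<n. a j powr t * (\<integral>x. indicator (A j) x * P j x \<partial>M))"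
      using integral_mono[OF int' int bound] A intP by simp
    also have "\<dots> \<le> C * (\<Sum>j<n. a j powr t * (2 * measure M (A j)))"
      using C \<Phi> by (intro mult_left_mono sum_mono) auto
    finally show "integrable M (\<lambda>x. (\<Sum>i<n. a i * indicator (A i) x) powr t) \<and>
        (\<integral>x. (\<Sum>i<n. a i * indicator (A i) x) powr t \<partial>M) \<le> 2 * C * (\<Sum>i<n. a i powr t * measure M (A i))"
      using int' by (simp add: T_def sum_distrib_left algebra_simps)
  qed
qed

section \<open>Kernels on nondegenerate pairs of balls\<close>

text \<open>Carries Borel measurability for the product topology over to the product of Lebesgue
  sigma-algebras. Entries from \<open>m\<close> on are replaced by 0, so that every coordinate of
  the image is measurable.\<close>

lemma measurable_coordinate_update:
  fixes m :: nat
  shows "(\<lambda>y i. if i < m then y i else 0) \<in> PiM {..<m} (\<lambda>_. lebesgue :: 'a::euclidean_space measure) \<rightarrow>\<^sub>M borel"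
proof (rule measurable_coordinatewise_then_product)
  fix i
  have id: "(\<lambda>x. x) \<in> (lebesgue :: 'a measure) \<rightarrow>\<^sub>M borel"
    by (intro measurable_completion) simp
  show "(\<lambda>y. if i < m then y i else 0) \<in> PiM {..<m} (\<lambda>_. lebesgue :: 'a measure) \<rightarrow>\<^sub>M borel"
  proof (cases "i < m")
    case True
    then show ?thesis
      using measurable_compose[OF measurable_component_singleton[of i "{..<m}" "\<lambda>_. lebesgue :: 'a measure"] id]
      by simp
  qed simp
qed

locale cz_kernel =
  fixes m :: nat and K :: "'a::euclidean_space \<Rightarrow> (nat \<Rightarrow> 'a) \<Rightarrow> complex" and \<omega> :: "real \<Rightarrow> real" and C :: real
  assumes m: "0 < m" and \<omega>: "modulus \<omega>" "(\<omega> \<longlongrightarrow> 0) (at_right 0)" and C: "0 \<le> C"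
    and cong: "\<And>x y y'. (\<And>i. i < m \<Longrightarrow> y i = y' i) \<Longrightarrow> K x y = K x y'"
    and size: "\<And>x y. off_diag m x y \<Longrightarrow> norm (K x y) \<le> C / ssum_dist m x y ^ (m * DIM('a))"
    and reg: "\<And>x y h. off_diag m x y \<Longrightarrow> norm h \<le> 1/2 * Max ((\<lambda>i. dist x (y i)) ` {..<m}) \<Longrightarrow>
              norm (K (x + h) y - K x y) + (\<Sum>i<m. norm (K x (y(i := y i + h)) - K x y))
                \<le> C / ssum_dist m x y ^ (m * DIM('a)) * \<omega> (norm h / ssum_dist m x y)"
begin

lemma \<omega>_mono: "0 \<le> s \<Longrightarrow> s \<le> t \<Longrightarrow> t < 1 \<Longrightarrow> \<omega> s \<le> \<omega> t"
  using \<omega>(1) by (auto simp: modulus_def intro: mono_onD)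

lemma \<omega>_nonneg: "0 \<le> s \<Longrightarrow> s < 1 \<Longrightarrow> 0 \<le> \<omega> s"
  using \<omega>(1) by (auto simp: modulus_def)

lemma \<omega>_small: "0 < e \<Longrightarrow> \<exists>t>0. t \<le> 1/2 \<and> \<omega> t \<le> e"
proof -
  assume "0 < e"
  then have "eventually (\<lambda>t. \<omega> t < e) (at_right 0)" by (rule order_tendstoD(2)[OF \<omega>(2)])
  then obtain b where b: "b > 0" "\<And>t. 0 < t \<Longrightarrow> t < b \<Longrightarrow> \<omega> t < e"
    by (auto simp: eventually_at_right_field)
  show ?thesis
    using b(1) less_imp_le[OF b(2)[of "min (b/2) (1/2)"]] by (intro exI[of _ "min (b/2) (1/2)"]) auto
qed

text \<open>Distance d/2 is required of one entry, and not d, so that the estimate still applies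
  after that entry has itself been moved. A shift by at most d/4 is admissible in the regularity
  condition and keeps the argument of \<open>\<omega>\<close> at most 1/2.\<close>

lemma kernel_shift_le:
  assumes i: "i < m" "d / 2 \<le> dist x (y i)" and d: "0 < d" "norm h \<le> \<delta>" "\<delta> \<le> d / 4"
  shows "norm (K (x + h) y - K x y) \<le> C * (2 / d) ^ (m * DIM('a)) * \<omega> (2 * \<delta> / d)"
    and "j < m \<Longrightarrow> norm (K x (y(j := y j + h)) - K x y) \<le> C * (2 / d) ^ (m * DIM('a)) * \<omega> (2 * \<delta> / d)"
proof -
  let ?s = "ssum_dist m x y"
  have off: "off_diag m x y" using i d by (auto simp: off_diag_def intro!: exI[of _ i])
  have s: "d / 2 \<le> ?s"
    using i member_le_sum[of i "{..<m}" "\<lambda>i. dist x (y i)"] by (simp add: ssum_dist_def)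
  have "d / 2 \<le> Max ((\<lambda>i. dist x (y i)) ` {..<m})"
    using i by (intro Max_ge_iff[THEN iffD2]) (auto intro!: exI[of _ i])
  then have "norm h \<le> 1/2 * Max ((\<lambda>i. dist x (y i)) ` {..<m})" using d by linarith
  note r = reg[OF off this]
  have "C / ?s ^ (m * DIM('a)) \<le> C / (d / 2) ^ (m * DIM('a))"
    using s d C by (intro divide_left_mono power_mono mult_pos_pos zero_less_power) auto
  also have "\<dots> = C * (2 / d) ^ (m * DIM('a))" by (simp add: power_divide)
  finally have 1: "C / ?s ^ (m * DIM('a)) \<le> C * (2 / d) ^ (m * DIM('a))" .
  have "norm h / ?s \<le> \<delta> / (d / 2)" using s d by (intro frac_le) (auto intro: order_trans[OF norm_ge_zero])
  then have 2: "\<omega> (norm h / ?s) \<le> \<omega> (2 * \<delta> / d)"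
    using d s by (intro \<omega>_mono) (auto simp: field_simps)
  have 3: "0 \<le> \<omega> (norm h / ?s)"
  proof (rule \<omega>_nonneg)
    show "norm h / ?s < 1" using s d by (simp add: divide_less_eq)
  qed (use s d in auto)
  have 4: "norm (K (x + h) y - K x y) + (\<Sum>i<m. norm (K x (y(i := y i + h)) - K x y))
      \<le> C * (2 / d) ^ (m * DIM('a)) * \<omega> (2 * \<delta> / d)"
    using r mult_mono[OF 1 2] 3 C d by (auto intro: order_trans)
  have 5: "0 \<le> (\<Sum>i<m. norm (K x (y(i := y i + h)) - K x y))" by (intro sum_nonneg) auto
  from 4 5 show "norm (K (x + h) y - K x y) \<le> C * (2 / d) ^ (m * DIM('a)) * \<omega> (2 * \<delta> / d)" by linarith
  assume "j < m"
  then have "norm (K x (y(j := y j + h)) - K x y) \<le> (\<Sum>i<m. norm (K x (y(i := y i + h)) - K x y))"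
    by (intro member_le_sum) auto
  with 4 show "norm (K x (y(j := y j + h)) - K x y) \<le> C * (2 / d) ^ (m * DIM('a)) * \<omega> (2 * \<delta> / d)"
    using norm_ge_zero[of "K (x + h) y - K x y"] by linarith
qed

text \<open>The regularity condition moves one entry at a time; \<open>z k\<close> has its first
  \<open>k\<close> entries moved already, and the distinguished entry never comes closer to
  \<open>x\<close> than d/2.\<close>

lemma kernel_perturbation_le:
  assumes i: "i < m" "d \<le> dist x (y i)" and d: "0 < d" "\<delta> \<le> d / 4"
    and y': "\<And>i. i < m \<Longrightarrow> dist (y i) (y' i) \<le> \<delta>"
  shows "norm (K x y' - K x y) \<le> m * (C * (2 / d) ^ (m * DIM('a)) * \<omega> (2 * \<delta> / d))"
proof -
  define z where "z k i = (if i < k then y' i else y i)" for k i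
  let ?B = "C * (2 / d) ^ (m * DIM('a)) * \<omega> (2 * \<delta> / d)"
  have \<delta>: "0 \<le> \<delta>" using y'[OF i(1)] order_trans[OF zero_le_dist] by blast
  have "norm (K x (z k) - K x y) \<le> k * ?B" if "k \<le> m" for k
    using that
  proof (induction k)
    case 0
    have "z 0 = y" by (auto simp: z_def)
    then show ?case by simp
  next
    case (Suc k)
    have zs: "z (Suc k) = (z k)(k := z k k + (y' k - y k))" by (auto simp: z_def fun_eq_iff)
    have "dist x (y i) \<le> dist x (z k i) + dist (z k i) (y i)" by (rule dist_triangle)
    moreover have "dist (z k i) (y i) \<le> \<delta>" using y'[OF i(1)] \<delta> by (auto simp: z_def dist_commute)
    ultimately have "d / 2 \<le> dist x (z k i)" using i d by linarith
    then have "norm (K x (z (Suc k)) - K x (z k)) \<le> ?B"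
      unfolding zs using y'[of k] Suc.prems
      by (intro kernel_shift_le(2)[OF i(1) _ d(1) _ d(2)]) (auto simp: dist_norm norm_minus_commute)
    then have "norm (K x (z (Suc k)) - K x y) \<le> ?B + k * ?B"
      using Suc norm_triangle_ineq[of "K x (z (Suc k)) - K x (z k)" "K x (z k) - K x y"] by simp
    then show ?case by (simp add: algebra_simps)
  qed
  moreover have "K x (z m) = K x y'" by (rule cong) (simp add: z_def)
  ultimately show ?thesis by (metis order_refl)
qed

text \<open>Since \<open>\<omega>\<close> tends to 0, regularity gives continuity of
  \<open>K x\<close> off the diagonal in the product topology; extending by 0 to the diagonal, a
  closed set, keeps it Borel.\<close>

lemma measurable_kernel:
  "(\<lambda>y. if off_diag m x y then K x y else 0) \<in> borel_measurable (PiM {..<m} (\<lambda>_. lebesgue))"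
proof -
  let ?S = "{y. off_diag m x y}"
  have "?S = (\<Union>i\<in>{..<m}. {y. y i \<noteq> x})" by (auto simp: off_diag_def)
  moreover have "open {y::nat \<Rightarrow> 'a. y i \<noteq> x}" for i
    by (intro open_Collect_neq continuous_on_product_coordinates continuous_on_const)
  ultimately have S: "open ?S" by auto
  have cont: "continuous_on ?S (K x)"
    unfolding continuous_on_eq_continuous_at[OF S]
  proof (intro ballI)
    fix y assume "y \<in> ?S"
    then obtain i where i: "i < m" "y i \<noteq> x" by (auto simp: off_diag_def)
    define d where "d = dist x (y i)"
    have d: "0 < d" using i by (simp add: d_def)
    show "isCont (K x) y"
      unfolding isCont_def
    proof (rule tendstoI)
      fix e :: real assume e: "0 < e"
      define B where "B = real m * (C * (2 / d) ^ (m * DIM('a)))"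
      have B: "0 \<le> B" using C d by (simp add: B_def)
      obtain t where t: "0 < t" "t \<le> 1/2" "\<omega> t \<le> e / (2 * (B + 1))"
        using \<omega>_small[of "e / (2 * (B + 1))"] e B by (auto simp: divide_pos_pos add_nonneg_pos)
      define \<delta> where "\<delta> = t * d / 2"
      have \<delta>: "0 < \<delta>" "\<delta> \<le> d / 4" "2 * \<delta> / d = t" using t d by (auto simp: \<delta>_def)
      have "dist (K x y') (K x y) < e" if "\<forall>i<m. dist (y i) (y' i) < \<delta>" for y'
      proof -
        have "norm (K x y' - K x y) \<le> B * \<omega> t"
          using kernel_perturbation_le[OF i(1) _ d \<delta>(2), of x y y', unfolded \<delta>(3)] that
          by (auto simp: d_def[symmetric] B_def less_imp_le mult.assoc)
        also have "\<dots> \<le> B * (e / (2 * (B + 1)))" using t B by (intro mult_left_mono) auto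
        also have "\<dots> < e" using e B by (simp add: divide_less_eq algebra_simps add_nonneg_pos)
        finally show ?thesis by (simp add: dist_norm)
      qed
      moreover have "open {y'. \<forall>i\<in>{..<m}. dist (y i) (y' i) < \<delta>}"
      proof -
        have "{y'. \<forall>i\<in>{..<m}. dist (y i) (y' i) < \<delta>} = (\<Inter>i\<in>{..<m}. {y'. dist (y i) (y' i) < \<delta>})" by auto
        also have "open \<dots>"
          by (intro open_INT finite_lessThan ballI open_Collect_less continuous_on_dist
              continuous_on_product_coordinates continuous_on_const)
        finally show ?thesis .
      qed
      ultimately show "\<forall>\<^sub>F y' in at y. dist (K x y') (K x y) < e"
        unfolding eventually_at_topological using \<delta>(1)
        by (intro exI[of _ "{y'. \<forall>i\<in>{..<m}. dist (y i) (y' i) < \<delta>}"]) auto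
    qed
  qed
  have G: "(\<lambda>y. if y \<in> ?S then K x y else 0) \<in> borel_measurable borel"
    by (intro borel_measurable_continuous_on_if cont continuous_on_const) (use S in auto)
  have eq: "(if off_diag m x y then K x y else 0) =
      (\<lambda>y. if y \<in> ?S then K x y else 0) (\<lambda>i. if i < m then y i else 0)" for y
    using cong[of y "\<lambda>i. if i < m then y i else 0" x] by (auto simp: off_diag_def)
  show ?thesis
    unfolding eq by (rule measurable_compose[OF measurable_coordinate_update G])
qed

text \<open>Asking for the non-degenerate point at distance \<open>A * \<rho>\<close> with
  \<open>A\<close> large makes the balls small relative to their distance, hence the oscillation of
  \<open>K\<close> small. Conversely the point cannot be too far: its kernel value is bounded below
  by non-degeneracy and above by the size condition, which forces the distance to be at most
  \<open>\<kappa> * \<rho>\<close>.\<close>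

lemma nondegenerate_balls:
  assumes "0 < c0" and nd: "\<And>y \<rho>. 0 < \<rho> \<Longrightarrow>
        (\<exists>x. dist x y \<ge> \<rho> \<and> norm (K x (\<lambda>_. y)) \<ge> 1 / (c0 * \<rho> ^ (m * DIM('a))))"
  obtains \<kappa> c where "0 < c" "1 \<le> \<kappa>" "\<And>y0 \<rho>. 0 < \<rho> \<Longrightarrow> \<exists>x0 K0. 4 * \<rho> \<le> dist x0 y0 \<and> dist x0 y0 \<le> \<kappa> * \<rho> \<and>
      c / \<rho> ^ (m * DIM('a)) \<le> norm K0 \<and>
      (\<forall>x y. x \<in> cball x0 \<rho> \<longrightarrow> (\<forall>i<m. y i \<in> cball y0 \<rho>) \<longrightarrow> norm (K x y - K0) \<le> norm K0 / 2)"
proof -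
  define N where "N = m * DIM('a)"
  have N: "0 < N" using m by (simp add: N_def)
  \<comment> \<open>Chosen so that the total oscillation, \<open>m\<close> moves of entries of
    \<open>y\<close> and one of \<open>x\<close>, comes out as half of the lower bound
    \<open>1 / (c0 * (A * \<rho>) ^ N)\<close>.\<close>
  define \<eta> where "\<eta> = 1 / (2 * (real m + 1) * (C + 1) * 4 ^ N * c0)"
  have "0 < \<eta>" using C assms(1) by (simp add: \<eta>_def)
  then obtain t where t: "0 < t" "t \<le> 1/2" "\<omega> t \<le> \<eta>" using \<omega>_small by blast
  define A where "A = 4 / t"
  have A: "8 \<le> A" "4 / A = t" using t by (auto simp: A_def field_simps)
  define \<kappa> where "\<kappa> = (C * c0 + 1) * A"
  have Cc: "0 \<le> C * c0" using C assms by simp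
  show ?thesis
  proof (rule that[of "1 / (c0 * A ^ N)" \<kappa>])
    show "0 < 1 / (c0 * A ^ N)" using A assms by simp
    show "1 \<le> \<kappa>" using A Cc mult_mono[of 1 "C * c0 + 1" 1 A] by (simp add: \<kappa>_def)
    fix y0 :: 'a and \<rho> :: real assume \<rho>: "0 < \<rho>"
    obtain x0 where x0: "dist x0 y0 \<ge> A * \<rho>" "norm (K x0 (\<lambda>_. y0)) \<ge> 1 / (c0 * (A * \<rho>) ^ N)"
      using nd[of "A * \<rho>" y0] \<rho> A by (auto simp: N_def)
    define d where "d = dist x0 y0"
    define K0 where "K0 = K x0 (\<lambda>_. y0)"
    have A\<rho>: "0 < A * \<rho>" "8 * \<rho> \<le> A * \<rho>" using A \<rho> by auto
    have d: "0 < d" "A * \<rho> \<le> d" "8 * \<rho> \<le> d" using x0 A\<rho> by (auto simp: d_def)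
    have off: "off_diag m x0 (\<lambda>_. y0)" using d m by (auto simp: off_diag_def d_def)
    have "1 / (c0 * (A * \<rho>) ^ N) \<le> C / ssum_dist m x0 (\<lambda>_. y0) ^ N"
      using x0(2) size[OF off] by (simp add: N_def)
    also have "\<dots> \<le> C / d ^ N"
    proof -
      have "1 * d \<le> real m * d" using m d by (intro mult_right_mono) auto
      then have "d ^ N \<le> ssum_dist m x0 (\<lambda>_. y0) ^ N"
        using d by (intro power_mono) (auto simp: ssum_dist_def d_def)
      then show ?thesis using C d by (intro divide_left_mono mult_pos_pos) (auto intro: less_le_trans[rotated])
    qed
    finally have le: "1 / (c0 * (A * \<rho>) ^ N) \<le> C / d ^ N" .
    have "d ^ N \<le> (C * c0) * (A * \<rho>) ^ N"
    proof -
      have pos: "0 < c0 * (A * \<rho>) ^ N" "0 < d ^ N" using d A\<rho> assms by auto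
      have "1 * d ^ N \<le> C * (c0 * (A * \<rho>) ^ N)"
        using le pos by (metis (no_types, lifting) frac_le_eq less_numeral_extra(3) pos_divide_le_eq
            pos_le_divide_eq times_divide_eq_left mult.commute)
      then show ?thesis by (simp add: mult_ac)
    qed
    \<comment> \<open>Enlarging the constant to an N-th power lets the N-th root be read off by
      \<open>power_mono_iff\<close>.\<close>
    also have "\<dots> \<le> (C * c0 + 1) ^ N * (A * \<rho>) ^ N"
    proof (rule mult_right_mono)
      have "C * c0 \<le> C * c0 + 1" by simp
      also have "\<dots> \<le> (C * c0 + 1) ^ N" using N Cc by (intro self_le_power) auto
      finally show "C * c0 \<le> (C * c0 + 1) ^ N" .
    qed (use A\<rho> in auto)
    also have "\<dots> = (\<kappa> * \<rho>) ^ N" by (simp add: \<kappa>_def power_mult_distrib mult_ac)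
    finally have "d ^ N \<le> (\<kappa> * \<rho>) ^ N" .
    then have d\<kappa>: "d \<le> \<kappa> * \<rho>"
      using N Cc A \<rho> by (simp add: power_mono_iff \<kappa>_def d_def)
    have "norm (K x y - K0) \<le> norm K0 / 2" if x: "x \<in> cball x0 \<rho>" and y: "\<forall>i<m. y i \<in> cball y0 \<rho>" for x y
    proof -
      have dx: "d / 2 \<le> dist x y0"
        using dist_triangle[of x0 y0 x] x d \<rho> unfolding d_def mem_cball by linarith
      have "norm (K (x0 + (x - x0)) (\<lambda>_. y0) - K x0 (\<lambda>_. y0)) \<le> C * (2 / d) ^ N * \<omega> (2 * \<rho> / d)"
        unfolding N_def using m d x \<rho> by (intro kernel_shift_le(1)[of 0]) (auto simp: dist_norm norm_minus_commute d_def)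
      also have "\<dots> \<le> C * (4 / d) ^ N * \<omega> (4 * \<rho> / d)"
        using d C \<rho> by (intro mult_mono power_mono divide_right_mono \<omega>_mono mult_left_mono \<omega>_nonneg mult_nonneg_nonneg) auto
      finally have 1: "norm (K x (\<lambda>_. y0) - K0) \<le> C * (4 / d) ^ N * \<omega> (4 * \<rho> / d)" by (simp add: K0_def)
      have "norm (K x y - K x (\<lambda>_. y0)) \<le> real m * (C * (2 / (d/2)) ^ N * \<omega> (2 * \<rho> / (d/2)))"
        unfolding N_def using m d y dx \<rho> by (intro kernel_perturbation_le[of 0]) auto
      then have 2: "norm (K x y - K x (\<lambda>_. y0)) \<le> real m * (C * (4 / d) ^ N * \<omega> (4 * \<rho> / d))" by simp
      have "norm (K x y - K0) \<le> (real m + 1) * (C * (4 / d) ^ N * \<omega> (4 * \<rho> / d))"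
        using 1 2 norm_triangle_ineq[of "K x y - K x (\<lambda>_. y0)" "K x (\<lambda>_. y0) - K0"]
        by (simp add: algebra_simps)
      also have "\<dots> \<le> (real m + 1) * ((C + 1) * (4 / (A * \<rho>)) ^ N * \<eta>)"
      proof (intro mult_left_mono mult_mono power_mono divide_left_mono)
        have "4 * \<rho> / d \<le> t" unfolding A(2)[symmetric] using d A \<rho> by (simp add: field_simps)
        then have "\<omega> (4 * \<rho> / d) \<le> \<omega> t" using t d \<rho> by (intro \<omega>_mono) auto
        with t(3) show "\<omega> (4 * \<rho> / d) \<le> \<eta>" by simp
        show "0 \<le> \<omega> (4 * \<rho> / d)" using d \<rho> by (intro \<omega>_nonneg) auto
      qed (use C d A\<rho> in auto)
      also have "\<dots> = 1 / (c0 * (A * \<rho>) ^ N) / 2"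
      proof -
        have "u * (v * (w / r) * (1 / (2 * u * v * w * c0))) = 1 / (c0 * r) / 2"
          if "u \<noteq> 0" "v \<noteq> 0" "w \<noteq> 0" for u v w r :: real
          using that by simp
        from this[of "real m + 1" "C + 1" "4 ^ N" "(A * \<rho>) ^ N"] show ?thesis
          using C unfolding \<eta>_def power_divide by simp
      qed
      also have "\<dots> \<le> norm K0 / 2" using x0(2) by (simp add: K0_def)
      finally show ?thesis .
    qed
    moreover have "1 / (c0 * A ^ N) / \<rho> ^ N \<le> norm K0" using x0(2) by (simp add: K0_def power_mult_distrib mult.assoc)
    moreover have "4 * \<rho> \<le> d" using d \<rho> by linarith
    ultimately show "\<exists>x0 K0. 4 * \<rho> \<le> dist x0 y0 \<and> dist x0 y0 \<le> \<kappa> * \<rho> \<and>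
      1 / (c0 * A ^ N) / \<rho> ^ (m * DIM('a)) \<le> norm K0 \<and>
      (\<forall>x y. x \<in> cball x0 \<rho> \<longrightarrow> (\<forall>i<m. y i \<in> cball y0 \<rho>) \<longrightarrow> norm (K x y - K0) \<le> norm K0 / 2)"
      using d\<kappa> unfolding N_def[symmetric] d_def by blast
  qed
qed

end

section \<open>Medians\<close>

lemma sigma_finite_lebesgue: "sigma_finite_measure (lebesgue :: 'a::euclidean_space measure)"
proof -
  obtain A where A: "countable A" "A \<subseteq> sets (lborel :: 'a measure)" "\<Union>A = space lborel"
    "\<forall>a\<in>A. emeasure lborel a \<noteq> \<infinity>"
    using lborel.sigma_finite_countable by blast
  show ?thesis
  proof
    have "emeasure lebesgue a = emeasure lborel a" if "a \<in> A" for a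
      using that A(2) by auto
    then show "\<exists>A. countable A \<and> A \<subseteq> sets (lebesgue :: 'a measure) \<and> \<Union>A = space lebesgue \<and>
        (\<forall>a\<in>A. emeasure lebesgue a \<noteq> \<infinity>)"
      using A by (intro exI[of _ A]) (auto intro: sets_completionI_sets)
  qed
qed

text \<open>The value is the infimum of the levels whose sublevel set holds at least half the mass.
  Continuity of the measure from above gives the first inequality at the infimum itself; continuity
  from below bounds the strict sublevel set by half, hence the second.\<close>

lemma median_exists:
  fixes h :: "'b \<Rightarrow> real"
  assumes h [measurable]: "h \<in> borel_measurable M" and B: "B \<in> fmeasurable M"
  obtains \<alpha> where "measure M B \<le> 2 * measure M {x\<in>B. h x \<le> \<alpha>}" "measure M B \<le> 2 * measure M {x\<in>B. \<alpha> \<le> h x}"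
proof (cases "measure M B = 0")
  case True
  then show ?thesis using that by simp
next
  case False
  then have pos: "0 < measure M B" by (simp add: zero_less_measure_iff)
  have [measurable]: "B \<in> sets M" using B by auto
  have BM: "B = {x\<in>space M. x \<in> B}" using sets.sets_into_space[of B M] by auto
  have fm: "{x\<in>B. P x} \<in> fmeasurable M" if "Measurable.pred M P" for P
  proof (rule fmeasurableI2[OF B])
    have "{x\<in>space M. x \<in> B \<and> P x} \<in> sets M" using that by measurable
    then show "{x\<in>B. P x} \<in> sets M" by (subst BM) (simp add: conj_assoc)
  qed auto
  have fms [simp]: "{x\<in>B. h x \<le> t} \<in> fmeasurable M" "{x\<in>B. h x < t} \<in> fmeasurable M"
    "{x\<in>B. t \<le> h x} \<in> fmeasurable M" for t
    by (intro fm; measurable)+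
  note sms [simp] = fms[THEN fmeasurableD]
  have fin [simp]: "emeasure M {x\<in>B. h x \<le> t} \<noteq> top" for t
    using fms(1)[of t] by (simp add: fmeasurable_def less_top)
  define G where "G t = measure M {x\<in>B. h x \<le> t}" for t
  have Gm: "G s \<le> G t" if "s \<le> t" for s t
    unfolding G_def using that by (intro measure_mono_fmeasurable) auto
  have G1: "(\<lambda>n. G (real n)) \<longlonglongrightarrow> measure M B"
  proof -
    have "(\<Union>n. {x\<in>B. h x \<le> real n}) = B" using real_arch_simple by auto
    moreover have "(\<lambda>n. G (real n)) \<longlonglongrightarrow> measure M (\<Union>n. {x\<in>B. h x \<le> real n})"
      unfolding G_def using B by (intro Lim_measure_incseq) (auto simp: incseq_def calculation fmeasurable_def less_top)
    ultimately show ?thesis by simp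
  qed
  have G0: "(\<lambda>n. G (- real n)) \<longlonglongrightarrow> 0"
  proof -
    have e: "(\<Inter>n. {x\<in>B. h x \<le> - real n}) = {}"
    proof -
      have "\<exists>n. \<not> h x \<le> - real n" for x
      proof -
        obtain n where "- h x < real n" using reals_Archimedean2 by blast
        then show ?thesis by (intro exI[of _ n]) linarith
      qed
      then show ?thesis by auto
    qed
    have "(\<lambda>n. G (- real n)) \<longlonglongrightarrow> measure M (\<Inter>n. {x\<in>B. h x \<le> - real n})"
      unfolding G_def by (intro Lim_measure_decseq) (auto simp: decseq_def)
    then show ?thesis by (simp add: e)
  qed
  define A where "A = {t. measure M B \<le> 2 * G t}"
  have "eventually (\<lambda>n. measure M B / 2 < G (real n)) sequentially"
    using order_tendstoD(1)[OF G1, of "measure M B / 2"] pos by simp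
  then obtain n1 where "measure M B / 2 < G (real n1)" by (auto simp: eventually_sequentially)
  then have ne: "real n1 \<in> A" by (simp add: A_def)
  have "eventually (\<lambda>n. G (- real n) < measure M B / 2) sequentially"
    using order_tendstoD(2)[OF G0, of "measure M B / 2"] pos by simp
  then obtain n0 where n0: "G (- real n0) < measure M B / 2" by (auto simp: eventually_sequentially)
  have lb: "- real n0 \<le> t" if "t \<in> A" for t
    using that n0 Gm[of t "- real n0"] by (auto simp: A_def not_le[symmetric] intro: leI)
  then have bdd: "bdd_below A" by (auto simp: bdd_below_def)
  define \<alpha> where "\<alpha> = Inf A"
  have above: "measure M B \<le> 2 * G t" if t: "\<alpha> < t" for t
  proof -
    have "A \<noteq> {}" using ne by blast
    then obtain s where "s \<in> A" "s < t" using t bdd cInf_less_iff[of A t] by (auto simp: \<alpha>_def)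
    then show ?thesis using Gm[of s t] by (auto simp: A_def)
  qed
  have below: "2 * G t \<le> measure M B" if "t < \<alpha>" for t
  proof -
    have "t \<notin> A" using cInf_lower[OF _ bdd, of t] that by (auto simp: \<alpha>_def)
    then show ?thesis by (simp add: A_def)
  qed
  have inv_mono: "inverse (real (Suc n)) \<le> inverse (real (Suc m))" if "m \<le> n" for m n
    using that by (intro le_imp_inverse_le) auto
  have lim1: "(\<lambda>n. G (\<alpha> + inverse (Suc n))) \<longlonglongrightarrow> G \<alpha>"
  proof -
    have "(\<Inter>n. {x\<in>B. h x \<le> \<alpha> + inverse (real (Suc n))}) = {x\<in>B. h x \<le> \<alpha>}"
    proof (intro equalityI subsetI)
      fix x assume x: "x \<in> (\<Inter>n. {x\<in>B. h x \<le> \<alpha> + inverse (real (Suc n))})"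
      have "h x \<le> \<alpha> + 0"
        by (rule LIMSEQ_le_const[OF tendsto_add[OF tendsto_const LIMSEQ_inverse_real_of_nat]]) (use x in auto)
      with x show "x \<in> {x\<in>B. h x \<le> \<alpha>}" by auto
    qed (auto intro: add_increasing2)
    moreover have "(\<lambda>n. G (\<alpha> + inverse (Suc n))) \<longlonglongrightarrow> measure M (\<Inter>n. {x\<in>B. h x \<le> \<alpha> + inverse (real (Suc n))})"
      unfolding G_def
    proof (intro Lim_measure_decseq)
      show "decseq (\<lambda>n. {x \<in> B. h x \<le> \<alpha> + inverse (real (Suc n))})"
        by (auto simp: decseq_def simp del: of_nat_Suc intro: order_trans[OF _ add_left_mono[OF inv_mono]])
    qed auto
    ultimately show ?thesis by (simp add: G_def)
  qed
  have "measure M B / 2 \<le> G \<alpha>"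
  proof (rule LIMSEQ_le_const[OF lim1], intro exI allI impI)
    show "measure M B / 2 \<le> G (\<alpha> + inverse (Suc n))" for n
      using above[of "\<alpha> + inverse (Suc n)"] by simp
  qed
  moreover have "measure M {x\<in>B. h x < \<alpha>} \<le> measure M B / 2"
  proof -
    have "(\<Union>n. {x\<in>B. h x \<le> \<alpha> - inverse (real (Suc n))}) = {x\<in>B. h x < \<alpha>}"
    proof (intro equalityI subsetI)
      fix x assume x: "x \<in> {x\<in>B. h x < \<alpha>}"
      then obtain n where "inverse (real (Suc n)) < \<alpha> - h x" using reals_Archimedean[of "\<alpha> - h x"] by auto
      with x show "x \<in> (\<Union>n. {x\<in>B. h x \<le> \<alpha> - inverse (real (Suc n))})" by (auto intro!: exI[of _ n])
    qed (auto simp del: of_nat_Suc elim!: le_less_trans)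
    moreover have "(\<lambda>n. G (\<alpha> - inverse (Suc n))) \<longlonglongrightarrow> measure M (\<Union>n. {x\<in>B. h x \<le> \<alpha> - inverse (real (Suc n))})"
      unfolding G_def
    proof (intro Lim_measure_incseq)
      show "incseq (\<lambda>n. {x \<in> B. h x \<le> \<alpha> - inverse (real (Suc n))})"
        by (auto simp: incseq_def simp del: of_nat_Suc intro: order_trans[OF _ diff_left_mono[OF inv_mono]])
      have "emeasure M (\<Union>n. {x \<in> B. h x \<le> \<alpha> - inverse (real (Suc n))}) \<le> emeasure M B"
        by (intro emeasure_mono) auto
      then show "emeasure M (\<Union>n. {x \<in> B. h x \<le> \<alpha> - inverse (real (Suc n))}) \<noteq> \<infinity>"
        using B by (auto simp: fmeasurable_def top_unique)
    qed auto
    ultimately have lim2: "(\<lambda>n. G (\<alpha> - inverse (Suc n))) \<longlonglongrightarrow> measure M {x\<in>B. h x < \<alpha>}" by simp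
    show ?thesis
    proof (rule LIMSEQ_le_const2[OF lim2], intro exI allI impI)
      show "G (\<alpha> - inverse (Suc n)) \<le> measure M B / 2" for n
        using below[of "\<alpha> - inverse (Suc n)"] by simp
    qed
  qed
  moreover have "measure M B = measure M {x\<in>B. h x < \<alpha>} + measure M {x\<in>B. \<alpha> \<le> h x}"
  proof -
    have "{x\<in>B. h x < \<alpha>} \<union> {x\<in>B. \<alpha> \<le> h x} = B" by auto
    moreover have "{x\<in>B. h x < \<alpha>} \<inter> {x\<in>B. \<alpha> \<le> h x} = {}" by auto
    ultimately show ?thesis
      using fms(2,3)[THEN fmeasurableD2] measure_Union[of M "{x\<in>B. h x < \<alpha>}" "{x\<in>B. \<alpha> \<le> h x}"] by auto
  qed
  ultimately show ?thesis using that[of \<alpha>] by (simp add: G_def)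
qed

section \<open>Testing the commutator\<close>

lemma continuous_on_Cc_inf:
  assumes "Cc_inf f" shows "continuous_on UNIV f"
proof -
  have "f differentiable (at x)" for x
    using assms unfolding Cc_inf_def smooth_fun_def by (auto dest!: spec[of _ "[]"])
  then show ?thesis
    by (intro continuous_at_imp_continuous_on ballI differentiable_imp_continuous_within)
qed

lemma eq_0_outside_fsupp: "x \<notin> fsupp f \<Longrightarrow> f x = 0"
  using closure_subset[of "{x. f x \<noteq> 0}"] by (auto simp: fsupp_def)

lemma Cc_inf_bounded:
  assumes "Cc_inf f" obtains B where "\<And>x. norm (f x) \<le> B" "0 \<le> B"
proof -
  have "compact (f ` fsupp f)"
    using assms by (intro compact_continuous_image continuous_on_subset[OF continuous_on_Cc_inf[OF assms] subset_UNIV])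
      (simp add: Cc_inf_def)
  from compact_imp_bounded[OF this] obtain B where B: "0 < B" "\<forall>y\<in>f ` fsupp f. norm y \<le> B"
    by (auto simp: bounded_pos)
  have "norm (f x) \<le> B" for x
    using B eq_0_outside_fsupp[of x f] by (cases "x \<in> fsupp f") auto
  then show ?thesis using that[of B] B(1) by simp
qed

lemma borel_measurable_Cc_inf: "Cc_inf f \<Longrightarrow> f \<in> borel_measurable lebesgue"
  by (rule borel_measurable_lebesgue_continuous[OF continuous_on_Cc_inf])

lemma sets_lebesgue_compact: "compact S \<Longrightarrow> S \<in> sets lebesgue"
  by (simp add: borel_compact)

lemma in_Lp_1_iff: "in_Lp 1 f \<longleftrightarrow> integrable lebesgue f" for f :: "'a::euclidean_space \<Rightarrow> complex"
  by (simp add: in_Lp_def integrable_iff_bounded powr_one' )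

lemma in_Lp_loc_1_integrable:
  fixes b :: "'a::euclidean_space \<Rightarrow> real"
  assumes "in_Lp_loc 1 b" "compact S"
  shows "integrable lebesgue (\<lambda>x. indicator S x * b x)"
proof (rule integrableI_bounded)
  show "(\<lambda>x. indicator S x * b x) \<in> borel_measurable lebesgue"
    using assms by (intro borel_measurable_times borel_measurable_indicator sets_lebesgue_compact)
      (simp_all add: in_Lp_loc_def)
  have "(\<integral>\<^sup>+x. ennreal (norm (indicator S x * b x)) \<partial>lebesgue) = (\<integral>\<^sup>+ x\<in>S. ennreal (norm (b x) powr 1) \<partial>lebesgue)"
    by (intro nn_integral_cong) (auto simp: indicator_def)
  also have "\<dots> < \<infinity>" using assms by (simp add: in_Lp_loc_def)
  finally show "(\<integral>\<^sup>+x. ennreal (norm (indicator S x * b x)) \<partial>lebesgue) < \<infinity>" .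
qed

lemma integrable_bounded_compact:
  fixes f :: "'a::euclidean_space \<Rightarrow> complex"
  assumes "Cc_inf f" "in_Lp_loc 1 b"
  shows "integrable lebesgue (\<lambda>x. complex_of_real (b x) * f x)"
proof -
  obtain B where B: "\<And>x. norm (f x) \<le> B" "0 \<le> B" using Cc_inf_bounded[OF assms(1)] by metis
  have c: "compact (fsupp f)" using assms by (simp add: Cc_inf_def)
  show ?thesis
  proof (rule Bochner_Integration.integrable_bound)
    show "integrable lebesgue (\<lambda>x. B * (indicator (fsupp f) x * b x))"
      by (intro integrable_mult_right in_Lp_loc_1_integrable[OF assms(2) c])
    show "AE x in lebesgue. norm (complex_of_real (b x) * f x) \<le> norm (B * (indicator (fsupp f) x * b x))"
    proof (rule AE_I2)
      fix x
      show "norm (complex_of_real (b x) * f x) \<le> norm (B * (indicator (fsupp f) x * b x))"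
      proof (cases "x \<in> fsupp f")
        case True
        then show ?thesis using B mult_left_mono[OF B(1), of "\<bar>b x\<bar>" x]
          by (simp add: norm_mult abs_mult mult.commute)
      qed (simp add: eq_0_outside_fsupp)
    qed
  qed (use assms borel_measurable_Cc_inf[OF assms(1)] in \<open>auto simp: in_Lp_loc_def\<close>)
qed

lemma in_Lp_loc_const: "in_Lp_loc 1 (\<lambda>x::'a::euclidean_space. 1::real)"
  using emeasure_compact_finite by (auto simp: in_Lp_loc_def sets_lebesgue_compact borel_compact)

lemma integrable_Cc_inf: "Cc_inf f \<Longrightarrow> integrable lebesgue f"
  using integrable_bounded_compact[OF _ in_Lp_loc_const, of f] by simp

lemma fsupp_mult_subset: "fsupp (\<lambda>x. g x * f x) \<subseteq> fsupp f"
  unfolding fsupp_def by (intro closure_mono) auto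

text \<open>Multiplying by \<open>b\<close> destroys smoothness but leaves an integrable function of
  compact support. This is the class in which the kernel formula is used for the second term of the
  commutator.\<close>

lemma L1c_mult_Cc_inf:
  assumes "Cc_inf f" "in_Lp_loc 1 b"
  shows "L1c (\<lambda>x. complex_of_real (b x) * f x)"
  unfolding L1c_def in_Lp_1_iff
proof
  have "compact (fsupp f)" using assms by (simp add: Cc_inf_def)
  from compact_Int_closed[OF this, of "fsupp (\<lambda>x. complex_of_real (b x) * f x)"]
  show "compact (fsupp (\<lambda>x. complex_of_real (b x) * f x))"
    using fsupp_mult_subset[of "\<lambda>x. complex_of_real (b x)" f] by (simp add: inf.absorb2 fsupp_def)
qed (rule integrable_bounded_compact[OF assms])

lemma L1c_Cc_inf: "Cc_inf f \<Longrightarrow> L1c f"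
  using L1c_mult_Cc_inf[OF _ in_Lp_loc_const, of f] by simp

section \<open>Kernel integral of the commutator\<close>

context cz_kernel
begin

text \<open>With \<open>x\<close> outside \<open>S\<close> and all entries in \<open>S\<close> the
  kernel stays off the diagonal, so it may be exchanged for its measurable version; integrability
  then follows from that of a tensor product.\<close>

lemma integrable_kernel_prod:
  assumes f: "\<And>i. i < m \<Longrightarrow> integrable lebesgue (f i)" "\<And>i y. i < m \<Longrightarrow> y \<notin> S \<Longrightarrow> f i y = 0"
    and B: "\<And>y. (\<And>i. i < m \<Longrightarrow> y i \<in> S) \<Longrightarrow> norm (K x y) \<le> B" and x: "x \<notin> S"
  shows "integrable (PiM {..<m} (\<lambda>_. lebesgue)) (\<lambda>y. K x y * (\<Prod>i<m. f i (y i)))"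
proof -
  interpret product_sigma_finite "\<lambda>_::nat. lebesgue :: 'a measure"
    by (simp add: product_sigma_finite_def sigma_finite_lebesgue)
  let ?K = "\<lambda>y. if off_diag m x y then K x y else 0"
  have cases: "(\<Prod>i<m. f i (y i)) = 0 \<or> (\<forall>i<m. y i \<in> S)" for y
    using f(2) by (auto intro: prod_zero)
  have off: "off_diag m x y" if "\<forall>i<m. y i \<in> S" for y
    using that x m by (auto simp: off_diag_def)
  have eq: "K x y * (\<Prod>i<m. f i (y i)) = ?K y * (\<Prod>i<m. f i (y i))" for y
    using cases[of y] off[of y] by auto
  have int: "integrable (PiM {..<m} (\<lambda>_. lebesgue)) (\<lambda>y. \<Prod>i<m. f i (y i))"
    using f by (intro product_integrable_prod) auto
  show ?thesis
    unfolding eq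
  proof (rule Bochner_Integration.integrable_bound)
    show "integrable (PiM {..<m} (\<lambda>_. lebesgue)) (\<lambda>y. complex_of_real \<bar>B\<bar> * (\<Prod>i<m. f i (y i)))"
      by (intro integrable_mult_right int)
    show "(\<lambda>y. ?K y * (\<Prod>i<m. f i (y i))) \<in> borel_measurable (PiM {..<m} (\<lambda>_. lebesgue))"
      by (intro borel_measurable_times measurable_kernel borel_measurable_integrable[OF int])
    show "AE y in PiM {..<m} (\<lambda>_. lebesgue). norm (?K y * (\<Prod>i<m. f i (y i))) \<le> norm (complex_of_real \<bar>B\<bar> * (\<Prod>i<m. f i (y i)))"
    proof (rule AE_I2)
      fix y
      show "norm (?K y * (\<Prod>i<m. f i (y i))) \<le> norm (complex_of_real \<bar>B\<bar> * (\<Prod>i<m. f i (y i)))"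
      proof (cases "\<forall>i<m. y i \<in> S")
        case True
        then have "norm (?K y) \<le> \<bar>B\<bar>" using B[of y] by auto
        then show ?thesis unfolding norm_mult by (intro mult_right_mono) auto
      next
        case False
        then have 0: "(\<Prod>i<m. f i (y i)) = 0" using cases[of y] by blast
        show ?thesis unfolding 0 by (simp only: mult_zero_right norm_zero order_refl)
      qed
    qed
  qed
qed

end

locale cz_commutator = cz_kernel m K \<omega> C for m and K :: "'a::euclidean_space \<Rightarrow> (nat \<Rightarrow> 'a) \<Rightarrow> complex" and \<omega> C +
  fixes T :: "(nat \<Rightarrow> 'a \<Rightarrow> complex) \<Rightarrow> 'a \<Rightarrow> complex" and b :: "'a \<Rightarrow> real"
  assumes linear: "multilinear_op m T" and rep: "kernel_rep_L1c m T K" and b: "in_Lp_loc 1 b"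
begin

text \<open>Both terms of the commutator are kernel integrals at a point outside \<open>S\<close>.
  Only entry 0 is multiplied by \<open>b\<close>, so subtracting leaves the factor
  \<open>b x - b (y 0)\<close>.\<close>

lemma commutator_eq_integral:
  assumes f: "\<And>i. i < m \<Longrightarrow> Cc_inf (f i)" "\<And>i y. i < m \<Longrightarrow> y \<notin> S \<Longrightarrow> f i y = 0" and S: "closed S" "x \<notin> S"
    and B: "\<And>y. (\<And>i. i < m \<Longrightarrow> y i \<in> S) \<Longrightarrow> norm (K x y) \<le> B"
  shows "integrable (PiM {..<m} (\<lambda>_. lebesgue)) (\<lambda>y. complex_of_real (b x - b (y 0)) * (K x y * (\<Prod>i<m. f i (y i))))"
    and "commutator1 b T f x = (\<integral>y. complex_of_real (b x - b (y 0)) * (K x y * (\<Prod>i<m. f i (y i))) \<partial>PiM {..<m} (\<lambda>_. lebesgue))"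
proof -
  let ?M = "PiM {..<m} (\<lambda>_. lebesgue :: 'a measure)"
  let ?f = "f(0 := (\<lambda>y. complex_of_real (b y) * f 0 y))"
  have f': "i < m \<Longrightarrow> integrable lebesgue (?f i)" "i < m \<Longrightarrow> y \<notin> S \<Longrightarrow> ?f i y = 0" for i y
    using f integrable_Cc_inf integrable_bounded_compact[OF _ b] by auto
  have i1: "integrable ?M (\<lambda>y. K x y * (\<Prod>i<m. f i (y i)))"
    using f integrable_Cc_inf by (intro integrable_kernel_prod[OF _ _ B S(2)]) auto
  have i2: "integrable ?M (\<lambda>y. K x y * (\<Prod>i<m. ?f i (y i)))"
    using f' by (intro integrable_kernel_prod[OF _ _ B S(2)]) auto
  have prod': "(\<Prod>i<m. ?f i (y i)) = complex_of_real (b (y 0)) * (\<Prod>i<m. f i (y i))" for y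
  proof -
    obtain k where k: "m = Suc k" using m by (cases m) auto
    show ?thesis unfolding k prod.lessThan_Suc_shift by simp
  qed
  have supp: "x \<notin> fsupp (f 0)" "x \<notin> fsupp (?f 0)"
    using fsupp_subset[of S "f 0"] fsupp_mult_subset[of "\<lambda>y. complex_of_real (b y)" "f 0"] S f(2) m by auto
  have T1: "T f x = kernel_integral m K f x"
    using m supp(1) by (intro rep[unfolded kernel_rep_L1c_def, rule_format] L1c_Cc_inf f(1)) auto
  have T2: "T ?f x = kernel_integral m K ?f x"
  proof (intro rep[unfolded kernel_rep_L1c_def, rule_format])
    show "L1c (?f i)" if "i < m" for i
      using L1c_Cc_inf[OF f(1)[OF that]] L1c_mult_Cc_inf[OF f(1)[OF that] b] by (cases "i = 0") auto
  qed (use m supp(2) in auto)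
  have eq: "complex_of_real (b x - b (y 0)) * (K x y * (\<Prod>i<m. f i (y i)))
     = complex_of_real (b x) * (K x y * (\<Prod>i<m. f i (y i))) - K x y * (\<Prod>i<m. ?f i (y i))" for y
    unfolding prod' by (simp add: algebra_simps)
  show "integrable ?M (\<lambda>y. complex_of_real (b x - b (y 0)) * (K x y * (\<Prod>i<m. f i (y i))))"
    unfolding eq by (intro Bochner_Integration.integrable_diff integrable_mult_right i1 i2)
  show "commutator1 b T f x = (\<integral>y. complex_of_real (b x - b (y 0)) * (K x y * (\<Prod>i<m. f i (y i))) \<partial>?M)"
    unfolding eq commutator1_def T1 T2 kernel_integral_def
    by (subst Bochner_Integration.integral_diff[OF integrable_mult_right[OF i1] i2]) simp
qed

end

text \<open>Entry 0 is the one that meets \<open>b\<close> and carries the approximate indicator;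
  the remaining ones only need to be nonnegative with integral bounded below. Entries from
  \<open>m\<close> on are fixed as zero, as \<open>multilinear_diagonal_le\<close> requires.\<close>

definition test_fun :: "nat \<Rightarrow> ('a \<Rightarrow> real) \<Rightarrow> ('a \<Rightarrow> real) \<Rightarrow> nat \<Rightarrow> 'a \<Rightarrow> complex" where
  "test_fun m \<phi> \<psi> i = (\<lambda>y. complex_of_real (if i = 0 then \<phi> y else if i < m then \<psi> y else 0))"

lemma Cc_inf_test_fun:
  assumes "Cc_inf (\<lambda>y. complex_of_real (\<phi> y))" "Cc_inf (\<lambda>y. complex_of_real (\<psi> y))"
  shows "Cc_inf (test_fun m \<phi> \<psi> i)"
proof -
  have "Cc_inf (\<lambda>y. complex_of_real 0)"
    by (rule Cc_inf_smooth_alg[OF smooth_alg.const compact_empty]) simp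
  then show ?thesis using assms by (cases "i = 0"; cases "i < m"; simp add: test_fun_def)
qed

lemma integrable_indicator_compact:
  assumes "compact S"
  shows "integrable lebesgue (indicator S :: 'a::euclidean_space \<Rightarrow> real)"
  using emeasure_compact_finite[OF assms] assms
  by (intro integrable_real_indicator) (auto simp: borel_compact)

text \<open>The pointwise bound t \<le> 1 + t^q reduces the claim to integrability of the q-th power
  and of a compact indicator.\<close>

lemma integrable_mult_in_Lp:
  fixes h g :: "'a::euclidean_space \<Rightarrow> complex"
  assumes "in_Lp q h" "1 \<le> q" and g: "g \<in> borel_measurable lebesgue" "\<And>x. norm (g x) \<le> M * indicator S x"
    and S: "compact S" and M: "0 \<le> M"
  shows "integrable lebesgue (\<lambda>x. g x * h x)"
proof (rule Bochner_Integration.integrable_bound)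
  have hm: "h \<in> borel_measurable lebesgue" using assms by (simp add: in_Lp_def)
  have "integrable lebesgue (\<lambda>x. norm (h x) powr q)"
    using assms(1) hm by (intro integrableI_nonneg) (auto simp: in_Lp_def)
  moreover have "integrable lebesgue (indicator S :: 'a \<Rightarrow> real)"
    by (rule integrable_indicator_compact[OF S])
  ultimately show "integrable lebesgue (\<lambda>x. M * (indicator S x + norm (h x) powr q))" by auto
  show "(\<lambda>x. g x * h x) \<in> borel_measurable lebesgue" using g hm by auto
  have p: "t \<le> 1 + t powr q" if "0 \<le> t" for t :: real
  proof (cases "t \<le> 1")
    case False
    then have "t powr 1 \<le> t powr q" using assms(2) by (intro powr_mono) auto
    then show ?thesis using False by simp
  qed (simp add: add_increasing2)
  show "AE x in lebesgue. norm (g x * h x) \<le> norm (M * (indicator S x + norm (h x) powr q))"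
  proof (rule AE_I2)
    fix x
    have "norm (g x * h x) \<le> M * indicator S x * norm (h x)"
      unfolding norm_mult by (intro mult_right_mono g(2)) auto
    also have "\<dots> \<le> M * (indicator S x + norm (h x) powr q)"
      unfolding mult.assoc using p[of "norm (h x)"] M
      by (intro mult_left_mono) (auto simp: indicator_def)
    finally show "norm (g x * h x) \<le> norm (M * (indicator S x + norm (h x) powr q))" using M by simp
  qed
qed

context cz_commutator
begin

text \<open>On the test set, \<open>K\<close> is within \<open>|K0| / 2\<close> of the constant \<open>K0\<close>, and \<open>s * (b y - b x)\<close> does not
  change sign for \<open>y\<close> in \<open>F\<close>, so after rotating by the phase of \<open>K0\<close> no cancellation takes place.\<close>

lemma commutator_lower_bound:
  assumes s: "s = 1 \<or> s = -1"
    and K0: "K0 \<noteq> 0" "\<And>y. (\<And>i. i < m \<Longrightarrow> y i \<in> S) \<Longrightarrow> norm (K x y - K0) \<le> norm K0 / 2"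
    and S: "compact S" "x \<notin> S"
    and \<phi>: "Cc_inf (\<lambda>y. complex_of_real (\<phi> y))" "\<And>y. y \<notin> S \<Longrightarrow> \<phi> y = 0"
    and \<psi>: "Cc_inf (\<lambda>y. complex_of_real (\<psi> y))" "\<And>y. y \<notin> S \<Longrightarrow> \<psi> y = 0" "\<And>y. 0 \<le> \<psi> y"
    and F: "F \<in> sets lebesgue" "F \<subseteq> S" "\<And>y. y \<in> F \<Longrightarrow> s * \<alpha> \<le> s * b y" and x: "s * b x \<le> s * \<alpha>"
  shows "norm K0 / 2 * (\<integral>y. \<psi> y \<partial>lebesgue) ^ (m - 1) *
      ((\<integral>y. indicator F y * (s * (b y - \<alpha>)) \<partial>lebesgue)
        - 3 * (1 + \<bar>b x\<bar>) * (\<integral>y. \<bar>\<phi> y - indicator F y\<bar> * (indicator S y * (1 + \<bar>b y\<bar>)) \<partial>lebesgue))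
    \<le> Re (- (of_real s * (cnj K0 / of_real (norm K0))) * commutator1 b T (test_fun m \<phi> \<psi>) x)"
proof -
  interpret product_sigma_finite "\<lambda>_::nat. lebesgue :: 'a measure"
    by (simp add: product_sigma_finite_def sigma_finite_lebesgue)
  obtain k where k: "m = Suc k" using m by (cases m) auto
  define N where "N = norm K0"
  have N: "0 < N" using K0 by (simp add: N_def)
  define \<sigma> where "\<sigma> = cnj K0 / of_real N"
  have \<sigma>: "norm \<sigma> = 1" "\<sigma> * K0 = of_real N"
    using N by (simp_all add: \<sigma>_def norm_divide N_def) (simp add: complex_norm_square[symmetric] power2_eq_square mult.commute)
  let ?M = "PiM {..<m} (\<lambda>_. lebesgue :: 'a measure)"
  let ?f = "test_fun m \<phi> \<psi>"
  have f: "Cc_inf (?f i)" "y \<notin> S \<Longrightarrow> ?f i y = 0" for i y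
    using \<phi> \<psi> by (simp_all add: Cc_inf_test_fun) (simp add: test_fun_def)
  have KB: "norm (K x y) \<le> 3 / 2 * N" if "\<And>i. i < m \<Longrightarrow> y i \<in> S" for y
  proof -
    have "norm (K x y - K0) \<le> norm K0 / 2" by (rule K0(2)) (rule that)
    then show ?thesis using norm_triangle_sub[of "K x y" K0] unfolding N_def by linarith
  qed
  have U: "integrable ?M (\<lambda>y. complex_of_real (b x - b (y 0)) * (K x y * (\<Prod>i<m. ?f i (y i))))"
    "commutator1 b T ?f x = (\<integral>y. complex_of_real (b x - b (y 0)) * (K x y * (\<Prod>i<m. ?f i (y i))) \<partial>?M)"
    by (rule commutator_eq_integral[where S = S and B = "3 / 2 * N"];
        (rule f compact_imp_closed[OF S(1)] S(2) KB; assumption?))+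
  have bS: "integrable lebesgue (\<lambda>y. indicator S y * b y)" by (rule in_Lp_loc_1_integrable[OF b S(1)])
  have 1: "integrable lebesgue (indicator S :: 'a \<Rightarrow> real)"
    by (rule integrable_indicator_compact[OF S(1)])
  have int1: "integrable lebesgue (\<lambda>y. indicator F y * (s * (b y - \<alpha>)))"
  proof (rule Bochner_Integration.integrable_bound)
    show "integrable lebesgue (\<lambda>y. norm (indicator S y * b y) + \<bar>\<alpha>\<bar> * indicator S y)"
      using bS 1 by auto
    show "(\<lambda>y. indicator F y * (s * (b y - \<alpha>))) \<in> borel_measurable lebesgue"
      using F b by (auto simp: in_Lp_loc_def)
    show "AE y in lebesgue. norm (indicator F y * (s * (b y - \<alpha>))) \<le> norm (norm (indicator S y * b y) + \<bar>\<alpha>\<bar> * indicator S y)"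
    proof (rule AE_I2)
      fix y show "norm (indicator F y * (s * (b y - \<alpha>))) \<le> norm (norm (indicator S y * b y) + \<bar>\<alpha>\<bar> * indicator S y)"
        using s F(2) by (auto simp: indicator_def abs_mult)
    qed
  qed
  obtain B where B: "\<And>y. \<bar>\<phi> y\<bar> \<le> B" "0 \<le> B" using Cc_inf_bounded[OF \<phi>(1)] by (metis norm_of_real)
  have \<phi>m: "\<phi> \<in> borel_measurable lebesgue"
  proof -
    show ?thesis
      using borel_measurable_Cc_inf[OF \<phi>(1)] unfolding borel_measurable_complex_iff by simp
  qed
  have int2: "integrable lebesgue (\<lambda>y. \<bar>\<phi> y - indicator F y\<bar> * (indicator S y * (1 + \<bar>b y\<bar>)))"
  proof (rule Bochner_Integration.integrable_bound)
    show "integrable lebesgue (\<lambda>y. (B + 1) * (norm (indicator S y * b y) + indicator S y))"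
      using bS 1 by auto
    show "(\<lambda>y. \<bar>\<phi> y - indicator F y\<bar> * (indicator S y * (1 + \<bar>b y\<bar>))) \<in> borel_measurable lebesgue"
      using F b \<phi>m sets_lebesgue_compact[OF S(1)]
      by (intro borel_measurable_times borel_measurable_indicator borel_measurable_abs borel_measurable_diff
          borel_measurable_add) (auto simp: in_Lp_loc_def)
    show "AE y in lebesgue. norm (\<bar>\<phi> y - indicator F y\<bar> * (indicator S y * (1 + \<bar>b y\<bar>)))
        \<le> norm ((B + 1) * (norm (indicator S y * b y) + indicator S y))"
    proof (rule AE_I2)
      fix y
      have "\<bar>\<phi> y - indicator F y\<bar> \<le> B + 1" using B(1)[of y] by (auto simp: indicator_def)
      then have "\<bar>\<phi> y - indicator F y\<bar> * (1 + \<bar>b y\<bar>) \<le> (B + 1) * (1 + \<bar>b y\<bar>)"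
        by (intro mult_right_mono) auto
      then show "norm (\<bar>\<phi> y - indicator F y\<bar> * (indicator S y * (1 + \<bar>b y\<bar>)))
        \<le> norm ((B + 1) * (norm (indicator S y * b y) + indicator S y))"
        using B by (simp add: indicator_def abs_mult add.commute)
    qed
  qed
  \<comment> \<open>A minorant of tensor form, so that its integral factorises. The first part of
    \<open>G 0\<close> uses that the rotated kernel has real part at least N/2; the second pays for
    replacing the indicator by \<phi>, that real part being at most 3N/2 and |b y - b x| at most (1
    + |b x|) (1 + |b y|).\<close>
  define G where "G i = (if i = (0::nat) then (\<lambda>y. N / 2 * (indicator F y * (s * (b y - \<alpha>))
     - 3 * (1 + \<bar>b x\<bar>) * (\<bar>\<phi> y - indicator F y\<bar> * (indicator S y * (1 + \<bar>b y\<bar>))))) else \<psi>)" for i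
  have intG: "integrable lebesgue (G i)" for i
  proof (cases "i = 0")
    case False
    have "integrable lebesgue (\<lambda>y. Re (complex_of_real (\<psi> y)))"
      by (intro integrable_Re integrable_Cc_inf \<psi>)
    with False show ?thesis by (simp add: G_def)
  qed (use int1 int2 in \<open>simp add: G_def\<close>)
  have pw: "(\<Prod>i<m. G i (y i)) \<le> Re (- (of_real s * \<sigma>) * (complex_of_real (b x - b (y 0)) * (K x y * (\<Prod>i<m. ?f i (y i)))))" for y
  proof -
    define P where "P = (\<Prod>i<k. \<psi> (y (Suc i)))"
    have P: "0 \<le> P" unfolding P_def using \<psi> by (intro prod_nonneg) auto
    have e1: "(\<Prod>i<m. G i (y i)) = G 0 (y 0) * P"
      unfolding k prod.lessThan_Suc_shift P_def by (simp add: G_def)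
    have e2: "(\<Prod>i<m. ?f i (y i)) = of_real (\<phi> (y 0) * P)"
      unfolding k prod.lessThan_Suc_shift P_def by (simp add: test_fun_def k)
    have e0: "- (of_real s * \<sigma>) * (complex_of_real (b x - b (y 0)) * (K x y * (\<Prod>i<m. ?f i (y i))))
        = of_real (s * (b (y 0) - b x) * \<phi> (y 0) * P) * (\<sigma> * K x y)"
      unfolding e2 by (simp add: algebra_simps)
    have e3: "Re (- (of_real s * \<sigma>) * (complex_of_real (b x - b (y 0)) * (K x y * (\<Prod>i<m. ?f i (y i)))))
        = s * (b (y 0) - b x) * \<phi> (y 0) * Re (\<sigma> * K x y) * P"
    proof -
      have Rm: "Re (complex_of_real r * z) = r * Re z" for r z by simp
      show ?thesis unfolding e0 Rm by (simp only: mult_ac)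
    qed
    show ?thesis
    proof (cases "\<forall>i<m. y i \<in> S")
      case True
      define R where "R = Re (\<sigma> * K x y)"
      have "norm (K x y - K0) \<le> norm K0 / 2" by (rule K0(2)) (use True in blast)
      then have "norm (\<sigma> * K x y - of_real N) \<le> N / 2"
        using \<sigma> norm_mult[of \<sigma> "K x y - K0"] by (simp add: right_diff_distrib N_def)
      then have R: "N / 2 \<le> R" "R \<le> 3 / 2 * N"
        using abs_Re_le_cmod[of "\<sigma> * K x y - of_real N"] by (auto simp: R_def)
      have y0: "y 0 \<in> S" using True m by auto
      let ?t = "s * (b (y 0) - b x)" and ?D = "\<phi> (y 0) - indicator F (y 0)"
      have "N / 2 * (indicator F (y 0) * (s * (b (y 0) - \<alpha>))) \<le> ?t * indicator F (y 0) * R"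
      proof (cases "y 0 \<in> F")
        case True
        have "N / 2 * (s * (b (y 0) - \<alpha>)) \<le> R * ?t"
        proof (rule mult_mono)
          show "s * (b (y 0) - \<alpha>) \<le> ?t" "0 \<le> s * (b (y 0) - \<alpha>)"
            using F(3)[OF True] x by (simp_all add: right_diff_distrib)
        qed (use R N in auto)
        then show ?thesis using True by (simp add: mult.commute)
      qed simp
      moreover have "- (3 / 2 * N * (1 + \<bar>b x\<bar>) * (\<bar>?D\<bar> * (1 + \<bar>b (y 0)\<bar>))) \<le> ?t * ?D * R"
      proof -
        have "\<bar>?t\<bar> \<le> \<bar>b x\<bar> + \<bar>b (y 0)\<bar>" using s by (auto simp: abs_mult)
        also have "\<dots> \<le> (1 + \<bar>b x\<bar>) * (1 + \<bar>b (y 0)\<bar>)" by (simp add: algebra_simps)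
        finally have "\<bar>?t\<bar> * \<bar>?D\<bar> * \<bar>R\<bar> \<le> (1 + \<bar>b x\<bar>) * (1 + \<bar>b (y 0)\<bar>) * \<bar>?D\<bar> * (3 / 2 * N)"
          using R N by (intro mult_mono) auto
        moreover have "- (\<bar>?t\<bar> * \<bar>?D\<bar> * \<bar>R\<bar>) \<le> ?t * ?D * R"
          unfolding abs_mult[symmetric] by (simp add: minus_le_iff abs_ge_minus_self)
        moreover have "(1 + \<bar>b x\<bar>) * (1 + \<bar>b (y 0)\<bar>) * \<bar>?D\<bar> * (3 / 2 * N)
            = 3 / 2 * N * (1 + \<bar>b x\<bar>) * (\<bar>?D\<bar> * (1 + \<bar>b (y 0)\<bar>))" by (simp only: mult_ac)
        ultimately show ?thesis by linarith
      qed
      moreover have "G 0 (y 0) = N / 2 * (indicator F (y 0) * (s * (b (y 0) - \<alpha>)))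
          + - (3 / 2 * N * (1 + \<bar>b x\<bar>) * (\<bar>?D\<bar> * (1 + \<bar>b (y 0)\<bar>)))"
      proof -
        have gen: "N / 2 * (A1 - 3 * A2 * A3) = N / 2 * A1 + - (3 / 2 * N * A2 * A3)" for A1 A2 A3
          by (simp add: algebra_simps)
        have "G 0 (y 0) = N / 2 * (indicator F (y 0) * (s * (b (y 0) - \<alpha>))
            - 3 * (1 + \<bar>b x\<bar>) * (\<bar>?D\<bar> * (1 + \<bar>b (y 0)\<bar>)))"
          using y0 by (simp add: G_def)
        then show ?thesis unfolding gen .
      qed
      moreover have "?t * \<phi> (y 0) * R = ?t * indicator F (y 0) * R + ?t * ?D * R"
        by (simp add: algebra_simps)
      ultimately have "G 0 (y 0) \<le> ?t * \<phi> (y 0) * R" by linarith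
      then show ?thesis unfolding e1 e3 R_def[symmetric] using P by (intro mult_right_mono)
    next
      case False
      then obtain i where i: "i < m" "y i \<notin> S" by auto
      show ?thesis
      proof (cases i)
        case 0
        then have "y 0 \<notin> F" using i F(2) by auto
        then show ?thesis unfolding e1 e3 using i 0 by (simp add: G_def \<phi>(2))
      next
        case (Suc j)
        then have "P = 0" unfolding P_def using i k \<psi>(2) by (intro prod_zero) auto
        then show ?thesis unfolding e1 e3 by simp
      qed
    qed
  qed
  have "(\<integral>y. (\<Prod>i<m. G i (y i)) \<partial>?M) \<le> (\<integral>y. Re (- (of_real s * \<sigma>) * (complex_of_real (b x - b (y 0)) * (K x y * (\<Prod>i<m. ?f i (y i))))) \<partial>?M)"
  proof (rule integral_mono)
    show "integrable ?M (\<lambda>y. \<Prod>i<m. G i (y i))" by (intro product_integrable_prod intG) auto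
    show "integrable ?M (\<lambda>y. Re (- (of_real s * \<sigma>) * (complex_of_real (b x - b (y 0)) * (K x y * (\<Prod>i<m. ?f i (y i))))))"
      by (intro integrable_Re integrable_mult_right U(1))
  qed (rule pw)
  also have "\<dots> = Re (\<integral>y. - (of_real s * \<sigma>) * (complex_of_real (b x - b (y 0)) * (K x y * (\<Prod>i<m. ?f i (y i)))) \<partial>?M)"
    by (rule integral_Re[OF integrable_mult_right[OF U(1)]])
  also have "(\<integral>y. - (of_real s * \<sigma>) * (complex_of_real (b x - b (y 0)) * (K x y * (\<Prod>i<m. ?f i (y i)))) \<partial>?M)
      = - (of_real s * \<sigma>) * commutator1 b T ?f x"
    unfolding U(2) by (rule integral_mult_right_zero)
  also have "(\<integral>y. (\<Prod>i<m. G i (y i)) \<partial>?M) = (\<Prod>i<m. integral\<^sup>L lebesgue (G i))"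
    by (intro product_integral_prod intG) auto
  also have "\<dots> = integral\<^sup>L lebesgue (G 0) * (\<integral>y. \<psi> y \<partial>lebesgue) ^ k"
    unfolding k prod.lessThan_Suc_shift by (simp add: G_def)
  also have "integral\<^sup>L lebesgue (G 0) = N / 2 * ((\<integral>y. indicator F y * (s * (b y - \<alpha>)) \<partial>lebesgue)
        - 3 * (1 + \<bar>b x\<bar>) * (\<integral>y. \<bar>\<phi> y - indicator F y\<bar> * (indicator S y * (1 + \<bar>b y\<bar>)) \<partial>lebesgue))"
    using int1 int2 by (simp add: G_def)
  finally show ?thesis by (simp add: k N_def \<sigma>_def mult_ac)
qed

end

context cz_commutator
begin

text \<open>Integration over \<open>E\<close> against the unimodular constant that undoes the phase
  of \<open>K0\<close>. The coefficient of the error does not depend on \<phi>, so a later choice of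
  \<phi> can make the error as small as desired; the compact \<open>B\<close> keeps the integral of
  |b| finite.\<close>

lemma commutator_pairing_lower_bound:
  assumes s: "s = 1 \<or> s = -1"
    and K0: "K0 \<noteq> 0" "\<And>x y. x \<in> E \<Longrightarrow> (\<And>i. i < m \<Longrightarrow> y i \<in> S) \<Longrightarrow> norm (K x y - K0) \<le> norm K0 / 2"
    and S: "compact S" and E: "E \<in> sets lebesgue" "E \<subseteq> B" "compact B" "B \<inter> S = {}"
    and \<phi>: "Cc_inf (\<lambda>y. complex_of_real (\<phi> y))" "\<And>y. y \<notin> S \<Longrightarrow> \<phi> y = 0"
    and \<psi>: "Cc_inf (\<lambda>y. complex_of_real (\<psi> y))" "\<And>y. y \<notin> S \<Longrightarrow> \<psi> y = 0" "\<And>y. 0 \<le> \<psi> y"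
    and F: "F \<in> sets lebesgue" "F \<subseteq> S" "\<And>y. y \<in> F \<Longrightarrow> s * \<alpha> \<le> s * b y" and x: "\<And>x. x \<in> E \<Longrightarrow> s * b x \<le> s * \<alpha>"
    and q: "1 \<le> q" "in_Lp q (commutator1 b T (test_fun m \<phi> \<psi>))"
  shows "norm K0 / 2 * (\<integral>y. \<psi> y \<partial>lebesgue) ^ (m - 1) *
      (measure lebesgue E * (\<integral>y. indicator F y * (s * (b y - \<alpha>)) \<partial>lebesgue)
        - 3 * (measure lebesgue E + (\<integral>y. indicator B y * \<bar>b y\<bar> \<partial>lebesgue)) *
          (\<integral>y. \<bar>\<phi> y - indicator F y\<bar> * (indicator S y * (1 + \<bar>b y\<bar>)) \<partial>lebesgue))
    \<le> Re (\<integral>x. (- (of_real s * (cnj K0 / of_real (norm K0))) * indicator E x) * commutator1 b T (test_fun m \<phi> \<psi>) x \<partial>lebesgue)"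
proof -
  define c where "c = norm K0 / 2 * (\<integral>y. \<psi> y \<partial>lebesgue) ^ (m - 1)"
  define J where "J = (\<integral>y. indicator F y * (s * (b y - \<alpha>)) \<partial>lebesgue)"
  define D where "D = (\<integral>y. \<bar>\<phi> y - indicator F y\<bar> * (indicator S y * (1 + \<bar>b y\<bar>)) \<partial>lebesgue)"
  define \<tau> where "\<tau> = - (complex_of_real s * (cnj K0 / of_real (norm K0)))"
  let ?U = "commutator1 b T (test_fun m \<phi> \<psi>)"
  have c: "0 \<le> c" unfolding c_def using \<psi> by (intro mult_nonneg_nonneg zero_le_power Bochner_Integration.integral_nonneg) auto
  have D: "0 \<le> D" unfolding D_def by (intro Bochner_Integration.integral_nonneg) auto
  have EB: "emeasure lebesgue E < \<infinity>"
    using emeasure_mono[OF E(2), of lebesgue] E emeasure_compact_finite[OF E(3)]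
    by (auto simp: borel_compact intro: le_less_trans)
  have n\<tau>: "norm \<tau> = 1" using s K0 by (auto simp: \<tau>_def norm_mult norm_divide)
  have intU: "integrable lebesgue (\<lambda>x. (\<tau> * indicator E x) * ?U x)"
  proof (rule integrable_mult_in_Lp[OF q(2,1)])
    show "norm (\<tau> * indicator E x) \<le> 1 * indicator B x" for x
      using n\<tau> E(2) by (auto simp: norm_mult indicator_def)
  qed (use E in auto)
  have lb: "indicator E x * (c * (J - 3 * (1 + \<bar>b x\<bar>) * D)) \<le> Re ((\<tau> * indicator E x) * ?U x)" for x
  proof (cases "x \<in> E")
    case True
    then have xS: "x \<notin> S" using E by auto
    show ?thesis
      using commutator_lower_bound[OF s K0(1) K0(2)[OF True] S xS \<phi> \<psi> F x[OF True]] True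
      by (simp add: c_def J_def D_def \<tau>_def)
  qed simp
  have bB: "integrable lebesgue (\<lambda>y. indicator B y * b y)" by (rule in_Lp_loc_1_integrable[OF b E(3)])
  then have bB': "integrable lebesgue (\<lambda>y. indicator B y * \<bar>b y\<bar>)"
    using integrable_abs[OF bB] by (simp add: abs_mult)
  have bE: "integrable lebesgue (\<lambda>y. indicator E y * \<bar>b y\<bar>)"
  proof (rule Bochner_Integration.integrable_bound[OF bB'])
    show "(\<lambda>y. indicator E y * \<bar>b y\<bar>) \<in> borel_measurable lebesgue" using E b by (auto simp: in_Lp_loc_def)
    show "AE y in lebesgue. norm (indicator E y * \<bar>b y\<bar>) \<le> norm (indicator B y * \<bar>b y\<bar>)"
      using E(2) by (auto simp: indicator_def)
  qed
  have iE: "integrable lebesgue (\<lambda>x. indicator E x :: real)" using E(1) EB by simp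
  have eq: "indicator E x * (c * (J - 3 * (1 + \<bar>b x\<bar>) * D)) =
      c * (J - 3 * D) * indicator E x - 3 * c * D * (indicator E x * \<bar>b x\<bar>)" for x
    by (simp add: algebra_simps)
  have "(\<integral>x. indicator E x * (c * (J - 3 * (1 + \<bar>b x\<bar>) * D)) \<partial>lebesgue)
      = c * (J - 3 * D) * measure lebesgue E - 3 * c * D * (\<integral>x. indicator E x * \<bar>b x\<bar> \<partial>lebesgue)"
    unfolding eq using bE iE E(1) by (subst Bochner_Integration.integral_diff) auto
  moreover have "(\<integral>x. indicator E x * \<bar>b x\<bar> \<partial>lebesgue) \<le> (\<integral>x. indicator B x * \<bar>b x\<bar> \<partial>lebesgue)"
    using E(2) by (intro integral_mono bE bB') (auto simp: indicator_def)
  ultimately have "c * (measure lebesgue E * J - 3 * (measure lebesgue E + (\<integral>y. indicator B y * \<bar>b y\<bar> \<partial>lebesgue)) * D)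
      \<le> (\<integral>x. indicator E x * (c * (J - 3 * (1 + \<bar>b x\<bar>) * D)) \<partial>lebesgue)"
    using mult_left_mono[of "\<integral>x. indicator E x * \<bar>b x\<bar> \<partial>lebesgue" "\<integral>x. indicator B x * \<bar>b x\<bar> \<partial>lebesgue" "3 * c * D"] c D
    by (simp add: algebra_simps)
  also have "\<dots> \<le> (\<integral>x. Re ((\<tau> * indicator E x) * ?U x) \<partial>lebesgue)"
    unfolding eq by (intro integral_mono lb[unfolded eq] integrable_Re intU Bochner_Integration.integrable_diff
        integrable_mult_right bE iE)
  also have "\<dots> = Re (\<integral>x. (\<tau> * indicator E x) * ?U x \<partial>lebesgue)" by (rule integral_Re[OF intU])
  finally show ?thesis by (simp add: c_def J_def D_def \<tau>_def)
qed


text \<open>Scale invariance is the point: |K0| is at least of order l^(-mn), the m - 1 bumps have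
  integral at least of order l^n each, and half of the companion ball has measure of order l^n, so
  no power of \<open>l\<close> remains in \<open>C0\<close>.\<close>

lemma test_functions:
  assumes q: "1 \<le> q" and Uq: "\<And>f. (\<And>i. i < m \<Longrightarrow> Cc_inf (f i)) \<Longrightarrow> in_Lp q (commutator1 b T f)"
    and nd: "0 < c0" "\<And>y \<rho>. 0 < \<rho> \<Longrightarrow>
        (\<exists>x. dist x y \<ge> \<rho> \<and> norm (K x (\<lambda>_. y)) \<ge> 1 / (c0 * \<rho> ^ (m * DIM('a))))"
  obtains C0 \<kappa> where "0 < C0" "real DIM('a) \<le> \<kappa>"
    "\<And>c l Q. \<lbrakk>0 < l; Q \<in> sets lebesgue; Q \<subseteq> cube c l\<rbrakk> \<Longrightarrow>
      \<exists>\<alpha> g \<phi>. g \<in> borel_measurable lebesgue \<and> (\<forall>x. norm (g x) \<le> indicator (cball c (\<kappa> * l)) x) \<and>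
        \<phi> \<in> smooth_alg \<and> (\<forall>x. \<bar>\<phi> x\<bar> \<le> 2) \<and> (\<forall>x. x \<notin> cube c (2 * l) \<longrightarrow> \<phi> x = 0) \<and>
        (\<integral>x. indicator Q x * \<bar>b x - \<alpha>\<bar> \<partial>lebesgue)
          \<le> C0 * Re (\<integral>x. g x * commutator1 b T (test_fun m \<phi> (bump c l)) x \<partial>lebesgue)"
proof -
  obtain \<kappa>0 c' where c': "0 < c'" and \<kappa>0: "1 \<le> \<kappa>0" and balls: "\<And>y0 \<rho>. 0 < \<rho> \<Longrightarrow> \<exists>x0 K0. 4 * \<rho> \<le> dist x0 y0 \<and> dist x0 y0 \<le> \<kappa>0 * \<rho> \<and>
      c' / \<rho> ^ (m * DIM('a)) \<le> norm K0 \<and>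
      (\<forall>x y. x \<in> cball x0 \<rho> \<longrightarrow> (\<forall>i<m. y i \<in> cball y0 \<rho>) \<longrightarrow> norm (K x y - K0) \<le> norm K0 / 2)"
    using nondegenerate_balls[OF nd] by metis
  obtain k where k: "m = Suc k" using m by (cases m) auto
  define n where "n = real DIM('a)"
  have n: "1 \<le> n" by (simp add: n_def Suc_leI)
  define \<delta> where "\<delta> = bump_min TYPE('a)"
  have \<delta>: "0 < \<delta>" unfolding \<delta>_def by (rule bump_min_pos)
  define V where "V = unit_ball_vol n"
  have V: "0 < V" using n by (simp add: V_def)
  \<comment> \<open>The 16 collects four losses of a factor 2: from |K0| / 2, from the half ball,
    from absorbing the approximation error and from keeping one sign only. The power of
    \<open>n\<close> comes from \<rho> = n l, and \<delta> is the lower bound of the bump.\<close>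
  define C0 where "C0 = 16 * n ^ (DIM('a) * k) / (c' * \<delta> ^ k * V)"
  \<comment> \<open>The ball of radius \<open>\<kappa> * l\<close> about \<open>c\<close> must
    contain the companion ball: centres at distance at most \<open>\<kappa>0 * \<rho>\<close>, plus
    the radius \<rho>.\<close>
  define \<kappa> where "\<kappa> = (\<kappa>0 + 1) * n"
  show ?thesis
  proof (rule that[of C0 \<kappa>])
    show "0 < C0" using c' \<delta> V n by (simp add: C0_def)
    show "real DIM('a) \<le> \<kappa>" using \<kappa>0 n mult_right_mono[of 1 "\<kappa>0 + 1" n] by (simp add: \<kappa>_def n_def)
    fix c :: 'a and l :: real and Q :: "'a set"
    assume l: "0 < l" and Q: "Q \<in> sets lebesgue" "Q \<subseteq> cube c l"
    define \<rho> where "\<rho> = n * l"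
    have \<rho>: "0 < \<rho>" using l n by (simp add: \<rho>_def)
    define S where "S = cube c (2 * l)"
    have S: "compact S" "S \<subseteq> cball c \<rho>"
      using cube_subset_cball[of c l] by (auto simp: S_def compact_cube \<rho>_def n_def)
    obtain x0 K0 where x0: "4 * \<rho> \<le> dist x0 c" "dist x0 c \<le> \<kappa>0 * \<rho>" and K0: "c' / \<rho> ^ (m * DIM('a)) \<le> norm K0"
      and KK: "\<And>x y. x \<in> cball x0 \<rho> \<Longrightarrow> (\<And>i. i < m \<Longrightarrow> y i \<in> cball c \<rho>) \<Longrightarrow> norm (K x y - K0) \<le> norm K0 / 2"
      using balls[OF \<rho>, of c] by blast
    have "0 < c' / \<rho> ^ (m * DIM('a))" using c' \<rho> by simp
    with K0 have K0p: "0 < norm K0" by linarith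
    define B where "B = cball x0 \<rho>"
    have B: "compact B" "B \<inter> S = {}"
    proof -
      have False if "x \<in> cball x0 \<rho>" "x \<in> cball c \<rho>" for x
        using that dist_triangle[of x0 c x] x0(1) \<rho> unfolding mem_cball dist_commute[of c] by linarith
      then show "B \<inter> S = {}" using S(2) unfolding B_def by blast
    qed (simp add: B_def)
    have bm: "b \<in> borel_measurable lebesgue" using b by (simp add: in_Lp_loc_def)
    have Bf: "B \<in> fmeasurable lebesgue" by (rule lmeasurable_compact[OF B(1)])
    \<comment> \<open>The median is taken on the companion ball rather than on the cube, so that for
      either sign the set \<open>E\<close> chosen later fills at least half of
      \<open>B\<close>.\<close>
    obtain \<alpha> where \<alpha>: "measure lebesgue B \<le> 2 * measure lebesgue {x\<in>B. b x \<le> \<alpha>}"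
        "measure lebesgue B \<le> 2 * measure lebesgue {x\<in>B. \<alpha> \<le> b x}"
      by (rule median_exists[OF bm Bf])
    define tot where "tot = (\<integral>x. indicator Q x * \<bar>b x - \<alpha>\<bar> \<partial>lebesgue)"
    define J where "J s = (\<integral>y. indicator {y\<in>Q. s * \<alpha> \<le> s * b y} y * (s * (b y - \<alpha>)) \<partial>lebesgue)" for s :: real
    have sets: "{x\<in>A. s * b x \<le> s * \<alpha>} \<in> sets lebesgue" "{x\<in>A. s * \<alpha> \<le> s * b x} \<in> sets lebesgue"
      if "A \<in> sets lebesgue" for A and s :: real
    proof -
      have [measurable]: "A \<in> sets lebesgue" "b \<in> borel_measurable lebesgue" by fact+
      have "{x\<in>space lebesgue. x \<in> A \<and> s * b x \<le> s * \<alpha>} \<in> sets lebesgue" by measurable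
      then show "{x\<in>A. s * b x \<le> s * \<alpha>} \<in> sets lebesgue" by simp
      have "{x\<in>space lebesgue. x \<in> A \<and> s * \<alpha> \<le> s * b x} \<in> sets lebesgue" by measurable
      then show "{x\<in>A. s * \<alpha> \<le> s * b x} \<in> sets lebesgue" by simp
    qed
    have cl: "cube c l \<subseteq> S" unfolding S_def using l by (intro cube_mono) auto
    have bS: "integrable lebesgue (\<lambda>y. indicator S y * b y)" by (rule in_Lp_loc_1_integrable[OF b S(1)])
    have iS: "integrable lebesgue (indicator S :: 'a \<Rightarrow> real)"
      by (rule integrable_indicator_compact[OF S(1)])
    have intJ: "integrable lebesgue (\<lambda>y. indicator {y\<in>Q. s * \<alpha> \<le> s * b y} y * (s * (b y - \<alpha>)))"
      if "s = 1 \<or> s = -1" for s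
    proof (rule Bochner_Integration.integrable_bound)
      show "integrable lebesgue (\<lambda>y. norm (indicator S y * b y) + \<bar>\<alpha>\<bar> * indicator S y)"
        using bS iS by auto
      show "(\<lambda>y. indicator {y\<in>Q. s * \<alpha> \<le> s * b y} y * (s * (b y - \<alpha>))) \<in> borel_measurable lebesgue"
        using bm sets(2)[OF Q(1), of s] by simp
      show "AE y in lebesgue. norm (indicator {y\<in>Q. s * \<alpha> \<le> s * b y} y * (s * (b y - \<alpha>)))
          \<le> norm (norm (indicator S y * b y) + \<bar>\<alpha>\<bar> * indicator S y)"
        using that Q(2) cl by (intro AE_I2) (auto simp: indicator_def abs_mult)
    qed
    \<comment> \<open>Positive and negative parts of b - \<alpha> on \<open>Q\<close>; one of them
      has at least half of the total, and it fixes the sign \<open>s\<close>.\<close>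
    have pw: "indicator Q x * \<bar>b x - \<alpha>\<bar> = indicator {y\<in>Q. 1 * \<alpha> \<le> 1 * b y} x * (1 * (b x - \<alpha>))
        + indicator {y\<in>Q. - 1 * \<alpha> \<le> - 1 * b y} x * (- 1 * (b x - \<alpha>))" for x
      by (auto simp: indicator_def)
    have "tot = J 1 + J (-1)"
      unfolding tot_def J_def pw
      by (rule Bochner_Integration.integral_add[OF intJ intJ]) simp_all
    then have "tot \<le> 2 * J 1 \<or> tot \<le> 2 * J (-1)" by linarith
    then obtain s where s: "s = 1 \<or> s = -1" "tot \<le> 2 * J s" by blast
    show "\<exists>\<alpha> g \<phi>. g \<in> borel_measurable lebesgue \<and> (\<forall>x. norm (g x) \<le> indicator (cball c (\<kappa> * l)) x) \<and>
        \<phi> \<in> smooth_alg \<and> (\<forall>x. \<bar>\<phi> x\<bar> \<le> 2) \<and> (\<forall>x. x \<notin> cube c (2 * l) \<longrightarrow> \<phi> x = 0) \<and>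
        (\<integral>x. indicator Q x * \<bar>b x - \<alpha>\<bar> \<partial>lebesgue)
          \<le> C0 * Re (\<integral>x. g x * commutator1 b T (test_fun m \<phi> (bump c l)) x \<partial>lebesgue)"
    proof (cases "J s \<le> 0")
      \<comment> \<open>Without a positive \<open>J s\<close> no positive tolerance \<open>e\<close>
        could be chosen; here zero functions suffice.\<close>
      case True
      then have "tot \<le> 0" using s by simp
      then show ?thesis
        by (intro exI[of _ \<alpha>] exI[of _ "\<lambda>_. 0"]) (auto simp: tot_def smooth_alg.const)
    next
      case False
      then have J: "0 < J s" by simp
      define E where "E = {x\<in>B. s * b x \<le> s * \<alpha>}"
      define F where "F = {y\<in>Q. s * \<alpha> \<le> s * b y}"
      have Bs: "B \<in> sets lebesgue" using Bf by auto
      have E: "E \<in> sets lebesgue" "E \<subseteq> B" unfolding E_def using sets(1)[OF Bs] by auto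
      have F: "F \<in> sets lebesgue" "F \<subseteq> cube c l" unfolding F_def using sets(2)[OF Q(1)] Q(2) by auto
      have mB: "measure lebesgue B = V * \<rho> ^ DIM('a)"
        using \<rho> content_cball[of \<rho> x0] by (simp add: B_def V_def n_def)
      have mE: "V * \<rho> ^ DIM('a) / 2 \<le> measure lebesgue E"
        using \<alpha> s(1) unfolding E_def mB[symmetric] by auto
      moreover have "0 < V * \<rho> ^ DIM('a) / 2" using V \<rho> by simp
      ultimately have mEp: "0 < measure lebesgue E" by linarith
      define W where "W = (\<integral>y. indicator B y * \<bar>b y\<bar> \<partial>lebesgue)"
      have W: "0 \<le> W" unfolding W_def by (intro Bochner_Integration.integral_nonneg) auto
      \<comment> \<open>This tolerance bounds the error term by exactly half of the main term
        \<open>measure lebesgue E * J s\<close>, see \<open>a3\<close>.\<close>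
      define e where "e = measure lebesgue E * J s / (6 * (measure lebesgue E + W))"
      have e: "0 < e" using mEp J W by (simp add: e_def add_pos_nonneg)
      have w: "integrable lebesgue (\<lambda>y. indicator S y * (1 + \<bar>b y\<bar>))"
        using Bochner_Integration.integrable_add[OF iS integrable_abs[OF bS]] by (simp add: abs_mult algebra_simps)
      obtain \<phi> where \<phi>: "\<phi> \<in> smooth_alg" "\<And>x. \<bar>\<phi> x\<bar> \<le> 2" "\<And>x. x \<notin> cube c (2 * l) \<Longrightarrow> \<phi> x = 0"
        and D: "(\<integral>x. \<bar>\<phi> x - indicator F x\<bar> * (indicator S x * (1 + \<bar>b x\<bar>)) \<partial>lebesgue) < e"
        using smooth_approx_indicator[OF l F e w] by auto
      have c\<phi>: "Cc_inf (\<lambda>y. complex_of_real (\<phi> y))"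
        by (rule Cc_inf_smooth_alg[OF \<phi>(1) compact_cube \<phi>(3)])
      have c\<psi>: "Cc_inf (\<lambda>y. complex_of_real (bump c l y))"
        by (rule Cc_inf_smooth_alg[OF smooth_alg_bump compact_cube bump_eq_0[OF l]])
      have Cf: "Cc_inf (test_fun m \<phi> (bump c l) i)" for i
        by (rule Cc_inf_test_fun[OF c\<phi> c\<psi>])
      define I where "I = (\<integral>y. bump c l y \<partial>lebesgue)"
      have I: "\<delta> * l ^ DIM('a) \<le> I"
      proof -
        have "integrable lebesgue (\<lambda>y. Re (complex_of_real (bump c l y)))"
          by (intro integrable_Re integrable_Cc_inf c\<psi>)
        then have i1: "integrable lebesgue (bump c l)" by simp
        have "(\<integral>y. \<delta> * indicator (cube c l) y \<partial>lebesgue) \<le> I"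
          unfolding I_def
        proof (intro integral_mono i1 integrable_mult_right)
          show "integrable lebesgue (indicator (cube c l) :: 'a \<Rightarrow> real)"
            by (rule integrable_indicator_compact[OF compact_cube])
          show "\<delta> * indicator (cube c l) y \<le> bump c l y" for y
            using bump_ge[OF l, of y c] bump_bounds(1)[of c l y] by (auto simp: indicator_def \<delta>_def)
        qed
        then show ?thesis using measure_cube[of l c] l lmeasurable_compact[OF compact_cube, of c l] by simp
      qed
      define g where "g x = - (of_real s * (cnj K0 / of_real (norm K0))) * indicator E x" for x
      let ?R = "Re (\<integral>x. g x * commutator1 b T (test_fun m \<phi> (bump c l)) x \<partial>lebesgue)"
      have g: "norm (g x) \<le> indicator (cball c (\<kappa> * l)) x" for x
      proof (cases "x \<in> E")
        case True
        have "dist c x \<le> dist x0 c + dist x0 x" using dist_triangle[of c x x0] by (simp add: dist_commute)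
        also have "\<dots> \<le> \<kappa>0 * \<rho> + \<rho>" using True E(2) x0(2) by (intro add_mono) (auto simp: B_def)
        also have "\<dots> = \<kappa> * l" by (simp add: \<kappa>_def \<rho>_def algebra_simps)
        finally show ?thesis using K0p s by (auto simp: g_def norm_mult norm_divide indicator_def)
      qed (simp add: g_def)
      have KE: "norm (K x y - K0) \<le> norm K0 / 2" if "x \<in> E" "\<And>i. i < m \<Longrightarrow> y i \<in> S" for x y
      proof (rule KK)
        show "x \<in> cball x0 \<rho>" using that(1) E(2) by (auto simp: B_def)
        show "y i \<in> cball c \<rho>" if "i < m" for i
          using subsetD[OF S(2) \<open>\<And>i. i < m \<Longrightarrow> y i \<in> S\<close>[OF that]] .
      qed
      have "norm K0 / 2 * I ^ (m - 1) * (measure lebesgue E * J s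
          - 3 * (measure lebesgue E + W) * (\<integral>x. \<bar>\<phi> x - indicator F x\<bar> * (indicator S x * (1 + \<bar>b x\<bar>)) \<partial>lebesgue)) \<le> ?R"
        unfolding I_def J_def W_def g_def F_def[symmetric]
      proof (rule commutator_pairing_lower_bound[where q = q])
        show "s = 1 \<or> s = -1" by (rule s(1))
        show "K0 \<noteq> 0" using K0p by auto
        show "norm (K x y - K0) \<le> norm K0 / 2" if "x \<in> E" "\<And>i. i < m \<Longrightarrow> y i \<in> S" for x y
          by (rule KE) (rule that)+
        show "y \<notin> S \<Longrightarrow> \<phi> y = 0" "y \<notin> S \<Longrightarrow> bump c l y = 0" for y
          using \<phi>(3) bump_eq_0[OF l] by (auto simp: S_def)
        show "F \<subseteq> S" using F(2) cl by auto
        show "s * \<alpha> \<le> s * b y" if "y \<in> F" for y using that by (simp add: F_def)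
        show "s * b x \<le> s * \<alpha>" if "x \<in> E" for x using that by (simp add: E_def)
        show "in_Lp q (commutator1 b T (test_fun m \<phi> (bump c l)))" by (rule Uq) (rule Cf)
      qed (rule S E B c\<phi> c\<psi> F(1) q bump_bounds)+
      note a1 = this
      have a2: "3 * (measure lebesgue E + W) * (\<integral>x. \<bar>\<phi> x - indicator F x\<bar> * (indicator S x * (1 + \<bar>b x\<bar>)) \<partial>lebesgue)
          \<le> 3 * (measure lebesgue E + W) * e"
        using D mEp W by (intro mult_left_mono) auto
      have a3: "3 * (measure lebesgue E + W) * e = measure lebesgue E * J s / 2"
        using mEp W by (simp add: e_def field_simps)
      have I0: "0 \<le> I" by (rule order_trans[OF _ I]) (use \<delta> l in auto)
      have "norm K0 / 2 * I ^ k * (measure lebesgue E * J s / 2) \<le> norm K0 / 2 * I ^ (m - 1) * (measure lebesgue E * J s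
          - 3 * (measure lebesgue E + W) * (\<integral>x. \<bar>\<phi> x - indicator F x\<bar> * (indicator S x * (1 + \<bar>b x\<bar>)) \<partial>lebesgue))"
        unfolding k diff_Suc_1
      proof (rule mult_left_mono)
        show "0 \<le> norm K0 / 2 * I ^ k" using I0 by simp
      qed (use a2 a3 in linarith)
      with a1 have R: "norm K0 / 2 * I ^ k * (measure lebesgue E * J s / 2) \<le> ?R" by linarith
      have p1: "c' / \<rho> ^ (m * DIM('a)) / 2 \<le> norm K0 / 2" using K0 by simp
      have p2: "(\<delta> * l ^ DIM('a)) ^ k \<le> I ^ k" using I \<delta> l by (intro power_mono) auto
      have p3: "V * \<rho> ^ DIM('a) / 2 * J s / 2 \<le> measure lebesgue E * J s / 2"
        using mE J by (intro divide_right_mono mult_right_mono) auto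
      have "c' / \<rho> ^ (m * DIM('a)) / 2 * (\<delta> * l ^ DIM('a)) ^ k * (V * \<rho> ^ DIM('a) / 2 * J s / 2)
          \<le> norm K0 / 2 * I ^ k * (measure lebesgue E * J s / 2)"
        by (rule mult_mono[OF mult_mono[OF p1 p2] p3]) (use I0 \<delta> l V \<rho> J in auto)
      then have R': "c' / \<rho> ^ (m * DIM('a)) / 2 * (\<delta> * l ^ DIM('a)) ^ k * (V * \<rho> ^ DIM('a) / 2 * J s / 2) \<le> ?R"
        using R by linarith
      have r1: "\<rho> ^ (m * DIM('a)) = \<rho> ^ DIM('a) * (n ^ (DIM('a) * k) * l ^ (DIM('a) * k))"
        unfolding k mult_Suc power_add \<rho>_def by (simp only: power_mult_distrib mult.commute[of k])
      have r2: "(\<delta> * l ^ DIM('a)) ^ k = \<delta> ^ k * l ^ (DIM('a) * k)"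
        by (simp add: power_mult_distrib power_mult)
      have gen: "c' / (A1 * (A2 * A3)) / 2 * (A4 * A3) * (V * A1 / 2 * J s / 2) = 2 * J s / (16 * A2 / (c' * A4 * V))"
        if "A1 \<noteq> 0" "A2 \<noteq> 0" "A3 \<noteq> 0" "A4 \<noteq> 0" for A1 A2 A3 A4
        using that c' V by (simp add: field_simps)
      have "c' / \<rho> ^ (m * DIM('a)) / 2 * (\<delta> * l ^ DIM('a)) ^ k * (V * \<rho> ^ DIM('a) / 2 * J s / 2) = 2 * J s / C0"
        unfolding r1 r2 C0_def by (rule gen) (use \<rho> n l \<delta> in auto)
      moreover have "0 < C0" using c' \<delta> V n by (simp add: C0_def)
      ultimately have "2 * J s / C0 \<le> ?R" "0 < C0" using R' by simp_all
      then have "2 * J s \<le> C0 * ?R" by (simp add: pos_divide_le_eq mult.commute)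
      then have fin: "tot \<le> C0 * ?R" using s(2) by linarith
      have gm: "g \<in> borel_measurable lebesgue" unfolding g_def using E(1) by simp
      show ?thesis
        using fin gm g \<phi> unfolding tot_def by blast
    qed
  qed
qed

end

section \<open>Diagonal extraction\<close>

text \<open>Inserting \<open>x\<close> adds the diagonal entry \<open>M x x\<close> and the sign of
  \<open>x\<close> times the combined cross terms; that sign is chosen to make the latter
  contribution nonnegative.\<close>

lemma exists_signs_diagonal_le:
  fixes M :: "'j \<Rightarrow> 'j \<Rightarrow> real"
  assumes "finite J"
  shows "\<exists>\<epsilon>. (\<forall>j. \<epsilon> j = 1 \<or> \<epsilon> j = -1) \<and> (\<Sum>i\<in>J. M i i) \<le> (\<Sum>i\<in>J. \<Sum>j\<in>J. \<epsilon> i * \<epsilon> j * M i j)"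
  using assms
proof (induction J)
  case empty
  show ?case by (intro exI[of _ "\<lambda>_. 1"]) auto
next
  case (insert x J)
  then obtain \<epsilon> where \<epsilon>: "\<And>j. \<epsilon> j = 1 \<or> \<epsilon> j = -1"
    "(\<Sum>i\<in>J. M i i) \<le> (\<Sum>i\<in>J. \<Sum>j\<in>J. \<epsilon> i * \<epsilon> j * M i j)" by blast
  define c where "c = (\<Sum>j\<in>J. \<epsilon> j * (M x j + M j x))"
  define s :: real where "s = (if 0 \<le> c then 1 else -1)"
  have s: "s = 1 \<or> s = -1" "0 \<le> s * c" "s * s = 1" by (auto simp: s_def)
  define \<epsilon>' where "\<epsilon>' = \<epsilon>(x := s)"
  have J: "\<epsilon>' j = \<epsilon> j" if "j \<in> J" for j using that insert.hyps by (auto simp: \<epsilon>'_def)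
  have x: "\<epsilon>' x = s" by (simp add: \<epsilon>'_def)
  have "(\<Sum>i\<in>insert x J. \<Sum>j\<in>insert x J. \<epsilon>' i * \<epsilon>' j * M i j)
      = M x x + (\<Sum>j\<in>J. s * \<epsilon> j * M x j) + (\<Sum>i\<in>J. \<epsilon> i * s * M i x + (\<Sum>j\<in>J. \<epsilon> i * \<epsilon> j * M i j))"
    using insert.hyps s(3) by (simp add: x J cong: sum.cong)
  also have "\<dots> = M x x + s * c + (\<Sum>i\<in>J. \<Sum>j\<in>J. \<epsilon> i * \<epsilon> j * M i j)"
    by (simp add: c_def sum.distrib sum_distrib_left algebra_simps)
  finally have "(\<Sum>i\<in>insert x J. M i i) \<le> (\<Sum>i\<in>insert x J. \<Sum>j\<in>insert x J. \<epsilon>' i * \<epsilon>' j * M i j)"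
    using insert.hyps \<epsilon>(2) s(2) by simp
  moreover have "\<forall>j. \<epsilon>' j = 1 \<or> \<epsilon>' j = -1" using \<epsilon>(1) s(1) by (auto simp: \<epsilon>'_def)
  ultimately show ?case by blast
qed

text \<open>Provides the listing by decreasing size for which the one-sided Carleson sums over j
  \<ge> i are meant.\<close>

lemma enumerate_antimono:
  fixes l :: "'j \<Rightarrow> real"
  assumes "finite J"
  obtains f where "bij_betw f {..<card J} J" "\<And>i j. i \<le> j \<Longrightarrow> j < card J \<Longrightarrow> l (f j) \<le> l (f i)"
proof -
  obtain ys where ys: "set ys = J" "distinct ys" using finite_distinct_list[OF assms] by blast
  define xs where "xs = sort_key (\<lambda>x. - l x) ys"
  have xs: "set xs = J" "distinct xs" "length xs = card J"
    using ys distinct_card[of ys] by (auto simp: xs_def)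
  have "sorted (map (\<lambda>x. - l x) xs)" unfolding xs_def by simp
  from sorted_nth_mono[OF this] have "l (xs ! j) \<le> l (xs ! i)" if "i \<le> j" "j < card J" for i j
    using that xs(3) by fastforce
  moreover have "bij_betw ((!) xs) {..<card J} J"
    by (rule bij_betw_nth[OF xs(2)]) (simp_all add: xs)
  ultimately show ?thesis using that[of "(!) xs"] by presburger
qed

section \<open>Hoelder's inequality\<close>

lemma Young_inequality:
  fixes a b p q :: real
  assumes ab: "0 \<le> a" "0 \<le> b" and pq: "1 < p" "1 < q" "1 / p + 1 / q = 1"
  shows "a * b \<le> a powr p / p + b powr q / q"
proof (cases "a = 0 \<or> b = 0")
  case True
  then show ?thesis using pq by (auto intro: divide_nonneg_pos)
next
  case False
  then have pos: "0 < a" "0 < b" using ab by auto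
  have "exp ((1 - 1/q) *\<^sub>R (p * ln a) + (1/q) *\<^sub>R (q * ln b)) \<le> (1 - 1/q) * exp (p * ln a) + (1/q) * exp (q * ln b)"
    using pq by (intro convex_onD[OF exp_convex]) (auto simp: field_simps)
  moreover have "1 - 1/q = 1/p" using pq(3) by linarith
  ultimately show ?thesis
    using pos pq by (simp add: powr_def exp_add field_simps)
qed

text \<open>After normalisation this is Young's inequality integrated. If one of the norms vanishes
  no normalisation is possible, but then the product is zero almost everywhere.\<close>

lemma Holder_inequality_integral:
  fixes f g :: "'b \<Rightarrow> complex"
  assumes pq: "1 < p" "1 < q" "1 / p + 1 / q = 1"
    and fg: "integrable M (\<lambda>x. f x * g x)"
    and f: "integrable M (\<lambda>x. norm (f x) powr p)" and g: "integrable M (\<lambda>x. norm (g x) powr q)"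
  shows "norm (\<integral>x. f x * g x \<partial>M) \<le> (\<integral>x. norm (f x) powr p \<partial>M) powr (1 / p) * (\<integral>x. norm (g x) powr q \<partial>M) powr (1 / q)"
proof -
  define A where "A = (\<integral>x. norm (f x) powr p \<partial>M)"
  define B where "B = (\<integral>x. norm (g x) powr q \<partial>M)"
  have A0: "0 \<le> A" and B0: "0 \<le> B" by (simp_all add: A_def B_def)
  have le: "norm (\<integral>x. f x * g x \<partial>M) \<le> (\<integral>x. norm (f x) * norm (g x) \<partial>M)"
    using integral_norm_bound[of M "\<lambda>x. f x * g x"] by (simp add: norm_mult)
  have int: "integrable M (\<lambda>x. norm (f x) * norm (g x))"
    using integrable_norm[OF fg] by (simp add: norm_mult)
  have zero: "norm (\<integral>x. f x * g x \<partial>M) \<le> 0" if "A = 0 \<or> B = 0"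
  proof -
    have "AE x in M. f x * g x = 0"
    proof (cases "A = 0")
      case True
      then have "AE x in M. norm (f x) powr p = 0"
        using integral_nonneg_eq_0_iff_AE[OF f] by (simp add: A_def)
      then show ?thesis by eventually_elim auto
    next
      case False
      then have "AE x in M. norm (g x) powr q = 0"
        using that integral_nonneg_eq_0_iff_AE[OF g] by (simp add: B_def)
      then show ?thesis by eventually_elim auto
    qed
    then have "(\<integral>x. f x * g x \<partial>M) = 0" by (rule integral_eq_zero_AE)
    then show ?thesis by simp
  qed
  show ?thesis
  proof (cases "A = 0 \<or> B = 0")
    case True
    then show ?thesis using zero order_trans[OF zero[OF True]] by simp
  next
    case False
    then have pos: "0 < A" "0 < B" using A0 B0 by auto
    define a where "a = A powr (1 / p)"
    define b where "b = B powr (1 / q)"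
    have ab: "0 < a" "0 < b" "a powr p = A" "b powr q = B"
      using pos pq by (auto simp: a_def b_def powr_powr)
    have pw: "norm (f x) * norm (g x) \<le> a * b * (norm (f x) powr p / (p * A) + norm (g x) powr q / (q * B))" for x
    proof -
      have "norm (f x) / a * (norm (g x) / b) \<le> (norm (f x) / a) powr p / p + (norm (g x) / b) powr q / q"
        using ab by (intro Young_inequality pq) auto
      also have "\<dots> = norm (f x) powr p / (p * A) + norm (g x) powr q / (q * B)"
        using ab by (simp add: powr_divide mult.commute)
      finally show ?thesis using ab by (simp add: field_simps)
    qed
    have int2: "integrable M (\<lambda>x. a * b * (norm (f x) powr p / (p * A) + norm (g x) powr q / (q * B)))"
      by (intro integrable_mult_right Bochner_Integration.integrable_add integrable_divide f g)
    have "(\<integral>x. norm (f x) * norm (g x) \<partial>M) \<le> (\<integral>x. a * b * (norm (f x) powr p / (p * A) + norm (g x) powr q / (q * B)) \<partial>M)"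
      by (rule integral_mono[OF int int2 pw])
    also have "\<dots> = a * b * (A / (p * A) + B / (q * B))"
      unfolding integral_mult_right_zero A_def B_def
      by (simp only: Bochner_Integration.integral_add[OF integrable_divide[OF f] integrable_divide[OF g]]
          integral_divide_zero)
    also have "A / (p * A) = 1 / p" using pos by simp
    also have "B / (q * B) = 1 / q" using pos by simp
    finally have "(\<integral>x. norm (f x) * norm (g x) \<partial>M) \<le> a * b" by (simp only: pq(3) mult_1_right)
    then show ?thesis using le unfolding a_def b_def A_def B_def by (rule order_trans[rotated])
  qed
qed

section \<open>Separating the diagonal of a multilinear form\<close>

lemma multilinear_op_sum:
  assumes T: "multilinear_op m T" and i: "i < m" and J: "finite J"
  shows "T (f(i := (\<lambda>x. \<Sum>j\<in>J. c j * g j x))) = (\<lambda>x. \<Sum>j\<in>J. c j * T (f(i := g j)) x)"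
  using J
proof (induction J)
  note add = T[unfolded multilinear_op_def, rule_format, OF i, THEN conjunct1]
  note scale = T[unfolded multilinear_op_def, rule_format, OF i, THEN conjunct2]
  {
    case empty
    show ?case using scale[of f 0 "\<lambda>x. 0"] by (simp only: mult_zero_left sum.empty)
  next
    case (insert j J)
    show ?case
      unfolding sum.insert[OF insert.hyps] add scale insert.IH by (rule refl)
  }
qed

text \<open>For i = 0 the multiplication by \<open>b\<close> happens inside the summed argument; for
  other \<open>i\<close> it acts on a different entry, and the two updates commute.\<close>

lemma commutator1_sum:
  assumes T: "multilinear_op m T" and i: "i < m" and J: "finite J"
  shows "commutator1 b T (f(i := (\<lambda>x. \<Sum>j\<in>J. c j * g j x))) x = (\<Sum>j\<in>J. c j * commutator1 b T (f(i := g j)) x)"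
proof (cases "i = 0")
  case True
  have "(\<lambda>y. complex_of_real (b y) * (\<Sum>j\<in>J. c j * g j y)) = (\<lambda>y. \<Sum>j\<in>J. c j * (complex_of_real (b y) * g j y))"
    by (simp add: sum_distrib_left mult_ac)
  then show ?thesis
    using multilinear_op_sum[OF assms, of f c g] multilinear_op_sum[OF assms, of f c "\<lambda>j y. complex_of_real (b y) * g j y"] True
    by (simp add: commutator1_def sum_distrib_left right_diff_distrib sum_subtractf mult_ac)
next
  case False
  then show ?thesis
    using multilinear_op_sum[OF assms, of f c g] multilinear_op_sum[OF assms, of "f(0 := (\<lambda>y. complex_of_real (b y) * f 0 y))" c g]
    by (simp add: commutator1_def fun_upd_twist[of i 0] sum_distrib_left right_diff_distrib sum_subtractf mult_ac)
qed

text \<open>Signs are chosen for one argument after the other, which replaces an average over independent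
  random signs in each argument.\<close>

lemma multilinear_diagonal_le:
  fixes P :: "'j \<Rightarrow> (nat \<Rightarrow> 'a \<Rightarrow> complex) \<Rightarrow> real" and w :: "nat \<Rightarrow> 'j \<Rightarrow> real"
    and f :: "'j \<Rightarrow> nat \<Rightarrow> 'a \<Rightarrow> complex"
  assumes J: "finite J" and f: "\<And>R i. R \<in> J \<Longrightarrow> i < m \<Longrightarrow> f R i \<in> X"
    and tail: "\<And>R i. R \<in> J \<Longrightarrow> m \<le> i \<Longrightarrow> f R i = (\<lambda>x. 0)"
    and X: "\<And>k c. k < m \<Longrightarrow> (\<lambda>x. \<Sum>S\<in>J. complex_of_real (c S) * f S k x) \<in> X"
    and lin: "\<And>R k h c. \<lbrakk>R \<in> J; k < m; \<And>i. i < m \<Longrightarrow> h i \<in> X\<rbrakk> \<Longrightarrow>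
       P R (h(k := (\<lambda>x. \<Sum>S\<in>J. complex_of_real (c S) * f S k x))) = (\<Sum>S\<in>J. c S * P R (h(k := f S k)))"
  obtains \<eta> :: "'j \<Rightarrow> real" and \<epsilon> :: "nat \<Rightarrow> 'j \<Rightarrow> real" where
    "\<And>R. \<eta> R = 1 \<or> \<eta> R = -1" "\<And>i R. \<epsilon> i R = 1 \<or> \<epsilon> i R = -1"
    "(\<Sum>R\<in>J. (\<Prod>i<m. w i R) * P R (f R)) \<le> (\<Sum>R\<in>J. \<eta> R * P R (\<lambda>i x. if i < m then
        \<Sum>S\<in>J. complex_of_real (\<epsilon> i S * w i S) * f S i x else 0))"
proof -
  define \<Phi> where "\<Phi> \<epsilon> i x = (if i < m then \<Sum>S\<in>J. complex_of_real (\<epsilon> i S * w i S) * f S i x else 0)"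
    for \<epsilon> :: "nat \<Rightarrow> 'j \<Rightarrow> real" and i x
  \<comment> \<open>At stage \<open>k\<close> the entries below \<open>k\<close> are still those of
    \<open>R\<close> itself, while the others have become full signed sums. The induction runs from
    \<open>m\<close> down to 0, and \<eta> collects the product of the signs attached to
    \<open>R\<close> so far.\<close>
  have "\<exists>\<eta> \<epsilon>. (\<forall>R. \<eta> R = 1 \<or> \<eta> R = (-1::real)) \<and> (\<forall>i R. \<epsilon> i R = 1 \<or> \<epsilon> i R = (-1::real)) \<and>
     (\<Sum>R\<in>J. (\<Prod>i<m. w i R) * P R (f R))
       \<le> (\<Sum>R\<in>J. (\<Prod>i<k. w i R) * (\<eta> R * P R (\<lambda>i. if i < k then f R i else \<Phi> \<epsilon> i)))" if "k \<le> m" for k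
    using that
  proof (induction rule: inc_induct)
    case base
    have "(\<lambda>i. if i < m then f R i else \<Phi> (\<lambda>_ _. 1) i) = f R" if "R \<in> J" for R
      using tail[OF that] by (auto simp: \<Phi>_def fun_eq_iff)
    then show ?case
      by (intro exI[of _ "\<lambda>_. 1"] exI[of _ "\<lambda>_ _. 1"]) (simp cong: sum.cong)
  next
    case (step k)
    then obtain \<eta> \<epsilon> where \<eta>: "\<And>R. \<eta> R = 1 \<or> \<eta> R = (-1::real)" and \<epsilon>: "\<And>i R. \<epsilon> i R = 1 \<or> \<epsilon> i R = (-1::real)"
      and le: "(\<Sum>R\<in>J. (\<Prod>i<m. w i R) * P R (f R))
       \<le> (\<Sum>R\<in>J. (\<Prod>i<Suc k. w i R) * (\<eta> R * P R (\<lambda>i. if i < Suc k then f R i else \<Phi> \<epsilon> i)))" by blast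
    define h where "h R i = (if i < Suc k then f R i else \<Phi> \<epsilon> i)" for R i
    have hX: "h R i \<in> X" if "R \<in> J" "i < m" for R i
      using that f X[of i "\<lambda>S. \<epsilon> i S * w i S"] by (auto simp: h_def \<Phi>_def[abs_def])
    \<comment> \<open>\<open>M R S\<close> takes entry \<open>k\<close> from \<open>S\<close> and
      leaves the other entries of \<open>h R\<close>. Its diagonal is the expression already
      reached, and linearity in entry \<open>k\<close> turns the signed double sum into the next
      stage.\<close>
    define M where "M R S = (\<Prod>i<k. w i R) * w k S * \<eta> R * P R ((h R)(k := f S k))" for R S
    obtain \<delta> where \<delta>: "\<And>j. \<delta> j = 1 \<or> \<delta> j = (-1::real)" "(\<Sum>i\<in>J. M i i) \<le> (\<Sum>i\<in>J. \<Sum>j\<in>J. \<delta> i * \<delta> j * M i j)"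
      using exists_signs_diagonal_le[OF J, of M] by blast
    define \<eta>' where "\<eta>' R = \<delta> R * \<eta> R" for R
    define \<epsilon>' where "\<epsilon>' = \<epsilon>(k := \<delta>)"
    have upd: "(h R)(k := f R k) = h R" for R by (auto simp: h_def fun_eq_iff)
    have upd': "(h R)(k := (\<lambda>x. \<Sum>S\<in>J. complex_of_real (\<delta> S * w k S) * f S k x))
        = (\<lambda>i. if i < k then f R i else \<Phi> \<epsilon>' i)" for R
      using step.hyps by (auto simp: h_def \<Phi>_def \<epsilon>'_def fun_eq_iff)
    have "(\<Sum>S\<in>J. \<delta> R * \<delta> S * M R S) = (\<Prod>i<k. w i R) * (\<eta>' R * P R (\<lambda>i. if i < k then f R i else \<Phi> \<epsilon>' i))"
      if R: "R \<in> J" for R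
    proof -
      have "P R ((h R)(k := (\<lambda>x. \<Sum>S\<in>J. complex_of_real (\<delta> S * w k S) * f S k x)))
          = (\<Sum>S\<in>J. (\<delta> S * w k S) * P R ((h R)(k := f S k)))"
        by (rule lin[OF R step.hyps(2)]) (rule hX[OF R])
      then show ?thesis
        unfolding upd' by (simp add: M_def \<eta>'_def sum_distrib_left mult_ac)
    qed
    then have "(\<Sum>i\<in>J. \<Sum>j\<in>J. \<delta> i * \<delta> j * M i j)
        = (\<Sum>R\<in>J. (\<Prod>i<k. w i R) * (\<eta>' R * P R (\<lambda>i. if i < k then f R i else \<Phi> \<epsilon>' i)))"
      by (rule sum.cong[OF refl])
    moreover have "(\<Sum>i\<in>J. M i i) = (\<Sum>R\<in>J. (\<Prod>i<Suc k. w i R) * (\<eta> R * P R (h R)))"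
      by (simp add: M_def upd mult_ac)
    ultimately have "(\<Sum>R\<in>J. (\<Prod>i<m. w i R) * P R (f R))
       \<le> (\<Sum>R\<in>J. (\<Prod>i<k. w i R) * (\<eta>' R * P R (\<lambda>i. if i < k then f R i else \<Phi> \<epsilon>' i)))"
      using le \<delta>(2) unfolding h_def[abs_def] by linarith
    moreover have "\<forall>R. \<eta>' R = 1 \<or> \<eta>' R = -1"
    proof
      fix R show "\<eta>' R = 1 \<or> \<eta>' R = -1" using \<eta>[of R] \<delta>(1)[of R] by (auto simp: \<eta>'_def)
    qed
    moreover have "\<forall>i R. \<epsilon>' i R = 1 \<or> \<epsilon>' i R = -1"
      using \<epsilon> \<delta>(1) by (simp add: \<epsilon>'_def)
    ultimately show ?case by blast
  qed
  from this[of 0] obtain \<eta> \<epsilon> where "\<And>R. \<eta> R = 1 \<or> \<eta> R = (-1::real)" "\<And>i R. \<epsilon> i R = 1 \<or> \<epsilon> i R = (-1::real)"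
     "(\<Sum>R\<in>J. (\<Prod>i<m. w i R) * P R (f R)) \<le> (\<Sum>R\<in>J. \<eta> R * P R (\<lambda>i. \<Phi> \<epsilon> i))" by auto
  then show ?thesis using that[of \<eta> \<epsilon>] unfolding \<Phi>_def[abs_def] by blast
qed

text \<open>Positivity of \<open>m\<close> matters at x = 0, where \<open>0 powr e\<close> is 0 for
  every exponent but an empty product is 1.\<close>

lemma powr_prod_eq:
  fixes x :: real and m :: nat
  assumes "0 \<le> x" "0 < m"
  shows "(\<Prod>i<m. x powr e i) = x powr (\<Sum>i<m. e i)"
proof (cases "x = 0")
  case True
  then have "(\<Prod>i<m. x powr e i) = (\<Prod>i<m. 0)" by simp
  then show ?thesis using True assms by simp
next
  case False
  then show ?thesis by (simp add: powr_sum)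
qed

lemma Lp_norm_eq:
  assumes "integrable lebesgue (\<lambda>x. norm (f x) powr e)" "f \<in> borel_measurable lebesgue"
  shows "Lp_norm e f = (\<integral>x. norm (f x) powr e \<partial>lebesgue) powr (1 / e)"
  unfolding Lp_norm_def using assms by (subst integral_eq_nn_integral) auto

text \<open>Amplitudes \<open>a i powr (1 / e)\<close> bound the e-th power of the norm by a
  multiple of the sum of \<open>a i\<close> times measures, in which \<open>e\<close> no longer
  appears. With a = t^r every exponent thus leads to the same energy. The factor 2 accommodates the
  sup bound of the test functions.\<close>

lemma sum_carleson_Lp:
  fixes \<Lambda> e :: real
  assumes "0 \<le> \<Lambda>" "1 < e"
  obtains C where "0 < C"
    "\<And>(n :: nat) A a X (H :: 'a::euclidean_space \<Rightarrow> complex).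
      \<lbrakk>\<And>i. i < n \<Longrightarrow> A i \<in> fmeasurable lebesgue; \<And>i. i < n \<Longrightarrow> 0 \<le> a i;
       \<And>i. i < n \<Longrightarrow> (\<Sum>j\<in>{j\<in>{i..<n}. A j \<inter> A i \<noteq> {}}. measure lebesgue (A j)) \<le> \<Lambda> * measure lebesgue (A i);
       H \<in> borel_measurable lebesgue; \<And>x. norm (H x) \<le> (\<Sum>i<n. 2 * a i powr (1 / e) * indicator (A i) x);
       (\<Sum>i<n. a i * measure lebesgue (A i)) \<le> X\<rbrakk>
     \<Longrightarrow> integrable lebesgue (\<lambda>x. norm (H x) powr e) \<and> Lp_norm e H \<le> C * X powr (1 / e)"
proof (rule carleson_embedding[OF assms, of "lebesgue :: 'a measure"])
  fix C :: real assume C: "0 < C" "\<And>(n :: nat) A a. \<lbrakk>\<And>i. i < n \<Longrightarrow> A i \<in> fmeasurable (lebesgue :: 'a measure); \<And>i. i < n \<Longrightarrow> 0 \<le> a i;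
       \<And>i. i < n \<Longrightarrow> (\<Sum>j\<in>{j\<in>{i..<n}. A j \<inter> A i \<noteq> {}}. measure lebesgue (A j)) \<le> \<Lambda> * measure lebesgue (A i)\<rbrakk>
     \<Longrightarrow> integrable lebesgue (\<lambda>x. (\<Sum>i<n. a i * indicator (A i) x) powr e) \<and>
        (\<integral>x. (\<Sum>i<n. a i * indicator (A i) x) powr e \<partial>lebesgue) \<le> C * (\<Sum>i<n. a i powr e * measure lebesgue (A i))"
  show thesis
  proof (rule that[of "(C * 2 powr e) powr (1 / e)"])
    show "0 < (C * 2 powr e) powr (1 / e)" using C(1) by simp
    fix n :: nat and A :: "nat \<Rightarrow> 'a set" and a X and H :: "'a \<Rightarrow> complex"
    assume A: "\<And>i. i < n \<Longrightarrow> A i \<in> fmeasurable lebesgue" and a: "\<And>i. i < n \<Longrightarrow> 0 \<le> a i"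
      and carl: "\<And>i. i < n \<Longrightarrow> (\<Sum>j\<in>{j\<in>{i..<n}. A j \<inter> A i \<noteq> {}}. measure lebesgue (A j)) \<le> \<Lambda> * measure lebesgue (A i)"
      and H: "H \<in> borel_measurable lebesgue" "\<And>x. norm (H x) \<le> (\<Sum>i<n. 2 * a i powr (1 / e) * indicator (A i) x)"
      and X: "(\<Sum>i<n. a i * measure lebesgue (A i)) \<le> X"
    define a' where "a' i = 2 * a i powr (1 / e)" for i
    let ?S = "\<lambda>x. (\<Sum>i<n. a' i * indicator (A i) x) powr e"
    have a': "0 \<le> a' i" "i < n \<Longrightarrow> a' i powr e = 2 powr e * a i" for i
      using a[of i] assms(2) by (auto simp: a'_def powr_mult powr_powr)
    have int: "integrable lebesgue ?S" and "(\<integral>x. ?S x \<partial>lebesgue) \<le> C * (\<Sum>i<n. a' i powr e * measure lebesgue (A i))"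
      using C(2)[OF A a'(1) carl] by auto
    then have le: "(\<integral>x. ?S x \<partial>lebesgue) \<le> (C * 2 powr e) * X"
    proof -
      have "(\<Sum>i<n. a' i powr e * measure lebesgue (A i)) = 2 powr e * (\<Sum>i<n. a i * measure lebesgue (A i))"
        by (simp add: a'(2) sum_distrib_left mult.assoc)
      also have "\<dots> \<le> 2 powr e * X" using X by (intro mult_left_mono) auto
      finally have "C * (\<Sum>i<n. a' i powr e * measure lebesgue (A i)) \<le> C * (2 powr e * X)"
        using C(1) by (intro mult_left_mono) auto
      with \<open>(\<integral>x. ?S x \<partial>lebesgue) \<le> C * (\<Sum>i<n. a' i powr e * measure lebesgue (A i))\<close>
      show ?thesis by (simp add: mult.assoc)
    qed
    have HS: "norm (H x) powr e \<le> ?S x" for x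
      using H(2)[of x] assms(2) by (intro powr_mono2) (auto simp: a'_def)
    have intH: "integrable lebesgue (\<lambda>x. norm (H x) powr e)"
    proof (rule Bochner_Integration.integrable_bound[OF int])
      show "(\<lambda>x. norm (H x) powr e) \<in> borel_measurable lebesgue" using H(1) by measurable
      show "AE x in lebesgue. norm (norm (H x) powr e) \<le> norm (?S x)" using HS by simp
    qed
    have "(\<integral>x. norm (H x) powr e \<partial>lebesgue) \<le> (C * 2 powr e) * X"
      using integral_mono[OF intH int HS] le by linarith
    then have "Lp_norm e H \<le> ((C * 2 powr e) * X) powr (1 / e)"
      unfolding Lp_norm_eq[OF intH H(1)] using assms(2) by (intro powr_mono2) auto
    also have "\<dots> = (C * 2 powr e) powr (1 / e) * X powr (1 / e)"
    proof -
      have "0 \<le> (\<Sum>i<n. a i * measure lebesgue (A i))" using a by (intro sum_nonneg mult_nonneg_nonneg) auto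
      then have "0 \<le> X" using X by linarith
      then show ?thesis by (simp add: powr_mult)
    qed
    finally show "integrable lebesgue (\<lambda>x. norm (H x) powr e) \<and> Lp_norm e H \<le> (C * 2 powr e) powr (1 / e) * X powr (1 / e)"
      using intH by simp
  qed
qed

text \<open>A part of \<open>Cc_inf\<close> whose stability under finite real combinations is
  inherited from the algebra, the union of the compact sets being the new one.\<close>

definition smooth_cs :: "('a::euclidean_space \<Rightarrow> complex) set" where
  "smooth_cs = {f. \<exists>\<phi>\<in>smooth_alg. \<exists>S. compact S \<and> (\<forall>x. x \<notin> S \<longrightarrow> \<phi> x = 0) \<and> f = (\<lambda>x. complex_of_real (\<phi> x))}"

lemma smooth_csI:
  "\<phi> \<in> smooth_alg \<Longrightarrow> compact S \<Longrightarrow> (\<And>x. x \<notin> S \<Longrightarrow> \<phi> x = 0) \<Longrightarrow> (\<lambda>x. complex_of_real (\<phi> x)) \<in> smooth_cs"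
  unfolding smooth_cs_def by blast

lemma Cc_inf_smooth_cs: "f \<in> smooth_cs \<Longrightarrow> Cc_inf f"
  unfolding smooth_cs_def using Cc_inf_smooth_alg by blast

lemma smooth_cs_sum:
  assumes "finite J" "\<And>S. S \<in> J \<Longrightarrow> f S \<in> smooth_cs"
  shows "(\<lambda>x. \<Sum>S\<in>J. complex_of_real (c S) * f S x) \<in> smooth_cs"
proof -
  have "\<forall>S\<in>J. \<exists>\<phi>. \<phi> \<in> smooth_alg \<and> (\<exists>B. compact B \<and> (\<forall>x. x \<notin> B \<longrightarrow> \<phi> x = 0)) \<and> f S = (\<lambda>x. complex_of_real (\<phi> x))"
    using assms(2) unfolding smooth_cs_def by blast
  from bchoice[OF this] obtain \<phi> where \<phi>: "\<forall>S\<in>J. \<phi> S \<in> smooth_alg \<and> (\<exists>B. compact B \<and> (\<forall>x. x \<notin> B \<longrightarrow> \<phi> S x = 0)) \<and> f S = (\<lambda>x. complex_of_real (\<phi> S x))"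
    by blast
  then have "\<forall>S\<in>J. \<exists>B. compact B \<and> (\<forall>x. x \<notin> B \<longrightarrow> \<phi> S x = 0)" by blast
  from bchoice[OF this] obtain B where B: "\<forall>S\<in>J. compact (B S) \<and> (\<forall>x. x \<notin> B S \<longrightarrow> \<phi> S x = 0)" by blast
  have "(\<lambda>x. complex_of_real (\<Sum>S\<in>J. c S * \<phi> S x)) \<in> smooth_cs"
  proof (rule smooth_csI)
    show "(\<lambda>x. \<Sum>S\<in>J. c S * \<phi> S x) \<in> smooth_alg"
      using \<phi> by (intro smooth_alg_sum smooth_alg.mult smooth_alg.const) auto
    show "compact (\<Union>S\<in>J. B S)" using B assms(1) by (intro compact_UN) auto
    show "(\<Sum>S\<in>J. c S * \<phi> S x) = 0" if "x \<notin> (\<Union>S\<in>J. B S)" for x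
      using that B by (intro sum.neutral) auto
  qed
  moreover have "complex_of_real (\<Sum>S\<in>J. c S * \<phi> S x) = (\<Sum>S\<in>J. complex_of_real (c S) * f S x)" for x
    using \<phi> by (simp cong: sum.cong)
  ultimately show ?thesis by simp
qed

lemma test_fun_smooth_cs:
  assumes "\<phi> \<in> smooth_alg" "0 < l" "\<And>x. x \<notin> cube c (2 * l) \<Longrightarrow> \<phi> x = 0"
  shows "test_fun m \<phi> (bump c l) i \<in> smooth_cs"
proof -
  have "test_fun m \<phi> (bump c l) i = (\<lambda>x. complex_of_real ((if i = 0 then \<phi> else if i < m then bump c l else (\<lambda>x. 0)) x))"
    by (auto simp: test_fun_def)
  also have "\<dots> \<in> smooth_cs"
    using assms bump_eq_0[OF assms(2)]
    by (intro smooth_csI[OF _ compact_cube[of c "2 * l"]]) (auto simp: smooth_alg_bump smooth_alg.const)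
  finally show ?thesis .
qed

lemma norm_test_fun_le:
  fixes c x :: "'a::euclidean_space"
  assumes "0 < l" "\<And>x. \<bar>\<phi> x\<bar> \<le> 2" "\<And>x. x \<notin> cube c (2 * l) \<Longrightarrow> \<phi> x = 0" "real DIM('a) \<le> \<kappa>"
  shows "norm (test_fun m \<phi> (bump c l) i x) \<le> 2 * indicator (cball c (\<kappa> * l)) x"
proof (cases "x \<in> cball c (\<kappa> * l)")
  case True
  then show ?thesis
    using assms(2)[of x] bump_bounds[of c l x] by (auto simp: test_fun_def)
next
  case False
  have "real DIM('a) * l \<le> \<kappa> * l" using assms(1,4) by (intro mult_right_mono) auto
  then have "x \<notin> cball c (real DIM('a) * l)" using False by auto
  then have "x \<notin> cube c (2 * l)" using cube_subset_cball[of c l] by blast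
  then show ?thesis using assms(3) bump_eq_0[OF assms(1)] False by (auto simp: test_fun_def)
qed

text \<open>What remains of the commutator after duality: \<open>T\<close> and \<open>K\<close> no
  longer occur. The ball of radius \<open>\<kappa> * l i\<close> is meant to contain the supports of
  all functions attached to the cube, and the sums over j \<ge> i are natural for a listing by
  decreasing side. The \<open>Q i\<close> may be any measurable parts of the cubes, so half-open
  dyadic cells qualify.\<close>

definition oscillation_estimate :: "('a::euclidean_space \<Rightarrow> real) \<Rightarrow> real \<Rightarrow> real \<Rightarrow> real \<Rightarrow> real \<Rightarrow> bool" where
  "oscillation_estimate b r \<kappa> \<Lambda> C \<longleftrightarrow> (\<forall>(N::nat) c l t Q. (\<forall>i<N. 0 < l i \<and> 0 \<le> t i \<and> Q i \<in> sets lebesgue \<and> Q i \<subseteq> cube (c i) (l i)) \<longrightarrow>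
       (\<forall>i<N. (\<Sum>j\<in>{j\<in>{i..<N}. cball (c j) (\<kappa> * l j) \<inter> cball (c i) (\<kappa> * l i) \<noteq> {}}. l j ^ DIM('a)) \<le> \<Lambda> * l i ^ DIM('a)) \<longrightarrow>
       (\<exists>\<alpha>. (\<Sum>i<N. t i powr (r - 1) * (\<integral>x. indicator (Q i) x * \<bar>b x - \<alpha> i\<bar> \<partial>lebesgue))
          \<le> C * (\<Sum>i<N. t i powr r * l i ^ DIM('a)) powr (1 - 1 / r)))"

section \<open>Duality estimate for a Carleson family\<close>

context cz_commutator
begin

text \<open>\<kappa> is fixed before \<Lambda>, because the packing constant of the stopping family
  will depend on \<kappa>. By \<open>expo\<close>, Hoelder's inequality with q' and q followed by
  boundedness of the commutator leaves the energy to the power 1/q' + 1/p = 1 - 1/r.\<close>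

lemma main_estimate:
  fixes p q :: real and ps :: "nat \<Rightarrow> real"
  assumes q: "1 < q" "q < p" and ps: "\<And>i. i < m \<Longrightarrow> 1 < ps i" and p: "1 / p = (\<Sum>i<m. 1 / ps i)"
    and cb: "comm_bounded m ps q b T"
    and nd: "0 < c0" "\<And>y \<rho>. 0 < \<rho> \<Longrightarrow>
        (\<exists>x. dist x y \<ge> \<rho> \<and> norm (K x (\<lambda>_. y)) \<ge> 1 / (c0 * \<rho> ^ (m * DIM('a))))"
    and r: "1 / r = 1 / q - 1 / p"
  obtains \<kappa> where "real DIM('a) \<le> \<kappa>"
    "\<And>\<Lambda>. 0 \<le> \<Lambda> \<Longrightarrow> \<exists>C. oscillation_estimate b r \<kappa> \<Lambda> C"
proof -
  let ?U = "commutator1 b T"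
  obtain C1 where C1: "\<And>f. (\<And>i. i < m \<Longrightarrow> Cc_inf (f i)) \<Longrightarrow> in_Lp q (?U f) \<and>
      Lp_norm q (?U f) \<le> C1 * (\<Prod>i<m. Lp_norm (ps i) (f i))"
    using cb unfolding comm_bounded_def by auto
  have Uq: "in_Lp q (?U f)" if "\<And>i. i < m \<Longrightarrow> Cc_inf (f i)" for f using C1[of f] that by blast
  define q' where "q' = q / (q - 1)"
  have q': "1 < q'" "1 / q' + 1 / q = 1" using q by (auto simp: q'_def field_simps)
  have r0: "r \<noteq> 0" using r q by (auto simp: field_simps)
  have expo: "1 / q' + 1 / p = 1 - 1 / r" using q' r by linarith
  have q1: "1 \<le> q" using q by simp
  show ?thesis
  proof (rule test_functions[OF q1 Uq nd])
    show "i < m \<Longrightarrow> (\<And>i. i < m \<Longrightarrow> Cc_inf (f i)) \<Longrightarrow> Cc_inf (f i)" for f :: "nat \<Rightarrow> 'a \<Rightarrow> complex" and i by blast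
    fix C0 \<kappa> :: real
    assume C0: "0 < C0" and \<kappa>: "real DIM('a) \<le> \<kappa>" and tests: "\<And>c l Q. \<lbrakk>0 < l; Q \<in> sets lebesgue; Q \<subseteq> cube c l\<rbrakk> \<Longrightarrow>
      \<exists>\<alpha> g \<phi>. g \<in> borel_measurable lebesgue \<and> (\<forall>x. norm (g x) \<le> indicator (cball c (\<kappa> * l)) x) \<and>
        \<phi> \<in> smooth_alg \<and> (\<forall>x. \<bar>\<phi> x\<bar> \<le> 2) \<and> (\<forall>x. x \<notin> cube c (2 * l) \<longrightarrow> \<phi> x = 0) \<and>
        (\<integral>x. indicator Q x * \<bar>b x - \<alpha>\<bar> \<partial>lebesgue) \<le> C0 * Re (\<integral>x. g x * ?U (test_fun m \<phi> (bump c l)) x \<partial>lebesgue)"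
    \<comment> \<open>Volume of the enlarged ball about a cube of side 1; it converts between powers
      of the side and measures of the balls \<open>A i\<close>.\<close>
    define W where "W = unit_ball_vol (real DIM('a)) * \<kappa> ^ DIM('a)"
    have W: "0 < W" using \<kappa> by (auto simp: W_def intro!: mult_pos_pos zero_less_power less_le_trans[OF _ \<kappa>])
    show thesis
    proof (rule that[OF \<kappa>])
      fix \<Lambda> :: real assume \<Lambda>: "0 \<le> \<Lambda>"
      \<comment> \<open>The embedding is needed for q' and for all \<open>ps i\<close> at once, so a
        constant is selected for each exponent.\<close>
      define CP where "CP e C \<longleftrightarrow> 0 < C \<and> (\<forall>(n :: nat) A a X (H :: 'a \<Rightarrow> complex).
        (\<forall>i<n. A i \<in> fmeasurable lebesgue) \<longrightarrow> (\<forall>i<n. 0 \<le> a i) \<longrightarrow>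
        (\<forall>i<n. (\<Sum>j\<in>{j\<in>{i..<n}. A j \<inter> A i \<noteq> {}}. measure lebesgue (A j)) \<le> \<Lambda> * measure lebesgue (A i)) \<longrightarrow>
        H \<in> borel_measurable lebesgue \<longrightarrow> (\<forall>x. norm (H x) \<le> (\<Sum>i<n. 2 * a i powr (1 / e) * indicator (A i) x)) \<longrightarrow>
        (\<Sum>i<n. a i * measure lebesgue (A i)) \<le> X \<longrightarrow>
        integrable lebesgue (\<lambda>x. norm (H x) powr e) \<and> Lp_norm e H \<le> C * X powr (1 / e))" for e C
      define Ce where "Ce e = (SOME C. CP e C)" for e
      have Ce: "CP e (Ce e)" if e: "1 < e" for e
        unfolding Ce_def
      proof (rule someI_ex, rule sum_carleson_Lp[OF \<Lambda> e])
        fix C assume C: "0 < C" and P: "\<And>(n :: nat) A a X (H :: 'a::euclidean_space \<Rightarrow> complex).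
          \<lbrakk>\<And>i. i < n \<Longrightarrow> A i \<in> fmeasurable lebesgue; \<And>i. i < n \<Longrightarrow> 0 \<le> a i;
           \<And>i. i < n \<Longrightarrow> (\<Sum>j\<in>{j\<in>{i..<n}. A j \<inter> A i \<noteq> {}}. measure lebesgue (A j)) \<le> \<Lambda> * measure lebesgue (A i);
           H \<in> borel_measurable lebesgue; \<And>x. norm (H x) \<le> (\<Sum>i<n. 2 * a i powr (1 / e) * indicator (A i) x);
           (\<Sum>i<n. a i * measure lebesgue (A i)) \<le> X\<rbrakk>
         \<Longrightarrow> integrable lebesgue (\<lambda>x. norm (H x) powr e) \<and> Lp_norm e H \<le> C * X powr (1 / e)"
        show "\<exists>C. CP e C"
          unfolding CP_def
        proof (rule exI[of _ C], rule conjI[OF C], intro allI impI)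
          fix n :: nat and A a X and H :: "'a \<Rightarrow> complex"
          assume h: "\<forall>i<n. A i \<in> fmeasurable lebesgue" "\<forall>i<n. 0 \<le> a i"
            "\<forall>i<n. (\<Sum>j\<in>{j\<in>{i..<n}. A j \<inter> A i \<noteq> {}}. measure lebesgue (A j)) \<le> \<Lambda> * measure lebesgue (A i)"
            "H \<in> borel_measurable lebesgue" "\<forall>x. norm (H x) \<le> (\<Sum>i<n. 2 * a i powr (1 / e) * indicator (A i) x)"
            "(\<Sum>i<n. a i * measure lebesgue (A i)) \<le> X"
          show "integrable lebesgue (\<lambda>x. norm (H x) powr e) \<and> Lp_norm e H \<le> C * X powr (1 / e)"
          proof (rule P[where n = n and A = A and a = a and H = H and X = X])
            show "A i \<in> fmeasurable lebesgue" if "i < n" for i by (rule h(1)[rule_format, OF that])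
            show "0 \<le> a i" if "i < n" for i by (rule h(2)[rule_format, OF that])
            show "(\<Sum>j\<in>{j\<in>{i..<n}. A j \<inter> A i \<noteq> {}}. measure lebesgue (A j)) \<le> \<Lambda> * measure lebesgue (A i)" if "i < n" for i
              by (rule h(3)[rule_format, OF that])
            show "norm (H x) \<le> (\<Sum>i<n. 2 * a i powr (1 / e) * indicator (A i) x)" for x by (rule h(5)[rule_format])
          qed (rule h(4) h(6))+
        qed
      qed
      define Cm where "Cm = C0 * (Ce q' * \<bar>C1\<bar> * (\<Prod>i<m. Ce (ps i)) * W powr (1 - 1 / r))"
      show "\<exists>C. oscillation_estimate b r \<kappa> \<Lambda> C"
        unfolding oscillation_estimate_def
      proof (intro exI[of _ Cm] allI impI)
        fix N :: nat and c :: "nat \<Rightarrow> 'a" and l t :: "nat \<Rightarrow> real" and Q :: "nat \<Rightarrow> 'a set"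
        assume hyp: "\<forall>i<N. 0 < l i \<and> 0 \<le> t i \<and> Q i \<in> sets lebesgue \<and> Q i \<subseteq> cube (c i) (l i)"
          and carl: "\<forall>i<N. (\<Sum>j\<in>{j\<in>{i..<N}. cball (c j) (\<kappa> * l j) \<inter> cball (c i) (\<kappa> * l i) \<noteq> {}}. l j ^ DIM('a)) \<le> \<Lambda> * l i ^ DIM('a)"
        have l: "\<And>i. i < N \<Longrightarrow> 0 < l i" and t: "\<And>i. i < N \<Longrightarrow> 0 \<le> t i" using hyp by auto
        define A where "A i = cball (c i) (\<kappa> * l i)" for i
        have \<kappa>0: "0 \<le> \<kappa>" using \<kappa> by simp
        have mA: "measure lebesgue (A i) = W * l i ^ DIM('a)" if "i < N" for i
          using content_cball[of "\<kappa> * l i" "c i"] l[OF that] \<kappa>0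
          by (simp add: A_def W_def power_mult_distrib)
        have fA: "A i \<in> fmeasurable lebesgue" for i unfolding A_def by (rule lmeasurable_compact) simp
        have carlA: "(\<Sum>j\<in>{j\<in>{i..<N}. A j \<inter> A i \<noteq> {}}. measure lebesgue (A j)) \<le> \<Lambda> * measure lebesgue (A i)" if "i < N" for i
        proof -
          have "(\<Sum>j\<in>{j\<in>{i..<N}. A j \<inter> A i \<noteq> {}}. measure lebesgue (A j)) = W * (\<Sum>j\<in>{j\<in>{i..<N}. A j \<inter> A i \<noteq> {}}. l j ^ DIM('a))"
            unfolding sum_distrib_left by (intro sum.cong refl mA) auto
          also have "\<dots> \<le> W * (\<Lambda> * l i ^ DIM('a))"
            using carl that W unfolding A_def by (intro mult_left_mono) auto
          finally show ?thesis using mA[OF that] by (simp add: mult_ac)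
        qed
        define good where "good i \<alpha> g \<phi> \<longleftrightarrow> g \<in> borel_measurable lebesgue \<and> (\<forall>x. norm (g x) \<le> indicator (A i) x) \<and>
          \<phi> \<in> smooth_alg \<and> (\<forall>x. \<bar>\<phi> x\<bar> \<le> 2) \<and> (\<forall>x. x \<notin> cube (c i) (2 * l i) \<longrightarrow> \<phi> x = 0) \<and>
          (\<integral>x. indicator (Q i) x * \<bar>b x - \<alpha>\<bar> \<partial>lebesgue) \<le> C0 * Re (\<integral>x. g x * ?U (test_fun m \<phi> (bump (c i) (l i))) x \<partial>lebesgue)"
          for i \<alpha> g \<phi>
        have "\<forall>i. \<exists>z. i < N \<longrightarrow> good i (fst z) (fst (snd z)) (snd (snd z))"
        proof
          fix i
          show "\<exists>z. i < N \<longrightarrow> good i (fst z) (fst (snd z)) (snd (snd z))"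
          proof (cases "i < N")
            case True
            then obtain \<alpha> g \<phi> where "good i \<alpha> g \<phi>"
              using tests[of "l i" "Q i" "c i"] hyp unfolding good_def A_def by blast
            then show ?thesis by (intro exI[of _ "(\<alpha>, g, \<phi>)"]) simp
          qed simp
        qed
        then obtain z where z: "\<forall>i. i < N \<longrightarrow> good i (fst (z i)) (fst (snd (z i))) (snd (snd (z i)))"
          by (rule choice[THEN exE])
        define \<alpha> where "\<alpha> i = fst (z i)" for i
        define g where "g i = fst (snd (z i))" for i
        define \<phi> where "\<phi> i = snd (snd (z i))" for i
        have good: "good i (\<alpha> i) (g i) (\<phi> i)" if "i < N" for i using z that by (simp add: \<alpha>_def g_def \<phi>_def)
        have gm: "g i \<in> borel_measurable lebesgue" "norm (g i x) \<le> indicator (A i) x" if "i < N" for i x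
          using good[OF that] by (auto simp: good_def)
        define f where "f i = test_fun m (\<phi> i) (bump (c i) (l i))" for i
        have fX: "f i k \<in> smooth_cs" if "i < N" for i k
          unfolding f_def using good[OF that] l[OF that] by (intro test_fun_smooth_cs) (auto simp: good_def)
        have fle: "norm (f i k x) \<le> 2 * indicator (A i) x" if "i < N" for i k x
          unfolding f_def A_def using good[OF that] l[OF that] \<kappa> by (intro norm_test_fun_le) (auto simp: good_def)
        have ftail: "f i k = (\<lambda>x. 0)" if "m \<le> k" for i k using that m by (auto simp: f_def test_fun_def)
        \<comment> \<open>The dual function carries t^(r/q') here, the arguments carry t^(r/p_k) in
          \<open>w\<close>; by \<open>wprod\<close> these multiply to
          \<open>t R powr (r - 1)\<close>.\<close>
        define P where "P R h = t R powr (r / q') * Re (\<integral>x. g R x * ?U h x \<partial>lebesgue)" for R h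
        define w where "w k R = t R powr (r / ps k)" for k R
        have intgU: "integrable lebesgue (\<lambda>x. g R x * ?U h x)" if "R < N" "\<And>i. i < m \<Longrightarrow> h i \<in> smooth_cs" for R h
        proof (rule integrable_mult_in_Lp[OF Uq q1 gm(1)[OF that(1)]])
          show "i < m \<Longrightarrow> Cc_inf (h i)" for i using that(2) by (rule Cc_inf_smooth_cs)
          show "norm (g R x) \<le> 1 * indicator (A R) x" for x using gm(2)[OF that(1)] by simp
          show "compact (A R)" by (simp add: A_def)
        qed simp
        obtain \<eta> :: "nat \<Rightarrow> real" and \<epsilon> :: "nat \<Rightarrow> nat \<Rightarrow> real" where
          \<eta>: "\<And>R. \<eta> R = 1 \<or> \<eta> R = -1" and \<epsilon>: "\<And>i R. \<epsilon> i R = 1 \<or> \<epsilon> i R = -1" and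
          diag: "(\<Sum>R\<in>{..<N}. (\<Prod>i<m. w i R) * P R (f R)) \<le> (\<Sum>R\<in>{..<N}. \<eta> R * P R (\<lambda>i x. if i < m then
             \<Sum>S\<in>{..<N}. complex_of_real (\<epsilon> i S * w i S) * f S i x else 0))"
        proof (rule multilinear_diagonal_le[of "{..<N}" m f smooth_cs P w])
          show "(\<lambda>x. \<Sum>S\<in>{..<N}. complex_of_real (c S) * f S k x) \<in> smooth_cs" for k c
            using fX by (intro smooth_cs_sum) auto
          show "P R (h(k := (\<lambda>x. \<Sum>S\<in>{..<N}. complex_of_real (c S) * f S k x))) = (\<Sum>S\<in>{..<N}. c S * P R (h(k := f S k)))"
            if R: "R \<in> {..<N}" and k: "k < m" and h: "\<And>i. i < m \<Longrightarrow> h i \<in> smooth_cs" for R k h and c :: "nat \<Rightarrow> real"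
          proof -
            have int: "integrable lebesgue (\<lambda>x. complex_of_real (c S) * (g R x * ?U (h(k := f S k)) x))" if "S \<in> {..<N}" for S
              using R that h fX by (intro integrable_mult_right intgU) auto
            have "(\<integral>x. g R x * ?U (h(k := (\<lambda>x. \<Sum>S\<in>{..<N}. complex_of_real (c S) * f S k x))) x \<partial>lebesgue)
                = (\<integral>x. (\<Sum>S\<in>{..<N}. complex_of_real (c S) * (g R x * ?U (h(k := f S k)) x)) \<partial>lebesgue)"
              unfolding commutator1_sum[OF linear k finite_lessThan] sum_distrib_left by (simp only: mult.left_commute)
            also have "\<dots> = (\<Sum>S\<in>{..<N}. complex_of_real (c S) * (\<integral>x. g R x * ?U (h(k := f S k)) x \<partial>lebesgue))"
              using int by (subst Bochner_Integration.integral_sum) auto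
            finally show ?thesis unfolding P_def by (simp add: sum_distrib_left mult.left_commute)
          qed
        qed (use fX ftail in auto)
        define F where "F i x = (if i < m then \<Sum>S\<in>{..<N}. complex_of_real (\<epsilon> i S * w i S) * f S i x else 0)" for i x
        define G where "G x = (\<Sum>R<N. complex_of_real (\<eta> R * t R powr (r / q')) * g R x)" for x
        have FX: "F i \<in> smooth_cs" if "i < m" for i
          using that fX unfolding F_def[abs_def] by simp (intro smooth_cs_sum[where c = "\<lambda>S. \<epsilon> i S * w i S", simplified], auto)
        have FC: "Cc_inf (F i)" if "i < m" for i by (rule Cc_inf_smooth_cs[OF FX[OF that]])
        define Y where "Y = (\<Sum>i<N. t i powr r * l i ^ DIM('a))"
        have Y: "0 \<le> Y" unfolding Y_def using l by (intro sum_nonneg mult_nonneg_nonneg zero_le_power) (auto intro: less_imp_le)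
        have sumA: "(\<Sum>i<N. t i powr r * measure lebesgue (A i)) \<le> W * Y"
          unfolding Y_def sum_distrib_left by (intro sum_mono) (auto simp: mA)
        \<comment> \<open>Embedding with a = t^r: every signed sum has its Lebesgue norm bounded by
          a power of the energy \<open>Y\<close>, whatever the signs.\<close>
        have bound: "integrable lebesgue (\<lambda>x. norm (H x) powr e) \<and> Lp_norm e H \<le> Ce e * (W * Y) powr (1 / e)"
          if e: "1 < e" and H: "H \<in> borel_measurable lebesgue" and
            le: "\<And>x. norm (H x) \<le> (\<Sum>i<N. 2 * t i powr (r / e) * indicator (A i) x)" for H :: "'a \<Rightarrow> complex" and e
        proof -
          have "\<forall>x. norm (H x) \<le> (\<Sum>i<N. 2 * (t i powr r) powr (1 / e) * indicator (A i) x)"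
            using le by (simp add: powr_powr)
          then show ?thesis
            using Ce[OF e] fA carlA H sumA unfolding CP_def by (elim conjE allE[of _ N] allE[of _ A] allE[of _ "\<lambda>i. t i powr r"] allE[of _ "W * Y"] allE[of _ H]) auto
        qed
        have Gm: "G \<in> borel_measurable lebesgue" unfolding G_def using gm(1) by (intro borel_measurable_sum borel_measurable_times) auto
        have Gle: "norm (G x) \<le> (\<Sum>i<N. 2 * t i powr (r / q') * indicator (A i) x)" for x
          unfolding G_def
        proof (rule order_trans[OF norm_sum], rule sum_mono)
          fix i assume "i \<in> {..<N}"
          then have "norm (g i x) \<le> indicator (A i) x" using gm(2) by auto
          also have "\<dots> \<le> 2 * indicator (A i) x" by simp
          finally show "norm (complex_of_real (\<eta> i * t i powr (r / q')) * g i x) \<le> 2 * t i powr (r / q') * indicator (A i) x"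
            using \<eta>[of i] mult_left_mono[of "norm (g i x)" "2 * indicator (A i) x" "t i powr (r / q')"] by (auto simp: norm_mult abs_mult mult_ac)
        qed
        have Fle: "norm (F k x) \<le> (\<Sum>i<N. 2 * t i powr (r / ps k) * indicator (A i) x)" if "k < m" for k x
          unfolding F_def using that
        proof (simp only: if_True, intro order_trans[OF norm_sum] sum_mono)
          fix i assume "i \<in> {..<N}"
          then have "norm (f i k x) \<le> 2 * indicator (A i) x" using fle by auto
          then show "norm (complex_of_real (\<epsilon> k i * w k i) * f i k x) \<le> 2 * t i powr (r / ps k) * indicator (A i) x"
            using \<epsilon>[of k i] mult_left_mono[of "norm (f i k x)" "2 * indicator (A i) x" "t i powr (r / ps k)"]
            by (auto simp: norm_mult abs_mult mult_ac w_def)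
        qed
        note bG = bound[OF q'(1) Gm Gle]
        have bF: "Lp_norm (ps k) (F k) \<le> Ce (ps k) * (W * Y) powr (1 / ps k)" if "k < m" for k
          using bound[OF ps[OF that] borel_measurable_Cc_inf[OF FC[OF that]] Fle[OF that]] by blast
        have UF: "in_Lp q (?U F)" "Lp_norm q (?U F) \<le> C1 * (\<Prod>i<m. Lp_norm (ps i) (F i))"
          using C1[of F] FC by auto
        have UFm: "?U F \<in> borel_measurable lebesgue" using UF(1) by (simp add: in_Lp_def)
        have UFi: "integrable lebesgue (\<lambda>x. norm (?U F x) powr q)"
          using UF(1) UFm by (intro integrableI_nonneg) (auto simp: in_Lp_def)
        have intGU': "integrable lebesgue (\<lambda>x. complex_of_real (\<eta> R * t R powr (r / q')) * (g R x * ?U F x))" if "R \<in> {..<N}" for R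
          using that FX by (intro integrable_mult_right intgU) auto
        have Gexp: "G x * ?U F x = (\<Sum>R<N. complex_of_real (\<eta> R * t R powr (r / q')) * (g R x * ?U F x))" for x
          by (simp add: G_def sum_distrib_right mult.assoc)
        have intGU: "integrable lebesgue (\<lambda>x. G x * ?U F x)"
          unfolding Gexp by (rule Bochner_Integration.integrable_sum[OF intGU'])
        have "(\<Sum>R<N. \<eta> R * P R F) = Re (\<integral>x. G x * ?U F x \<partial>lebesgue)"
        proof -
          have "(\<integral>x. G x * ?U F x \<partial>lebesgue)
              = (\<Sum>R<N. \<integral>x. complex_of_real (\<eta> R * t R powr (r / q')) * (g R x * ?U F x) \<partial>lebesgue)"
            unfolding Gexp by (rule Bochner_Integration.integral_sum) (rule intGU')
          also have "\<dots> = (\<Sum>R<N. complex_of_real (\<eta> R * t R powr (r / q')) * (\<integral>x. g R x * ?U F x \<partial>lebesgue))"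
            by (simp only: integral_mult_right_zero)
          finally have e: "(\<integral>x. G x * ?U F x \<partial>lebesgue)
              = (\<Sum>R<N. complex_of_real (\<eta> R * t R powr (r / q')) * (\<integral>x. g R x * ?U F x \<partial>lebesgue))" .
          have Rm: "Re (complex_of_real u * v) = u * Re v" for u v by simp
          show ?thesis unfolding e Re_sum Rm P_def by (simp only: mult.assoc)
        qed
        also have "\<dots> \<le> norm (\<integral>x. G x * ?U F x \<partial>lebesgue)" by (rule complex_Re_le_cmod)
        also have "\<dots> \<le> Lp_norm q' G * Lp_norm q (?U F)"
          unfolding Lp_norm_eq[OF conjunct1[OF bG] Gm] Lp_norm_eq[OF UFi UFm]
          by (rule Holder_inequality_integral[OF q'(1) q(1) q'(2) intGU conjunct1[OF bG] UFi])
        also have "\<dots> \<le> (Ce q' * (W * Y) powr (1 / q')) * (\<bar>C1\<bar> * (\<Prod>i<m. Ce (ps i) * (W * Y) powr (1 / ps i)))"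
        proof (rule mult_mono)
          show "Lp_norm q' G \<le> Ce q' * (W * Y) powr (1 / q')" using bG by blast
          have n: "0 \<le> Lp_norm e h" for e and h :: "'a \<Rightarrow> complex" by (simp add: Lp_norm_def)
          have "C1 * (\<Prod>i<m. Lp_norm (ps i) (F i)) \<le> \<bar>C1\<bar> * (\<Prod>i<m. Lp_norm (ps i) (F i))"
            by (intro mult_right_mono prod_nonneg) (auto simp: n)
          also have "\<dots> \<le> \<bar>C1\<bar> * (\<Prod>i<m. Ce (ps i) * (W * Y) powr (1 / ps i))"
            using bF n by (intro mult_left_mono prod_mono) auto
          finally show "Lp_norm q (?U F) \<le> \<bar>C1\<bar> * (\<Prod>i<m. Ce (ps i) * (W * Y) powr (1 / ps i))" using UF(2) by linarith
          show "0 \<le> Lp_norm q (?U F)" by (rule n)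
          show "0 \<le> Ce q' * (W * Y) powr (1 / q')" using Ce[OF q'(1)] by (simp add: CP_def)
        qed
        also have "\<dots> = Ce q' * \<bar>C1\<bar> * (\<Prod>i<m. Ce (ps i)) * ((W * Y) powr (1 / q') * (\<Prod>i<m. (W * Y) powr (1 / ps i)))"
          by (simp add: prod.distrib mult_ac)
        also have "(W * Y) powr (1 / q') * (\<Prod>i<m. (W * Y) powr (1 / ps i)) = (W * Y) powr (1 - 1 / r)"
          using powr_prod_eq[of "W * Y" m "\<lambda>i. 1 / ps i"] W Y m unfolding expo[symmetric] powr_add p by simp
        also have "(W * Y) powr (1 - 1 / r) = W powr (1 - 1 / r) * Y powr (1 - 1 / r)"
          by (simp add: powr_mult)
        finally have 1: "(\<Sum>R<N. \<eta> R * P R F) \<le> Ce q' * \<bar>C1\<bar> * (\<Prod>i<m. Ce (ps i)) * (W powr (1 - 1 / r) * Y powr (1 - 1 / r))" .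
        have wprod: "(\<Prod>i<m. w i R) * t R powr (r / q') = t R powr (r - 1)" if "R < N" for R
        proof -
          have "(\<Prod>i<m. w i R) = t R powr (\<Sum>i<m. r / ps i)"
            unfolding w_def by (rule powr_prod_eq[OF t[OF that] m])
          also have "(\<Sum>i<m. r / ps i) = r / p"
            using p by (simp add: sum_distrib_left[symmetric] divide_inverse)
          finally have "(\<Prod>i<m. w i R) * t R powr (r / q') = t R powr (r / p + r / q')" by (simp add: powr_add)
          also have "r / p + r / q' = r * (1 / q' + 1 / p)" by (simp add: algebra_simps)
          also have "\<dots> = r - 1" unfolding expo using r0 by (simp add: algebra_simps)
          finally show ?thesis .
        qed
        have "(\<Sum>i<N. t i powr (r - 1) * (\<integral>x. indicator (Q i) x * \<bar>b x - \<alpha> i\<bar> \<partial>lebesgue))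
            \<le> (\<Sum>i<N. C0 * ((\<Prod>k<m. w k i) * P i (f i)))"
        proof (rule sum_mono)
          fix i assume i: "i \<in> {..<N}"
          have "t i powr (r - 1) * (\<integral>x. indicator (Q i) x * \<bar>b x - \<alpha> i\<bar> \<partial>lebesgue)
              \<le> t i powr (r - 1) * (C0 * Re (\<integral>x. g i x * ?U (f i) x \<partial>lebesgue))"
            using good[of i] i by (intro mult_left_mono) (auto simp: good_def f_def)
          also have "\<dots> = C0 * ((\<Prod>k<m. w k i) * P i (f i))"
            using wprod[of i, symmetric] i by (simp add: P_def mult_ac)
          finally show "t i powr (r - 1) * (\<integral>x. indicator (Q i) x * \<bar>b x - \<alpha> i\<bar> \<partial>lebesgue) \<le> C0 * ((\<Prod>k<m. w k i) * P i (f i))" .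
        qed
        also have "\<dots> = C0 * (\<Sum>i<N. (\<Prod>k<m. w k i) * P i (f i))" by (simp only: sum_distrib_left)
        also have "\<dots> \<le> C0 * (\<Sum>R<N. \<eta> R * P R F)"
          using diag C0 unfolding F_def[abs_def] by (intro mult_left_mono) auto
        also have "\<dots> \<le> C0 * (Ce q' * \<bar>C1\<bar> * (\<Prod>i<m. Ce (ps i)) * (W powr (1 - 1 / r) * Y powr (1 - 1 / r)))"
          using 1 C0 by (intro mult_left_mono) auto
        also have "\<dots> = Cm * Y powr (1 - 1 / r)" by (simp add: Cm_def mult_ac)
        finally show "\<exists>\<alpha>. (\<Sum>i<N. t i powr (r - 1) * (\<integral>x. indicator (Q i) x * \<bar>b x - \<alpha> i\<bar> \<partial>lebesgue))
          \<le> Cm * (\<Sum>i<N. t i powr r * l i ^ DIM('a)) powr (1 - 1 / r)"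
          unfolding Y_def by (rule exI[of _ \<alpha>])
      qed
    qed
  qed
qed

end

section \<open>Dyadic stopping cubes\<close>

locale dyadic =
  fixes a :: "'a::euclidean_space" and L :: real
  assumes L: "0 < L"
begin

text \<open>Cells will be the classes of points with equal integer parts, hence half-open: each
  generation partitions the space exactly, and nesting is integer division by 2 as in
  \<open>idx_Suc\<close>. A cell is named by any of its points.\<close>

definition idx :: "nat \<Rightarrow> 'a \<Rightarrow> 'a \<Rightarrow> int" where
  "idx j x i = \<lfloor>2 ^ j * ((x - a) \<bullet> i) / L\<rfloor>"

definition cell :: "nat \<Rightarrow> 'a \<Rightarrow> 'a set" where
  "cell j x = {y. \<forall>i\<in>Basis. idx j y i = idx j x i}"

definition side :: "nat \<Rightarrow> real" where
  "side j = L / 2 ^ j"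

definition centre :: "nat \<Rightarrow> 'a \<Rightarrow> 'a" where
  "centre j x = (\<Sum>i\<in>Basis. (a \<bullet> i + side j * (idx j x i + 1 / 2)) *\<^sub>R i)"

lemma side_pos: "0 < side j"
  using L by (simp add: side_def)

lemma side_antimono: "i \<le> j \<Longrightarrow> side j \<le> side i"
  unfolding side_def using L by (intro divide_left_mono power_increasing) simp_all

lemma side_Suc: "side j = 2 * side (Suc j)"
  by (simp add: side_def)

lemma mem_cell [simp]: "x \<in> cell j x"
  by (simp add: cell_def)

lemma cell_eq: "y \<in> cell j x \<Longrightarrow> cell j y = cell j x"
  by (simp add: cell_def)

lemma idx_Suc: "idx j x i = idx (Suc j) x i div 2"
proof -
  have "idx j x i = \<lfloor>(2 ^ Suc j * ((x - a) \<bullet> i) / L) / real_of_int 2\<rfloor>"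
    unfolding idx_def by simp
  also have "\<dots> = \<lfloor>2 ^ Suc j * ((x - a) \<bullet> i) / L\<rfloor> div 2"
    by (rule floor_divide_real_eq_div) simp
  finally show ?thesis unfolding idx_def .
qed

lemma cell_Suc_subset: "cell (Suc j) x \<subseteq> cell j x"
proof
  fix y assume "y \<in> cell (Suc j) x"
  then show "y \<in> cell j x"
    unfolding cell_def by (simp add: idx_Suc[of j y] idx_Suc[of j x])
qed

lemma cell_antimono: "i \<le> j \<Longrightarrow> cell j x \<subseteq> cell i x"
proof (induction j rule: dec_induct)
  case (step n)
  then show ?case using cell_Suc_subset[of n x] by blast
qed simp

lemma idx_iff: "idx j y i = k \<longleftrightarrow> a \<bullet> i + side j * k \<le> y \<bullet> i \<and> y \<bullet> i < a \<bullet> i + side j * (k + 1)"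
proof -
  have "idx j y i = k \<longleftrightarrow> of_int k \<le> ((y - a) \<bullet> i) / side j \<and> ((y - a) \<bullet> i) / side j < of_int k + 1"
    unfolding idx_def side_def floor_eq_iff by (simp add: mult.commute)
  then show ?thesis
    using side_pos[of j] by (simp add: pos_le_divide_eq pos_divide_less_eq inner_diff_left) (simp add: algebra_simps)
qed

definition low :: "nat \<Rightarrow> 'a \<Rightarrow> 'a" where
  "low j x = (\<Sum>i\<in>Basis. (a \<bullet> i + side j * idx j x i) *\<^sub>R i)"

lemma cell_iff: "y \<in> cell j x \<longleftrightarrow> (\<forall>i\<in>Basis. low j x \<bullet> i \<le> y \<bullet> i \<and> y \<bullet> i < low j x \<bullet> i + side j)"
  unfolding cell_def low_def mem_Collect_eq idx_iff
  by (simp add: inner_sum_left_Basis distrib_left add.assoc)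

lemma cell_subset_cbox: "cell j x \<subseteq> cbox (low j x) (low j x + side j *\<^sub>R One)"
  by (auto simp: cell_iff mem_box inner_add_left less_imp_le)

lemma box_subset_cell: "box (low j x) (low j x + side j *\<^sub>R One) \<subseteq> cell j x"
  by (auto simp: cell_iff mem_box inner_add_left less_imp_le)

lemma cell_subset_cube: "cell j x \<subseteq> cube (centre j x) (side j)"
proof
  fix y assume y: "y \<in> cell j x"
  have "\<bar>(y - centre j x) \<bullet> i\<bar> \<le> side j / 2" if "i \<in> Basis" for i
  proof -
    have "centre j x \<bullet> i = low j x \<bullet> i + side j / 2"
    proof -
      have "centre j x \<bullet> i = a \<bullet> i + side j * (idx j x i + 1 / 2)" "low j x \<bullet> i = a \<bullet> i + side j * idx j x i"
        using that by (simp_all only: centre_def low_def inner_sum_left_Basis)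
      then show ?thesis by (simp add: algebra_simps)
    qed
    moreover have "low j x \<bullet> i \<le> y \<bullet> i" "y \<bullet> i < low j x \<bullet> i + side j" using y that by (auto simp: cell_iff)
    ultimately show ?thesis unfolding inner_diff_left abs_le_iff by linarith
  qed
  then show "y \<in> cube (centre j x) (side j)" by (simp add: cube_def)
qed

lemma dist_centre_le: "y \<in> cell j x \<Longrightarrow> dist (centre j x) y \<le> real DIM('a) * side j"
proof -
  assume "y \<in> cell j x"
  then have "y \<in> cube (centre j x) (2 * side j)"
    using cell_subset_cube cube_mono[of "side j" "2 * side j" "centre j x"] side_pos[of j] by fastforce
  then show ?thesis using cube_subset_cball by (auto simp: subset_iff)
qed

lemma cell_lmeasurable: "cell j x \<in> fmeasurable lebesgue"
proof -
  have "cell j x = (\<Inter>i\<in>Basis. {y. low j x \<bullet> i \<le> y \<bullet> i} \<inter> {y. y \<bullet> i < low j x \<bullet> i + side j})"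
    by (auto simp: cell_iff)
  also have "\<dots> \<in> sets borel"
    by (intro sets.finite_INT) auto
  finally have "cell j x \<in> sets lebesgue" by simp
  then show ?thesis by (rule fmeasurableI2[OF lmeasurable_cbox cell_subset_cbox])
qed

lemma cell_sets [simp]: "cell j x \<in> sets lebesgue"
  by (rule fmeasurableD[OF cell_lmeasurable])

text \<open>The half-open cell is squeezed between the open and the closed box of the same
  side.\<close>

lemma measure_cell: "measure lebesgue (cell j x) = side j ^ DIM('a)"
proof -
  have c: "measure lebesgue (cbox (low j x) (low j x + side j *\<^sub>R One)) = side j ^ DIM('a)"
    using side_pos[of j] by (simp add: content_cbox_if box_eq_empty inner_add_left)
  have "measure lebesgue (box (low j x) (low j x + side j *\<^sub>R One)) = side j ^ DIM('a)"
    using side_pos[of j] by (subst measure_completion) (auto simp: measure_lborel_box_eq inner_add_left less_imp_le)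
  moreover have "measure lebesgue (box (low j x) (low j x + side j *\<^sub>R One)) \<le> measure lebesgue (cell j x)"
    by (intro measure_mono_fmeasurable box_subset_cell cell_lmeasurable) auto
  moreover have "measure lebesgue (cell j x) \<le> measure lebesgue (cbox (low j x) (low j x + side j *\<^sub>R One))"
    by (intro measure_mono_fmeasurable cell_subset_cbox) auto
  ultimately show ?thesis using c by linarith
qed

lemma idx_0_a: "idx 0 a i = 0"
  by (simp add: idx_def)

lemma cell_0: "x \<in> cell 0 a \<Longrightarrow> cell 0 x = cell 0 a"
  by (rule cell_eq)

lemma mem_top: "y \<in> cell j x \<Longrightarrow> x \<in> cell 0 a \<Longrightarrow> y \<in> cell 0 a"
  using cell_antimono[of 0 j x] cell_0 by blast

lemma finite_cells: "finite (cell j ` cell 0 a)"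
proof -
  have "cell j ` cell 0 a \<subseteq> (\<lambda>g. {y. \<forall>i\<in>Basis. idx j y i = g i}) ` (Basis \<rightarrow>\<^sub>E {0..<2 ^ j})"
  proof
    fix Q assume "Q \<in> cell j ` cell 0 a"
    then obtain x where x: "x \<in> cell 0 a" "Q = cell j x" by auto
    have "idx j x i \<in> {0..<2 ^ j}" if "i \<in> Basis" for i
    proof -
      have "idx 0 x i = 0" using x(1) that by (simp add: cell_def idx_0_a)
      then have *: "0 \<le> (x - a) \<bullet> i / L" "(x - a) \<bullet> i / L < 1"
        by (simp_all add: idx_def floor_eq_iff)
      have "0 \<le> 2 ^ j * ((x - a) \<bullet> i / L)" by (rule mult_nonneg_nonneg[OF _ *(1)]) simp
      moreover have "2 ^ j * ((x - a) \<bullet> i / L) < 2 ^ j * 1" by (rule mult_strict_left_mono[OF *(2)]) simp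
      ultimately show ?thesis by (simp add: idx_def floor_less_iff)
    qed
    then have "restrict (idx j x) Basis \<in> Basis \<rightarrow>\<^sub>E {0..<2 ^ j}" by auto
    moreover have "Q = {y. \<forall>i\<in>Basis. idx j y i = restrict (idx j x) Basis i}"
      by (auto simp: x cell_def)
    ultimately show "Q \<in> (\<lambda>g. {y. \<forall>i\<in>Basis. idx j y i = g i}) ` (Basis \<rightarrow>\<^sub>E {0..<2 ^ j})" by blast
  qed
  moreover have "finite (Basis \<rightarrow>\<^sub>E {0..<(2::int) ^ j})" by (intro finite_PiE) auto
  ultimately show ?thesis by (rule finite_subset[OF _ finite_imageI])
qed

end

section \<open>Selected cells and their packing\<close>

lemma sum_integral_disjoint_le:
  fixes h :: "'b \<Rightarrow> real"
  assumes "finite I" "disjoint_family_on Q I" "\<And>i. i \<in> I \<Longrightarrow> Q i \<subseteq> R" "\<And>i. i \<in> I \<Longrightarrow> Q i \<in> sets M"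
    and "integrable M (\<lambda>x. indicator R x * h x)" "R \<in> sets M" "\<And>x. 0 \<le> h x"
  shows "(\<Sum>i\<in>I. \<integral>x. indicator (Q i) x * h x \<partial>M) \<le> (\<integral>x. indicator R x * h x \<partial>M)"
proof -
  have int: "integrable M (\<lambda>x. indicator (Q i) x * h x)" if "i \<in> I" for i
  proof -
    have "integrable M (\<lambda>x. indicator (Q i) x * (indicator R x * h x))"
      using integrable_mult_indicator[OF assms(4)[OF that] assms(5)] by simp
    moreover have "indicator (Q i) x * (indicator R x * h x) = indicator (Q i) x * h x" for x
      using assms(3)[OF that] by (auto simp: indicator_def)
    ultimately show ?thesis by simp
  qed
  have "(\<Sum>i\<in>I. \<integral>x. indicator (Q i) x * h x \<partial>M) = (\<integral>x. (\<Sum>i\<in>I. indicator (Q i) x * h x) \<partial>M)"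
    by (rule Bochner_Integration.integral_sum[symmetric]) (rule int)
  also have "\<dots> \<le> (\<integral>x. indicator R x * h x \<partial>M)"
  proof (intro integral_mono Bochner_Integration.integrable_sum int assms)
    fix x
    have "(\<Sum>i\<in>I. indicator (Q i) x * h x) = (\<Sum>i\<in>I. indicator (Q i) x) * h x" by (simp only: sum_distrib_right)
    also have "(\<Sum>i\<in>I. indicator (Q i) x) = (indicator (\<Union>i\<in>I. Q i) x :: real)"
      by (rule indicator_UN_disjoint[OF assms(1,2), symmetric])
    also have "indicator (\<Union>i\<in>I. Q i) x * h x \<le> indicator R x * h x"
      using assms(3,7) by (intro mult_right_mono) (auto simp: indicator_def)
    finally show "(\<Sum>i\<in>I. indicator (Q i) x * h x) \<le> indicator R x * h x" .
  qed
  finally show ?thesis .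
qed

text \<open>The right-hand side keeps the exact remainder so that the induction closes; its
  consequence is the bound 2.\<close>

lemma sum_halves_le: "(\<Sum>k<M. if k < k1 then 0 else (1/2::real) ^ (k - k1)) \<le> (if M \<le> k1 then 0 else 2 - 2 * (1/2) ^ (M - k1))"
proof (induction M)
  case (Suc M)
  consider "Suc M \<le> k1" | "M = k1" | "k1 < M" by linarith
  then show ?case
  proof cases
    case 3
    then have e: "(1/2::real) ^ (Suc M - k1) = (1/2) ^ (M - k1) / 2" by (simp add: Suc_diff_le)
    have "(\<Sum>k<Suc M. if k < k1 then 0 else (1/2::real) ^ (k - k1))
        = (\<Sum>k<M. if k < k1 then 0 else (1/2::real) ^ (k - k1)) + (1/2) ^ (M - k1)" using 3 by simp
    moreover have "(\<Sum>k<M. if k < k1 then 0 else (1/2::real) ^ (k - k1)) \<le> 2 - 2 * (1/2) ^ (M - k1)"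
      using Suc 3 by (auto split: if_splits)
    moreover have "\<not> Suc M \<le> k1" using 3 by simp
    ultimately show ?thesis unfolding e if_not_P[OF \<open>\<not> Suc M \<le> k1\<close>] by linarith
  next
    case 1
    then have "(\<Sum>k<Suc M. if k < k1 then 0 else (1/2::real) ^ (k - k1)) = 0" by (intro sum.neutral) auto
    then show ?thesis using 1 by simp
  next
    case 2
    then have "(\<Sum>k<M. if k < k1 then 0 else (1/2::real) ^ (k - k1)) = 0" by (intro sum.neutral) auto
    then show ?thesis using 2 by simp
  qed
qed simp

text \<open>A positive mean oscillation over the top cell makes all thresholds \<open>t k\<close>
  positive. The opposite case, \<open>b\<close> almost everywhere constant there, is treated apart
  in \<open>oscillation_Lr_bound\<close>.\<close>

locale dyadic_oscillation = dyadic a L for a :: "'a::euclidean_space" and L +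
  fixes b :: "'a \<Rightarrow> real" and N :: nat
  assumes b: "in_Lp_loc 1 b"
    and osc_pos: "0 < (\<integral>x. indicator (cell 0 a) x * \<bar>b x - (\<integral>y. indicator (cell 0 a) y * b y \<partial>lebesgue) / side 0 ^ DIM('a)\<bar> \<partial>lebesgue)"
begin

definition b0 :: real where
  "b0 = (\<integral>y. indicator (cell 0 a) y * b y \<partial>lebesgue) / side 0 ^ DIM('a)"

definition u :: "'a \<Rightarrow> real" where
  "u x = \<bar>b x - b0\<bar>"

definition av :: "nat \<Rightarrow> 'a \<Rightarrow> real" where
  "av j x = (\<integral>y. indicator (cell j x) y * u y \<partial>lebesgue) / side j ^ DIM('a)"

text \<open>From one generation to the next a mean grows at most by a factor
  \<open>2 ^ DIM('a)\<close>, see \<open>av_Suc_le\<close>. The additional 2 in the ratio of the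
  thresholds makes the total volume of the selected cells decay geometrically in the level, and
  leaves half of the left side over in \<open>children_le\<close>.\<close>

definition \<theta> :: real where
  "\<theta> = 2 ^ Suc DIM('a)"

definition t :: "nat \<Rightarrow> real" where
  "t k = \<theta> ^ k * av 0 a"

text \<open>\<open>sel k j x\<close>: the dyadic cube of generation \<open>j\<close> around \<open>x\<close> is a maximal one with average above \<open>t k\<close>.
  Only generations up to \<open>N\<close> enter \<open>J\<close>, so that the energy to be absorbed is known to be finite.\<close>

definition sel :: "nat \<Rightarrow> nat \<Rightarrow> 'a \<Rightarrow> bool" where
  "sel k j x \<longleftrightarrow> (if k = 0 then j = 0 else t k < av j x \<and> (\<forall>i<j. av i x \<le> t k))"

definition J :: "(nat \<times> nat \<times> 'a set) set" where
  "J = {(k, j, Q). k \<le> DIM('a) * N \<and> j \<le> N \<and> (\<exists>x\<in>cell 0 a. Q = cell j x \<and> sel k j x)}"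

abbreviation lev :: "nat \<times> nat \<times> 'a set \<Rightarrow> nat" where "lev X \<equiv> fst X"
abbreviation gen :: "nat \<times> nat \<times> 'a set \<Rightarrow> nat" where "gen X \<equiv> fst (snd X)"
abbreviation cel :: "nat \<times> nat \<times> 'a set \<Rightarrow> 'a set" where "cel X \<equiv> snd (snd X)"

lemma \<theta>: "1 < \<theta>" "\<theta> = 2 * 2 ^ DIM('a)"
proof -
  have "(1::real) \<le> 2 ^ DIM('a)" by simp
  then show "1 < \<theta>" unfolding \<theta>_def power_Suc by linarith
qed (simp add: \<theta>_def)

lemma side_n_pos: "0 < side j ^ DIM('a)"
  using side_pos by simp

lemma int_b_diff: "S \<in> sets lebesgue \<Longrightarrow> S \<subseteq> cell 0 a \<Longrightarrow> integrable lebesgue (\<lambda>x. indicator S x * \<bar>b x - c\<bar>)"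
proof -
  assume S: "S \<in> sets lebesgue" "S \<subseteq> cell 0 a"
  define B where "B = cbox (low 0 a) (low 0 a + side 0 *\<^sub>R One)"
  have SB: "S \<subseteq> B" using S cell_subset_cbox unfolding B_def by blast
  have "integrable lebesgue (\<lambda>x. indicator B x * b x - c * indicator B x)"
    unfolding B_def by (intro Bochner_Integration.integrable_diff integrable_mult_right
        in_Lp_loc_1_integrable[OF b] integrable_indicator_compact compact_cbox)
  then have i1: "integrable lebesgue (\<lambda>x. indicator S x *\<^sub>R \<bar>indicator B x * b x - c * indicator B x\<bar>)"
    by (intro integrable_mult_indicator S integrable_abs)
  have "indicator S x *\<^sub>R \<bar>indicator B x * b x - c * indicator B x\<bar> = indicator S x * \<bar>b x - c\<bar>" for x
    using SB by (auto simp: indicator_def)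
  then show ?thesis using i1 by (simp only:)
qed

lemma cell_subset_top: "x \<in> cell 0 a \<Longrightarrow> cell j x \<subseteq> cell 0 a"
  using mem_top by blast

lemma int_u: "x \<in> cell 0 a \<Longrightarrow> integrable lebesgue (\<lambda>y. indicator (cell j x) y * u y)"
  unfolding u_def by (intro int_b_diff cell_subset_top) auto

lemma u_nonneg: "0 \<le> u x"
  by (simp add: u_def)

lemma int_u_eq: "(\<integral>y. indicator (cell j x) y * u y \<partial>lebesgue) = av j x * side j ^ DIM('a)"
  using less_imp_neq[OF side_n_pos[of j]] unfolding av_def by simp

lemma av_nonneg: "0 \<le> av j x"
  unfolding av_def using side_n_pos[of j] u_nonneg
  by (intro divide_nonneg_pos Bochner_Integration.integral_nonneg) auto

lemma av0_pos: "0 < av 0 a"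
  using osc_pos side_n_pos[of 0] unfolding av_def u_def b0_def by (intro divide_pos_pos) auto

lemma av_cong: "y \<in> cell j x \<Longrightarrow> i \<le> j \<Longrightarrow> av i y = av i x"
  unfolding av_def using cell_antimono[of i j x] cell_eq[of y i x] by (auto dest: subsetD)

lemma av_0: "x \<in> cell 0 a \<Longrightarrow> av 0 x = av 0 a"
  by (rule av_cong[of x 0 a]) auto

lemma av_Suc_le:
  assumes "x \<in> cell 0 a"
  shows "av (Suc j) x \<le> 2 ^ DIM('a) * av j x"
proof -
  have "(\<integral>y. indicator (cell (Suc j) x) y * u y \<partial>lebesgue) \<le> (\<integral>y. indicator (cell j x) y * u y \<partial>lebesgue)"
    using cell_Suc_subset[of j x] u_nonneg
    by (intro integral_mono int_u assms mult_right_mono) (auto simp: indicator_def)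
  then have "av (Suc j) x * side (Suc j) ^ DIM('a) \<le> av j x * (2 * side (Suc j)) ^ DIM('a)"
    unfolding int_u_eq side_Suc[of j] .
  then have "av (Suc j) x * side (Suc j) ^ DIM('a) \<le> (2 ^ DIM('a) * av j x) * side (Suc j) ^ DIM('a)"
    by (simp add: power_mult_distrib mult_ac)
  then show ?thesis using side_n_pos[of "Suc j"] by (rule mult_right_le_imp_le)
qed

lemma t_0: "t 0 = av 0 a" and t_Suc: "t (Suc k) = \<theta> * t k" and t_pos: "0 < t k"
  using av0_pos \<theta> by (auto simp: t_def)

lemma t_mono: "i \<le> k \<Longrightarrow> t i \<le> t k"
  unfolding t_def using av0_pos \<theta>(1) by (intro mult_right_mono power_increasing) auto

text \<open>This justifies the cap on the level in \<open>J\<close>: no mean up to generation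
  \<open>N\<close> exceeds \<open>t (DIM('a) * N)\<close>.\<close>

lemma av_le: "x \<in> cell 0 a \<Longrightarrow> av j x \<le> t (DIM('a) * j)"
proof (induction j)
  case 0
  then show ?case using av_0[OF 0] t_0 by simp
next
  case (Suc j)
  have "av (Suc j) x \<le> 2 ^ DIM('a) * t (DIM('a) * j)"
    by (rule order_trans[OF av_Suc_le[OF Suc.prems] mult_left_mono[OF Suc.IH[OF Suc.prems]]]) simp
  also have "\<dots> \<le> \<theta> * t (DIM('a) * j)" using t_pos[of "DIM('a) * j"] by (intro mult_right_mono) (auto simp: \<theta>)
  also have "\<dots> = t (Suc (DIM('a) * j))" by (simp add: t_Suc)
  also have "\<dots> \<le> t (DIM('a) * Suc j)" by (intro t_mono) (simp add: Suc_le_eq)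
  finally show ?case .
qed

lemma sel_cong: "y \<in> cell j x \<Longrightarrow> sel k j y = sel k j x"
  using av_cong[of y j x] by (simp add: sel_def)

lemma sel_lower: "x \<in> cell 0 a \<Longrightarrow> sel k j x \<Longrightarrow> t k \<le> av j x"
  using av_0[of x] by (auto simp: sel_def t_0 split: if_splits)

text \<open>The parent of a selected cell has mean at most \<open>t k\<close>, by maximality, and
  the mean of a child is at most \<open>2 ^ DIM('a)\<close> times that. At generation 0 there is no
  parent, but the mean is \<open>t 0\<close>.\<close>

lemma sel_upper:
  assumes x: "x \<in> cell 0 a" and s: "sel k j x"
  shows "av j x \<le> 2 ^ DIM('a) * t k"
proof (cases j)
  case 0
  have "av 0 x \<le> 1 * t k" using av_0[OF x] t_mono[of 0 k] by (simp add: t_0)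
  also have "\<dots> \<le> 2 ^ DIM('a) * t k" using t_pos[of k] by (intro mult_right_mono) auto
  finally show ?thesis using 0 by simp
next
  case (Suc i)
  then have "av i x \<le> t k" using s by (auto simp: sel_def split: if_splits)
  then have "2 ^ DIM('a) * av i x \<le> 2 ^ DIM('a) * t k" by (intro mult_left_mono) auto
  then show ?thesis using av_Suc_le[OF x, of i] unfolding Suc by (rule order_trans[rotated])
qed

lemma sel_unique: "sel k j x \<Longrightarrow> sel k j' x \<Longrightarrow> j = j'"
  by (rule linorder_cases[of j j']) (auto simp: sel_def split: if_splits)

lemma J_at:
  assumes "X \<in> J" "z \<in> cel X"
  shows "z \<in> cell 0 a" "cel X = cell (gen X) z" "sel (lev X) (gen X) z"
proof -
  obtain x where x: "x \<in> cell 0 a" "cel X = cell (gen X) x" "sel (lev X) (gen X) x"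
    using assms(1) by (auto simp: J_def)
  have z: "z \<in> cell (gen X) x" using assms(2) x(2) by simp
  show "z \<in> cell 0 a" using mem_top[OF z x(1)] .
  show "cel X = cell (gen X) z" using cell_eq[OF z] x(2) by simp
  show "sel (lev X) (gen X) z" using sel_cong[OF z] x(3) by simp
qed

lemma J_bounds: "X \<in> J \<Longrightarrow> lev X \<le> DIM('a) * N" "X \<in> J \<Longrightarrow> gen X \<le> N"
  by (auto simp: J_def)

lemma J_nonempty: "X \<in> J \<Longrightarrow> \<exists>z. z \<in> cel X"
proof -
  assume "X \<in> J"
  then obtain x where "cel X = cell (gen X) x" by (auto simp: J_def)
  then have "x \<in> cel X" by simp
  then show ?thesis by (rule exI)
qed

text \<open>Members of \<open>J\<close> store the cell only as a set; a point in it makes the facts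
  about \<open>cell j x\<close> applicable.\<close>

definition rep :: "nat \<times> nat \<times> 'a set \<Rightarrow> 'a" where
  "rep X = (SOME z. z \<in> cel X)"

lemma rep: "X \<in> J \<Longrightarrow> rep X \<in> cel X"
  unfolding rep_def by (rule someI_ex) (rule J_nonempty)

lemma J_rep: "X \<in> J \<Longrightarrow> rep X \<in> cell 0 a" "X \<in> J \<Longrightarrow> cel X = cell (gen X) (rep X)"
    "X \<in> J \<Longrightarrow> sel (lev X) (gen X) (rep X)"
  using J_at rep by auto

lemma cel_subset_top: "X \<in> J \<Longrightarrow> cel X \<subseteq> cell 0 a"
  using J_at(1) by blast

text \<open>Cells selected at one level and sharing a point have the same generation by
  \<open>sel_unique\<close>, and cells of one generation are equal or disjoint.\<close>

lemma J_disjoint: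
  assumes "X \<in> J" "Y \<in> J" "lev X = lev Y" "z \<in> cel X" "z \<in> cel Y"
  shows "X = Y"
proof -
  have "gen X = gen Y" using J_at(3)[OF assms(1,4)] J_at(3)[OF assms(2,5)] assms(3) sel_unique by metis
  moreover have "cel X = cel Y" using J_at(2)[OF assms(1,4)] J_at(2)[OF assms(2,5)] \<open>gen X = gen Y\<close> by simp
  ultimately show ?thesis using assms(3) by (simp add: prod_eq_iff)
qed

lemma J_disjoint_family:
  assumes "S \<subseteq> J" "\<And>X. X \<in> S \<Longrightarrow> lev X = k"
  shows "disjoint_family_on cel S"
  unfolding disjoint_family_on_def
proof (intro ballI impI)
  fix X Y assume "X \<in> S" "Y \<in> S" "X \<noteq> Y"
  then show "cel X \<inter> cel Y = {}" using J_disjoint[of X Y] assms by auto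
qed

lemma finite_J: "finite J"
proof (rule finite_subset)
  show "J \<subseteq> {..DIM('a) * N} \<times> {..N} \<times> (\<Union>j\<in>{..N}. cell j ` cell 0 a)"
    by (auto simp: J_def)
  show "finite ({..DIM('a) * N} \<times> {..N} \<times> (\<Union>j\<in>{..N}. cell j ` cell 0 a))"
    by (intro finite_cartesian_product finite_UN_I finite_cells) auto
qed

lemma J_sets: "X \<in> J \<Longrightarrow> cel X \<in> sets lebesgue"
  using J_rep(2) by (metis cell_sets)

lemma measure_cel: "X \<in> J \<Longrightarrow> measure lebesgue (cel X) = side (gen X) ^ DIM('a)"
  using J_rep(2) measure_cell by metis

lemma int_1: "integrable lebesgue (\<lambda>x. indicator (cell j z) x * (1::real))"
  using cell_lmeasurable[of j z] by (simp add: fmeasurable_def)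

lemma int_1_cel: "X \<in> J \<Longrightarrow> (\<integral>x. indicator (cel X) x * (1::real) \<partial>lebesgue) = side (gen X) ^ DIM('a)"
  using J_sets measure_cel by simp

lemma sum_side_le:
  assumes S: "S \<subseteq> J" "\<And>X. X \<in> S \<Longrightarrow> lev X = k" "\<And>X. X \<in> S \<Longrightarrow> cel X \<subseteq> cell i z"
  shows "(\<Sum>X\<in>S. side (gen X) ^ DIM('a)) \<le> side i ^ DIM('a)"
proof -
  have "(\<Sum>X\<in>S. side (gen X) ^ DIM('a)) = (\<Sum>X\<in>S. \<integral>x. indicator (cel X) x * (1::real) \<partial>lebesgue)"
    using S(1) int_1_cel by (intro sum.cong) auto
  also have "\<dots> \<le> (\<integral>x. indicator (cell i z) x * (1::real) \<partial>lebesgue)"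
    using S J_sets finite_subset[OF S(1) finite_J]
    by (intro sum_integral_disjoint_le J_disjoint_family[OF S(1,2)] int_1) auto
  also have "\<dots> = side i ^ DIM('a)" using measure_cell by simp
  finally show ?thesis .
qed

text \<open>The selected subcells of one cell are sorted by level. A nonempty level forces the mean
  over the cell to be at most \<open>2 ^ DIM('a) * t k\<close>, so levels below some
  \<open>k1\<close> are empty. Level \<open>k1\<close> is a disjoint family inside the cell. At
  every later level the volume is at most the integral over the cell divided by the threshold, which
  gives a factor at most 1/2 per level.\<close>

lemma J_carleson:
  assumes z: "z \<in> cell 0 a"
  shows "(\<Sum>X\<in>{X\<in>J. i \<le> gen X \<and> cel X \<subseteq> cell i z}. side (gen X) ^ DIM('a)) \<le> 2 * side i ^ DIM('a)"
proof -
  define T where "T = {X\<in>J. i \<le> gen X \<and> cel X \<subseteq> cell i z}"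
  define S where "S k = {X\<in>T. lev X = k}" for k
  define M where "M = Suc (DIM('a) * N)"
  have T: "finite T" unfolding T_def using finite_J by simp
  have SJ: "S k \<subseteq> J" for k by (auto simp: S_def T_def)
  have grp: "(\<Sum>X\<in>T. side (gen X) ^ DIM('a)) = (\<Sum>k<M. \<Sum>X\<in>S k. side (gen X) ^ DIM('a))"
    unfolding S_def by (rule sum.group[symmetric]) (use T J_bounds in \<open>auto simp: T_def M_def less_Suc_eq_le\<close>)
  have c: "av i z \<le> 2 ^ DIM('a) * t k" if ne: "S k \<noteq> {}" for k
  proof -
    obtain X where X: "X \<in> J" "i \<le> gen X" "cel X \<subseteq> cell i z" "lev X = k" using ne by (auto simp: S_def T_def)
    define x where "x = rep X"
    have x: "x \<in> cell 0 a" "sel k (gen X) x" "x \<in> cell i z" using J_rep[OF X(1)] rep[OF X(1)] X by (auto simp: x_def)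
    have avx: "av i x = av i z" by (rule av_cong[OF x(3)]) simp
    show ?thesis
    proof (cases "av i x \<le> t k")
      case True
      also have "t k \<le> 2 ^ DIM('a) * t k" using t_pos[of k] mult_right_mono[of 1 "2 ^ DIM('a)" "t k"] by simp
      finally show ?thesis by (simp add: avx)
    next
      case False
      \<comment> \<open>A mean above \<open>t k\<close> strictly before the selected generation
        would contradict maximality.\<close>
      have "i = gen X"
      proof (cases "k = 0")
        case True then show ?thesis using x(2) X(2) by (simp add: sel_def)
      next
        case k: False
        then show ?thesis using x(2) X(2) False by (auto simp: sel_def le_less)
      qed
      then show ?thesis using sel_upper[OF x(1,2)] avx by simp
    qed
  qed
  have bu: "t k * (\<Sum>X\<in>S k. side (gen X) ^ DIM('a)) \<le> av i z * side i ^ DIM('a)" for k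
  proof -
    have "t k * (\<Sum>X\<in>S k. side (gen X) ^ DIM('a)) \<le> (\<Sum>X\<in>S k. \<integral>x. indicator (cel X) x * u x \<partial>lebesgue)"
      unfolding sum_distrib_left
    proof (rule sum_mono)
      fix X assume "X \<in> S k"
      then have X: "X \<in> J" "lev X = k" by (auto simp: S_def T_def)
      show "t k * side (gen X) ^ DIM('a) \<le> (\<integral>x. indicator (cel X) x * u x \<partial>lebesgue)"
        unfolding J_rep(2)[OF X(1)] int_u_eq
        using sel_lower[OF J_rep(1,3)[OF X(1)]] X(2) side_n_pos by (intro mult_right_mono) (auto intro: less_imp_le)
    qed
    also have "\<dots> \<le> (\<integral>x. indicator (cell i z) x * u x \<partial>lebesgue)"
      using SJ[of k] J_sets finite_subset[OF SJ finite_J]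
      by (intro sum_integral_disjoint_le J_disjoint_family[of "S k" k] int_u z u_nonneg) (auto simp: S_def T_def)
    finally show ?thesis by (simp add: int_u_eq)
  qed
  show ?thesis
  proof (cases "\<forall>k. S k = {}")
    case True
    then show ?thesis using grp side_n_pos[of i] by (simp add: T_def)
  next
    case False
    then have ex: "\<exists>k. av i z \<le> 2 ^ DIM('a) * t k" using c by blast
    define k1 where "k1 = (LEAST k. av i z \<le> 2 ^ DIM('a) * t k)"
    have k1: "av i z \<le> 2 ^ DIM('a) * t k1" unfolding k1_def by (rule LeastI_ex[OF ex])
    have "(\<Sum>X\<in>S k. side (gen X) ^ DIM('a)) \<le> side i ^ DIM('a) * (if k < k1 then 0 else (1/2) ^ (k - k1))" for k
    proof -
      consider "k < k1" | "k = k1" | "k1 < k" by linarith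
      then show ?thesis
      proof cases
        case 1
        then have "\<not> av i z \<le> 2 ^ DIM('a) * t k" unfolding k1_def by (rule not_less_Least)
        then have "S k = {}" using c by blast
        then show ?thesis using 1 by simp
      next
        case 2
        have "(\<Sum>X\<in>S k. side (gen X) ^ DIM('a)) \<le> side i ^ DIM('a)"
          by (rule sum_side_le[OF SJ, where k = k and z = z]) (simp_all add: S_def T_def)
        with 2 show ?thesis by simp
      next
        case 3
        then obtain d where d: "k = k1 + Suc d" using less_imp_Suc_add by fastforce
        \<comment> \<open>One factor \<open>2 ^ DIM('a)\<close> pays for the overshoot of the mean
          above \<open>t k1\<close>; the remaining powers of 2 give the decay.\<close>
        have "2 ^ DIM('a) * (2::real) ^ Suc d = 2 ^ (DIM('a) + Suc d)" by (simp only: power_add)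
        also have "\<dots> \<le> 2 ^ (Suc DIM('a) * Suc d)" by (intro power_increasing) auto
        also have "\<dots> = \<theta> ^ Suc d" unfolding \<theta>_def by (simp only: power_mult)
        finally have th: "2 ^ DIM('a) * 2 ^ Suc d \<le> \<theta> ^ Suc d" .
        have tk: "t k = \<theta> ^ Suc d * t k1" unfolding t_def d by (simp add: power_add mult_ac)
        let ?\<Sigma> = "\<Sum>X\<in>S k. side (gen X) ^ DIM('a)"
        have s0: "0 \<le> ?\<Sigma>" using side_n_pos by (intro sum_nonneg) (auto intro: less_imp_le)
        have "(2 ^ DIM('a) * t k1) * (2 ^ Suc d * ?\<Sigma>) = (2 ^ DIM('a) * 2 ^ Suc d) * (t k1 * ?\<Sigma>)" by (simp only: mult_ac)
        also have "\<dots> \<le> \<theta> ^ Suc d * (t k1 * ?\<Sigma>)"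
          using th t_pos[of k1] s0 by (intro mult_right_mono) auto
        also have "\<dots> = t k * ?\<Sigma>" by (simp only: tk mult_ac)
        also have "\<dots> \<le> av i z * side i ^ DIM('a)" by (rule bu)
        also have "\<dots> \<le> (2 ^ DIM('a) * t k1) * side i ^ DIM('a)"
          using k1 side_n_pos[of i] by (intro mult_right_mono) auto
        finally have "2 ^ Suc d * ?\<Sigma> \<le> side i ^ DIM('a)" using t_pos[of k1] by simp
        then have "?\<Sigma> \<le> side i ^ DIM('a) / 2 ^ Suc d" by (simp add: pos_le_divide_eq mult.commute)
        then show ?thesis using d by (simp add: power_divide)
      qed
    qed
    then have "(\<Sum>k<M. \<Sum>X\<in>S k. side (gen X) ^ DIM('a))
        \<le> side i ^ DIM('a) * (\<Sum>k<M. if k < k1 then 0 else (1/2) ^ (k - k1))"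
      unfolding sum_distrib_left by (intro sum_mono) auto
    also have "\<dots> \<le> side i ^ DIM('a) * 2"
    proof (rule mult_left_mono)
      have "(if M \<le> k1 then 0 else 2 - 2 * (1/2::real) ^ (M - k1)) \<le> 2" by simp
      then show "(\<Sum>k<M. if k < k1 then 0 else (1/2::real) ^ (k - k1)) \<le> 2"
        using sum_halves_le[of k1 M] by linarith
    qed (use side_n_pos[of i] in simp)
    finally show ?thesis using grp by (simp add: T_def mult.commute)
  qed
qed

end

section \<open>Packing of dilated balls, and the energy\<close>

context dyadic_oscillation
begin

definition ctr :: "nat \<times> nat \<times> 'a set \<Rightarrow> 'a" where
  "ctr X = centre (gen X) (rep X)"

lemma cel_subset_cube: "X \<in> J \<Longrightarrow> cel X \<subseteq> cube (ctr X) (side (gen X))"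
  using cell_subset_cube[of "gen X" "rep X"] J_rep(2)[of X] by (simp add: ctr_def)

lemma dist_ctr_le: "X \<in> J \<Longrightarrow> z \<in> cel X \<Longrightarrow> dist (ctr X) z \<le> real DIM('a) * side (gen X)"
  using dist_centre_le[of z "gen X" "rep X"] J_rep(2)[of X] by (simp add: ctr_def)

text \<open>Dilated balls may meet although the cells are unrelated in the dyadic tree. The cells
  are grouped by their ancestor of the generation of \<open>X\<close>; these ancestors are disjoint,
  of equal volume and inside one ball, so volume bounds their number, and each group is packed by
  \<open>J_carleson\<close>.\<close>

lemma J_ball_carleson:
  assumes X: "X \<in> J" and \<kappa>: "0 \<le> \<kappa>"
  shows "(\<Sum>Y\<in>{Y\<in>J. gen X \<le> gen Y \<and> cball (ctr Y) (\<kappa> * side (gen Y)) \<inter> cball (ctr X) (\<kappa> * side (gen X)) \<noteq> {}}. side (gen Y) ^ DIM('a))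
    \<le> 2 * unit_ball_vol (real DIM('a)) * (2 * \<kappa> + 3 * real DIM('a)) ^ DIM('a) * side (gen X) ^ DIM('a)"
proof -
  define i where "i = gen X"
  define n where "n = real DIM('a)"
  define T where "T = {Y\<in>J. gen X \<le> gen Y \<and> cball (ctr Y) (\<kappa> * side (gen Y)) \<inter> cball (ctr X) (\<kappa> * side (gen X)) \<noteq> {}}"
  define h where "h Y = cell i (rep Y)" for Y
  define R where "R = h ` T"
  \<comment> \<open>Length of a path from the centre of \<open>X\<close> to a point of the ancestor
    of \<open>Y\<close>: two dilated radii through a common point of the balls, then three pieces of
    length at most \<open>n * side i\<close>.\<close>
  define \<rho> where "\<rho> = (2 * \<kappa> + 3 * n) * side i"
  define B where "B = cball (ctr X) \<rho>"
  have n: "0 \<le> n" by (simp add: n_def)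
  have \<rho>: "0 \<le> \<rho>" using \<kappa> n side_pos[of i] by (simp add: \<rho>_def)
  have T: "finite T" "T \<subseteq> J" unfolding T_def using finite_J by auto
  have R: "finite R" using T by (simp add: R_def)
  have sub: "h Y \<subseteq> B" if Y: "Y \<in> T" for Y
  proof
    fix y assume y: "y \<in> h Y"
    have YJ: "Y \<in> J" "i \<le> gen Y" using Y by (auto simp: T_def i_def)
    obtain w where w: "dist (ctr Y) w \<le> \<kappa> * side (gen Y)" "dist (ctr X) w \<le> \<kappa> * side i"
      using Y by (auto simp: T_def i_def)
    have s: "side (gen Y) \<le> side i" by (rule side_antimono[OF YJ(2)])
    have s1: "\<kappa> * side (gen Y) \<le> \<kappa> * side i" by (rule mult_left_mono[OF s \<kappa>])
    have s2: "n * side (gen Y) \<le> n * side i" by (rule mult_left_mono[OF s n])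
    have d1: "dist (ctr Y) (rep Y) \<le> n * side (gen Y)" using dist_ctr_le[OF YJ(1) rep[OF YJ(1)]] by (simp add: n_def)
    have d2: "dist (centre i (rep Y)) (rep Y) \<le> n * side i" using dist_centre_le[of "rep Y" i "rep Y"] by (simp add: n_def)
    have d3: "dist (centre i (rep Y)) y \<le> n * side i" using dist_centre_le[of y i "rep Y"] y by (simp add: n_def h_def)
    have "dist (ctr X) y \<le> dist (ctr X) w + dist (ctr Y) w + dist (ctr Y) (rep Y) + dist (centre i (rep Y)) (rep Y) + dist (centre i (rep Y)) y"
      using dist_triangle[of "ctr X" y w] dist_triangle[of w y "ctr Y"] dist_triangle[of "ctr Y" y "rep Y"]
        dist_triangle[of "rep Y" y "centre i (rep Y)"]
      unfolding dist_commute[of w "ctr Y"] dist_commute[of "rep Y" "centre i (rep Y)"] by linarith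
    also have "\<dots> \<le> \<kappa> * side i + \<kappa> * side i + n * side i + n * side i + n * side i"
      using w s1 s2 d1 d2 d3 by linarith
    also have "\<dots> = \<rho>" by (simp add: \<rho>_def algebra_simps)
    finally show "y \<in> B" by (simp add: B_def)
  qed
  have dis: "disjoint_family_on (\<lambda>Q. Q) R"
    unfolding disjoint_family_on_def R_def h_def using cell_eq by blast
  have ones: "(\<integral>x. indicator Q x * (1::real) \<partial>lebesgue) = side i ^ DIM('a)" if "Q \<in> R" for Q
    using that measure_cell by (auto simp: R_def h_def)
  have "real (card R) * side i ^ DIM('a) = (\<Sum>Q\<in>R. side i ^ DIM('a))" by simp
  also have "\<dots> = (\<Sum>Q\<in>R. \<integral>x. indicator Q x * (1::real) \<partial>lebesgue)"
    by (rule sum.cong[OF refl ones[symmetric]])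
  also have "\<dots> \<le> (\<integral>x. indicator B x * (1::real) \<partial>lebesgue)"
  proof (rule sum_integral_disjoint_le[OF R dis])
    show "Q \<subseteq> B" if "Q \<in> R" for Q using that sub by (auto simp: R_def)
    show "Q \<in> sets lebesgue" if "Q \<in> R" for Q using that by (auto simp: R_def h_def)
    show "integrable lebesgue (\<lambda>x. indicator B x * (1::real))"
      using integrable_indicator_compact[of B] by (simp add: B_def)
  qed (auto simp: B_def)
  also have "\<dots> = unit_ball_vol n * \<rho> ^ DIM('a)"
    using content_cball[OF \<rho>, of "ctr X"] by (simp add: B_def n_def)
  finally have card: "real (card R) * side i ^ DIM('a) \<le> unit_ball_vol n * (2 * \<kappa> + 3 * n) ^ DIM('a) * side i ^ DIM('a)"
    by (simp add: \<rho>_def power_mult_distrib mult.assoc)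
  have "(\<Sum>Y\<in>T. side (gen Y) ^ DIM('a)) = (\<Sum>Q\<in>R. \<Sum>Y\<in>{Y\<in>T. h Y = Q}. side (gen Y) ^ DIM('a))"
    by (rule sum.group[symmetric, OF T(1) R]) (simp add: R_def)
  also have "\<dots> \<le> (\<Sum>Q\<in>R. 2 * side i ^ DIM('a))"
  proof (rule sum_mono)
    fix Q assume "Q \<in> R"
    then obtain Y0 where Y0: "Y0 \<in> T" "Q = cell i (rep Y0)" by (auto simp: R_def h_def)
    have "(\<Sum>Y\<in>{Y\<in>T. h Y = Q}. side (gen Y) ^ DIM('a))
       \<le> (\<Sum>Y\<in>{Y\<in>J. i \<le> gen Y \<and> cel Y \<subseteq> cell i (rep Y0)}. side (gen Y) ^ DIM('a))"
    proof (rule sum_mono2)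
      show "finite {Y\<in>J. i \<le> gen Y \<and> cel Y \<subseteq> cell i (rep Y0)}" using finite_J by simp
      show "{Y\<in>T. h Y = Q} \<subseteq> {Y\<in>J. i \<le> gen Y \<and> cel Y \<subseteq> cell i (rep Y0)}"
      proof
        fix Y assume "Y \<in> {Y\<in>T. h Y = Q}"
        then have Y: "Y \<in> J" "i \<le> gen Y" "cell i (rep Y) = cell i (rep Y0)"
          using Y0 by (auto simp: T_def i_def h_def)
        have "cel Y \<subseteq> cell i (rep Y)" using J_rep(2)[OF Y(1)] cell_antimono[OF Y(2), of "rep Y"] by simp
        then show "Y \<in> {Y\<in>J. i \<le> gen Y \<and> cel Y \<subseteq> cell i (rep Y0)}" using Y by simp
      qed
    qed (use side_n_pos in \<open>auto intro: less_imp_le\<close>)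
    also have "\<dots> \<le> 2 * side i ^ DIM('a)"
      by (rule J_carleson[OF J_rep(1)[OF subsetD[OF T(2) Y0(1)]]])
    finally show "(\<Sum>Y\<in>{Y\<in>T. h Y = Q}. side (gen Y) ^ DIM('a)) \<le> 2 * side i ^ DIM('a)" .
  qed
  also have "\<dots> = 2 * (real (card R) * side i ^ DIM('a))" by simp
  also have "\<dots> \<le> 2 * (unit_ball_vol n * (2 * \<kappa> + 3 * n) ^ DIM('a) * side i ^ DIM('a))"
    using card by (intro mult_left_mono) auto
  finally show ?thesis by (simp add: T_def i_def n_def mult.assoc)
qed

text \<open>A mean above the higher threshold is above the lower one too, and the first generation
  at which the lower one is exceeded cannot be later. At level 0 the top cell does.\<close>

lemma J_parent:
  assumes X: "X \<in> J" and k: "lev X = Suc k"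
  shows "\<exists>P\<in>J. lev P = k \<and> cel X \<subseteq> cel P"
proof -
  define x where "x = rep X"
  have x: "x \<in> cell 0 a" "cel X = cell (gen X) x" "sel (Suc k) (gen X) x"
    using J_rep[OF X] k by (auto simp: x_def)
  have bnd: "k \<le> DIM('a) * N" "gen X \<le> N" using J_bounds[OF X] k by auto
  have av: "t k < av (gen X) x" using x(3) t_mono[of k "Suc k"] by (auto simp: sel_def)
  show ?thesis
  proof (cases "k = 0")
    case True
    have "(0, 0, cell 0 x) \<in> J" using x(1) by (auto simp: J_def sel_def)
    moreover have "cel X \<subseteq> cell 0 x" using x(2) cell_antimono[of 0 "gen X" x] by simp
    ultimately show ?thesis using True by (intro bexI[of _ "(0, 0, cell 0 x)"]) auto
  next
    case False
    define j where "j = (LEAST j. t k < av j x)"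
    have j: "t k < av j x" "j \<le> gen X" "\<forall>i<j. av i x \<le> t k"
      unfolding j_def using av by (auto intro: LeastI Least_le dest: not_less_Least simp: not_less)
    then have "(k, j, cell j x) \<in> J" using False x(1) bnd by (auto simp: J_def sel_def)
    moreover have "cel X \<subseteq> cell j x" using x(2) cell_antimono[OF j(2), of x] by simp
    ultimately show ?thesis by (intro bexI[of _ "(k, j, cell j x)"]) auto
  qed
qed

text \<open>The constant \<alpha> is arbitrary whereas cells are selected by \<open>b0\<close>.
  Replacing \<open>b0\<close> by \<alpha> costs |\<alpha> - b0| times the volume of the children,
  and |\<alpha> - b0| is at most the mean of |b - \<alpha>| over \<open>P\<close> plus that of
  \<open>u\<close>, which is at most \<open>2 ^ DIM('a) * t k\<close>. As \<open>t (Suc k)\<close>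
  is twice this, half of the left side survives.\<close>

lemma children_le:
  assumes P: "P \<in> J" "lev P = k" and S: "S \<subseteq> J" "\<And>X. X \<in> S \<Longrightarrow> lev X = Suc k" "\<And>X. X \<in> S \<Longrightarrow> cel X \<subseteq> cel P"
  shows "t (Suc k) * (\<Sum>X\<in>S. side (gen X) ^ DIM('a)) \<le> 4 * (\<integral>x. indicator (cel P) x * \<bar>b x - \<alpha>\<bar> \<partial>lebesgue)"
proof -
  let ?n = "DIM('a)"
  let ?I = "\<integral>x. indicator (cel P) x * \<bar>b x - \<alpha>\<bar> \<partial>lebesgue"
  define M where "M = (\<Sum>X\<in>S. side (gen X) ^ ?n)"
  define s where "s = side (gen P) ^ ?n"
  have s: "0 < s" unfolding s_def by (rule side_n_pos)
  have fS: "finite S" using S(1) finite_J by (rule finite_subset)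
  have "0 \<le> M" unfolding M_def by (intro sum_nonneg less_imp_le side_n_pos)
  moreover have "M \<le> s" unfolding M_def s_def
    by (rule sum_side_le[OF S(1,2), where i = "gen P" and z = "rep P"])
      (use S(3) J_rep(2)[OF P(1)] in simp_all)
  ultimately have M: "0 \<le> M" "M \<le> s" .
  have iP: "integrable lebesgue (\<lambda>x. indicator (cel P) x * \<bar>b x - c\<bar>)" for c
    using J_sets[OF P(1)] cel_subset_top[OF P(1)] by (rule int_b_diff)
  have iX: "integrable lebesgue (\<lambda>x. indicator (cel X) x * \<bar>b x - c\<bar>)" if "X \<in> S" for c X
    by (rule int_b_diff[OF J_sets cel_subset_top]) (rule subsetD[OF S(1) that])+
  have ind: "integrable lebesgue (\<lambda>x. indicator (cel X) x * c)" if "X \<in> J" for X and c :: real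
    using int_1[of "gen X" "rep X"] J_rep(2)[OF that] by simp
  have ind': "(\<integral>x. indicator (cel X) x * c \<partial>lebesgue) = c * side (gen X) ^ ?n" if "X \<in> J" for X and c :: real
    using int_1_cel[OF that] by simp
  have I0: "0 \<le> ?I" by (intro Bochner_Integration.integral_nonneg) auto
  have "t (Suc k) * M \<le> (\<Sum>X\<in>S. \<integral>x. indicator (cel X) x * u x \<partial>lebesgue)"
    unfolding M_def sum_distrib_left
  proof (rule sum_mono)
    fix X assume "X \<in> S"
    then have X: "X \<in> J" "lev X = Suc k" by (rule subsetD[OF S(1)], rule S(2))
    show "t (Suc k) * side (gen X) ^ ?n \<le> (\<integral>x. indicator (cel X) x * u x \<partial>lebesgue)"
      unfolding J_rep(2)[OF X(1)] int_u_eq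
      using sel_lower[OF J_rep(1,3)[OF X(1)]] X(2) side_n_pos[of "gen X"] by (intro mult_right_mono) auto
  qed
  also have "\<dots> \<le> (\<Sum>X\<in>S. (\<integral>x. indicator (cel X) x * \<bar>b x - \<alpha>\<bar> \<partial>lebesgue) + \<bar>\<alpha> - b0\<bar> * side (gen X) ^ ?n)"
  proof (rule sum_mono)
    fix X assume X: "X \<in> S"
    then have XJ: "X \<in> J" by (rule subsetD[OF S(1)])
    have "(\<integral>x. indicator (cel X) x * u x \<partial>lebesgue) \<le> (\<integral>x. indicator (cel X) x * \<bar>b x - \<alpha>\<bar> + indicator (cel X) x * \<bar>\<alpha> - b0\<bar> \<partial>lebesgue)"
      unfolding u_def by (intro integral_mono Bochner_Integration.integrable_add iX[OF X] ind[OF XJ]) (auto simp: indicator_def)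
    also have "\<dots> = (\<integral>x. indicator (cel X) x * \<bar>b x - \<alpha>\<bar> \<partial>lebesgue) + \<bar>\<alpha> - b0\<bar> * side (gen X) ^ ?n"
      by (subst Bochner_Integration.integral_add[OF iX[OF X] ind[OF XJ]]) (simp only: ind'[OF XJ])
    finally show "(\<integral>x. indicator (cel X) x * u x \<partial>lebesgue) \<le> (\<integral>x. indicator (cel X) x * \<bar>b x - \<alpha>\<bar> \<partial>lebesgue) + \<bar>\<alpha> - b0\<bar> * side (gen X) ^ ?n" .
  qed
  also have "\<dots> = (\<Sum>X\<in>S. \<integral>x. indicator (cel X) x * \<bar>b x - \<alpha>\<bar> \<partial>lebesgue) + \<bar>\<alpha> - b0\<bar> * M"
    by (simp only: sum.distrib M_def sum_distrib_left)
  also have "(\<Sum>X\<in>S. \<integral>x. indicator (cel X) x * \<bar>b x - \<alpha>\<bar> \<partial>lebesgue) \<le> ?I"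
  proof (rule sum_integral_disjoint_le[OF fS J_disjoint_family[OF S(1,2)]])
    show "cel X \<subseteq> cel P" if "X \<in> S" for X by (rule S(3)[OF that])
    show "cel X \<in> sets lebesgue" if "X \<in> S" for X by (rule J_sets[OF subsetD[OF S(1) that]])
  qed (simp_all add: iP J_sets[OF P(1)])
  finally have 1: "t (Suc k) * M \<le> ?I + \<bar>\<alpha> - b0\<bar> * M" by simp
  have "\<bar>\<alpha> - b0\<bar> * s = (\<integral>x. indicator (cel P) x * \<bar>\<alpha> - b0\<bar> \<partial>lebesgue)" unfolding ind'[OF P(1)] s_def ..
  also have "\<dots> \<le> (\<integral>x. indicator (cel P) x * \<bar>b x - \<alpha>\<bar> + indicator (cel P) x * \<bar>b x - b0\<bar> \<partial>lebesgue)"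
    by (intro integral_mono Bochner_Integration.integrable_add iP ind[OF P(1)]) (auto simp: indicator_def)
  also have "\<dots> = ?I + (\<integral>x. indicator (cel P) x * u x \<partial>lebesgue)"
    unfolding u_def by (rule Bochner_Integration.integral_add[OF iP iP])
  also have "(\<integral>x. indicator (cel P) x * u x \<partial>lebesgue) = av (gen P) (rep P) * s"
    unfolding s_def J_rep(2)[OF P(1)] int_u_eq ..
  also have "av (gen P) (rep P) * s \<le> (2 ^ ?n * t k) * s"
    using sel_upper[OF J_rep(1,3)[OF P(1)]] P(2) s by (intro mult_right_mono) auto
  finally have 2: "\<bar>\<alpha> - b0\<bar> * s \<le> ?I + (2 ^ ?n * t k) * s" by simp
  \<comment> \<open>The volume \<open>M\<close> of the children may be enlarged to that of
    \<open>P\<close> only behind a nonnegative coefficient.\<close>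
  have "(\<bar>\<alpha> - b0\<bar> - 2 ^ ?n * t k) * M \<le> ?I"
  proof (cases "\<bar>\<alpha> - b0\<bar> - 2 ^ ?n * t k \<le> 0")
    case True
    then have "(\<bar>\<alpha> - b0\<bar> - 2 ^ ?n * t k) * M \<le> 0" using M by (intro mult_nonpos_nonneg) auto
    then show ?thesis using I0 by linarith
  next
    case False
    then have "(\<bar>\<alpha> - b0\<bar> - 2 ^ ?n * t k) * M \<le> (\<bar>\<alpha> - b0\<bar> - 2 ^ ?n * t k) * s"
      using M by (intro mult_left_mono) auto
    also have "\<dots> \<le> ?I" using 2 unfolding left_diff_distrib by linarith
    finally show ?thesis .
  qed
  then have "\<bar>\<alpha> - b0\<bar> * M \<le> ?I + 2 ^ ?n * t k * M" unfolding left_diff_distrib by linarith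
  moreover have "t (Suc k) * M = 2 * (2 ^ ?n * t k * M)" by (simp add: t_Suc \<theta>(2))
  ultimately show ?thesis using 1 unfolding M_def by linarith
qed

lemma top_mem_J: "(0, 0, cell 0 a) \<in> J"
  using mem_cell[of a 0] by (auto simp: J_def sel_def)

lemma top_only: "X \<in> J \<Longrightarrow> lev X = 0 \<Longrightarrow> X = (0, 0, cell 0 a)"
  using J_disjoint[OF _ top_mem_J, of X "rep X"] rep[of X] cel_subset_top[of X] by auto

text \<open>Since \<open>b0\<close> is the mean, |b0 - \<alpha>| times the volume is at most the
  integral of |b - \<alpha>|; no constant beats the mean by more than a factor 2.\<close>

lemma top_le: "t 0 * side 0 ^ DIM('a) \<le> 2 * (\<integral>x. indicator (cell 0 a) x * \<bar>b x - \<alpha>\<bar> \<partial>lebesgue)"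
proof -
  let ?I = "\<integral>x. indicator (cell 0 a) x * \<bar>b x - \<alpha>\<bar> \<partial>lebesgue"
  define s where "s = side 0 ^ DIM('a)"
  have s: "0 < s" unfolding s_def by (rule side_n_pos)
  have iP: "integrable lebesgue (\<lambda>x. indicator (cell 0 a) x * \<bar>b x - c\<bar>)" for c
    by (rule int_b_diff) auto
  have ic: "integrable lebesgue (\<lambda>x. indicator (cell 0 a) x * c)" for c :: real using int_1[of 0 a] by simp
  have ic': "(\<integral>x. indicator (cell 0 a) x * c \<partial>lebesgue) = c * s" for c :: real
    using measure_cell[of 0 a] by (simp add: s_def)
  have ib: "integrable lebesgue (\<lambda>x. indicator (cell 0 a) x * b x)"
  proof (rule Bochner_Integration.integrable_bound[OF iP[of 0]])
    show "(\<lambda>x. indicator (cell 0 a) x * b x) \<in> borel_measurable lebesgue"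
      using b by (intro borel_measurable_times borel_measurable_indicator cell_sets) (simp add: in_Lp_loc_def)
  qed (auto simp: abs_mult)
  have "(b0 - \<alpha>) * s = (\<integral>x. indicator (cell 0 a) x * b x \<partial>lebesgue) - (\<integral>x. indicator (cell 0 a) x * \<alpha> \<partial>lebesgue)"
    unfolding ic' using side_pos[of 0] by (simp add: b0_def s_def left_diff_distrib)
  also have "\<dots> = (\<integral>x. indicator (cell 0 a) x * (b x - \<alpha>) \<partial>lebesgue)"
    unfolding right_diff_distrib by (rule Bochner_Integration.integral_diff[symmetric, OF ib ic])
  finally have "\<bar>b0 - \<alpha>\<bar> * s = \<bar>\<integral>x. indicator (cell 0 a) x * (b x - \<alpha>) \<partial>lebesgue\<bar>"
    using s by (metis abs_mult abs_of_pos)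
  also have "\<dots> \<le> ?I"
    using integral_abs_bound[of lebesgue "\<lambda>x. indicator (cell 0 a) x * (b x - \<alpha>)"] by (simp add: abs_mult)
  finally have 1: "\<bar>b0 - \<alpha>\<bar> * s \<le> ?I" .
  have "t 0 * s = (\<integral>x. indicator (cell 0 a) x * u x \<partial>lebesgue)"
    unfolding int_u_eq t_0 s_def ..
  also have "\<dots> \<le> (\<integral>x. indicator (cell 0 a) x * \<bar>b x - \<alpha>\<bar> + indicator (cell 0 a) x * \<bar>b0 - \<alpha>\<bar> \<partial>lebesgue)"
    unfolding u_def by (intro integral_mono Bochner_Integration.integrable_add iP ic) (auto simp: indicator_def)
  also have "\<dots> = ?I + \<bar>b0 - \<alpha>\<bar> * s"
    unfolding Bochner_Integration.integral_add[OF iP ic] ic' ..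
  finally show ?thesis using 1 unfolding s_def by linarith
qed

definition energy :: "real \<Rightarrow> real" where
  "energy r = (\<Sum>X\<in>J. t (lev X) powr r * side (gen X) ^ DIM('a))"

lemma energy_pos: "0 < energy r"
proof -
  have pos: "0 < t (lev X) powr r * side (gen X) ^ DIM('a)" for X
    using t_pos[of "lev X"] side_n_pos[of "gen X"] by (intro mult_pos_pos) auto
  then show ?thesis
    unfolding energy_def by (intro sum_pos2[OF finite_J top_mem_J] pos less_imp_le[OF pos])
qed

text \<open>Every selected cell except the top one is charged to a cell of the preceding level that
  contains it. The charges to one cell are controlled by \<open>children_le\<close> with constant 4,
  the top cell by \<open>top_le\<close> with constant 2, whence the 6.\<close>

lemma energy_le:
  assumes r: "1 < r"
  shows "energy r \<le> 6 * \<theta> powr (r - 1) * (\<Sum>X\<in>J. t (lev X) powr (r - 1) * (\<integral>x. indicator (cel X) x * \<bar>b x - \<alpha> X\<bar> \<partial>lebesgue))"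
proof -
  let ?n = "DIM('a)"
  define I where "I X = (\<integral>x. indicator (cel X) x * \<bar>b x - \<alpha> X\<bar> \<partial>lebesgue)" for X
  define W where "W = (\<Sum>X\<in>J. t (lev X) powr (r - 1) * I X)"
  have I0: "0 \<le> I X" for X unfolding I_def by (intro Bochner_Integration.integral_nonneg) auto
  have \<theta>1: "1 \<le> \<theta> powr (r - 1)" using \<theta>(1) r by (simp add: ge_one_powr_ge_zero)
  have pw: "t k powr r = t k powr (r - 1) * t k" for k
    using t_pos[of k] powr_add[of "t k" "r - 1" 1] by (simp add: powr_one_gt_zero_iff less_imp_le)
  define J1 where "J1 = {X\<in>J. lev X \<noteq> 0}"
  have J1: "finite J1" using finite_J by (simp add: J1_def)
  have "X \<in> insert (0, 0, cell 0 a) J1" if "X \<in> J" for X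
    using top_only[OF that] that by (cases "lev X = 0") (simp_all add: J1_def)
  moreover have "J1 \<subseteq> J" unfolding J1_def by blast
  ultimately have J: "J = insert (0, 0, cell 0 a) J1" using top_mem_J by blast
  have J0: "(0, 0, cell 0 a) \<notin> J1" by (simp add: J1_def)
  have "\<forall>X\<in>J1. \<exists>P. P \<in> J \<and> lev X = Suc (lev P) \<and> cel X \<subseteq> cel P"
  proof
    fix X assume "X \<in> J1"
    then have X: "X \<in> J" "lev X = Suc (lev X - 1)" by (simp_all add: J1_def)
    from J_parent[OF this] obtain P where "P \<in> J" "lev P = lev X - 1" "cel X \<subseteq> cel P" by blast
    then show "\<exists>P. P \<in> J \<and> lev X = Suc (lev P) \<and> cel X \<subseteq> cel P"
      using X(2) by (intro exI[of _ P]) simp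
  qed
  from bchoice[OF this] obtain par where par: "\<forall>X\<in>J1. par X \<in> J \<and> lev X = Suc (lev (par X)) \<and> cel X \<subseteq> cel (par X)" ..
  have "(\<Sum>X\<in>J1. t (lev X) powr r * side (gen X) ^ ?n) = (\<Sum>P\<in>J. \<Sum>X\<in>{X\<in>J1. par X = P}. t (lev X) powr r * side (gen X) ^ ?n)"
    by (rule sum.group[symmetric, OF J1 finite_J]) (use par in blast)
  also have "\<dots> \<le> (\<Sum>P\<in>J. 4 * \<theta> powr (r - 1) * (t (lev P) powr (r - 1) * I P))"
  proof (rule sum_mono)
    fix P assume P: "P \<in> J"
    define S where "S = {X\<in>J1. par X = P}"
    have S: "S \<subseteq> J" "\<And>X. X \<in> S \<Longrightarrow> lev X = Suc (lev P)" "\<And>X. X \<in> S \<Longrightarrow> cel X \<subseteq> cel P"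
    proof -
      have "X \<in> J1 \<and> par X = P" if "X \<in> S" for X using that by (simp add: S_def)
      then have "lev X = Suc (lev P) \<and> cel X \<subseteq> cel P" if "X \<in> S" for X using that par by metis
      then show "\<And>X. X \<in> S \<Longrightarrow> lev X = Suc (lev P)" "\<And>X. X \<in> S \<Longrightarrow> cel X \<subseteq> cel P" by blast+
      show "S \<subseteq> J" unfolding S_def J1_def by blast
    qed
    have "(\<Sum>X\<in>S. t (lev X) powr r * side (gen X) ^ ?n) = t (Suc (lev P)) powr r * (\<Sum>X\<in>S. side (gen X) ^ ?n)"
      using S(2) by (simp add: sum_distrib_left)
    also have "\<dots> = t (Suc (lev P)) powr (r - 1) * (t (Suc (lev P)) * (\<Sum>X\<in>S. side (gen X) ^ ?n))"
      by (simp add: pw mult.assoc)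
    also have "\<dots> \<le> t (Suc (lev P)) powr (r - 1) * (4 * I P)"
      unfolding I_def using children_le[OF P refl S] by (intro mult_left_mono) auto
    also have "t (Suc (lev P)) powr (r - 1) = \<theta> powr (r - 1) * t (lev P) powr (r - 1)"
      by (simp add: t_Suc powr_mult)
    finally show "(\<Sum>X\<in>{X\<in>J1. par X = P}. t (lev X) powr r * side (gen X) ^ ?n)
        \<le> 4 * \<theta> powr (r - 1) * (t (lev P) powr (r - 1) * I P)"
      by (simp add: S_def mult_ac)
  qed
  also have "\<dots> = 4 * \<theta> powr (r - 1) * W" by (simp only: W_def sum_distrib_left)
  finally have 1: "(\<Sum>X\<in>J1. t (lev X) powr r * side (gen X) ^ ?n) \<le> 4 * \<theta> powr (r - 1) * W" .
  have W0: "0 \<le> W" unfolding W_def using I0 by (intro sum_nonneg mult_nonneg_nonneg) auto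
  have "t 0 powr r * side 0 ^ ?n = t 0 powr (r - 1) * (t 0 * side 0 ^ ?n)" by (simp add: pw)
  also have "\<dots> \<le> t 0 powr (r - 1) * (2 * I (0, 0, cell 0 a))"
    using top_le[of "\<alpha> (0, 0, cell 0 a)"] by (intro mult_left_mono) (auto simp: I_def)
  also have "\<dots> = 2 * (t (lev (0, 0, cell 0 a)) powr (r - 1) * I (0, 0, cell 0 a))" by simp
  also have "\<dots> \<le> 2 * W"
    unfolding W_def using I0 finite_J top_mem_J
    by (intro mult_left_mono member_le_sum[of "(0, 0, cell 0 a)" J "\<lambda>X. t (lev X) powr (r - 1) * I X"]) auto
  also have "\<dots> \<le> 2 * (\<theta> powr (r - 1) * W)" using mult_right_mono[OF \<theta>1 W0] by simp
  finally have 2: "t 0 powr r * side 0 ^ ?n \<le> 2 * (\<theta> powr (r - 1) * W)" .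
  have "energy r = t 0 powr r * side 0 ^ ?n + (\<Sum>X\<in>J1. t (lev X) powr r * side (gen X) ^ ?n)"
    unfolding energy_def by (subst J, subst sum.insert[OF J1 J0]) simp
  then have "energy r \<le> 6 * (\<theta> powr (r - 1) * W)" using 1 2 by linarith
  then show ?thesis by (simp add: W_def I_def mult.assoc)
qed

text \<open>Let \<open>k\<close> be the largest level selected at \<open>x\<close> up to generation
  \<open>N\<close>. A mean above \<open>t (Suc k)\<close> would make the first generation with this
  property selected at level \<open>Suc k\<close>; beyond the cap on levels it is excluded by
  \<open>av_le\<close>. So the mean is at most \<theta> times a threshold that occurs in the
  sum.\<close>

lemma av_powr_le:
  assumes x: "x \<in> cell 0 a" and r: "1 < r"
  shows "av N x powr r \<le> (\<Sum>X\<in>J. \<theta> powr r * t (lev X) powr r * indicator (cel X) x)"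
proof -
  define Kx where "Kx = {k. k \<le> DIM('a) * N \<and> (\<exists>j\<le>N. sel k j x)}"
  have K: "finite Kx" "0 \<in> Kx" by (auto simp: Kx_def sel_def)
  define k where "k = Max Kx"
  have k: "k \<in> Kx" unfolding k_def using K by (intro Max_in) auto
  then obtain j where j: "j \<le> N" "sel k j x" "k \<le> DIM('a) * N" by (auto simp: Kx_def)
  have XJ: "(k, j, cell j x) \<in> J" using x j by (auto simp: J_def)
  have "av N x \<le> t (Suc k)"
  proof (rule ccontr)
    assume n: "\<not> av N x \<le> t (Suc k)"
    show False
    proof (cases "Suc k \<le> DIM('a) * N")
      case True
      define i where "i = (LEAST i. t (Suc k) < av i x)"
      have i: "t (Suc k) < av i x" "i \<le> N" "\<forall>l<i. av l x \<le> t (Suc k)"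
        unfolding i_def using n by (auto intro: LeastI Least_le dest: not_less_Least simp: not_less not_le)
      then have "Suc k \<in> Kx" using True by (auto simp: Kx_def sel_def)
      then have "Suc k \<le> k" unfolding k_def using K by (intro Max_ge) auto
      then show False by simp
    next
      case False
      then have "k = DIM('a) * N" using j(3) by simp
      then show False using n av_le[OF x, of N] t_mono[of k "Suc k"] by simp
    qed
  qed
  then have "av N x powr r \<le> (\<theta> * t k) powr r"
    using av_nonneg r by (intro powr_mono2) (auto simp: t_Suc)
  also have "\<dots> = \<theta> powr r * t (lev (k, j, cell j x)) powr r * indicator (cel (k, j, cell j x)) x"
    by (simp add: powr_mult)
  also have "\<dots> \<le> (\<Sum>X\<in>J. \<theta> powr r * t (lev X) powr r * indicator (cel X) x)"
    by (rule member_le_sum[OF XJ _ finite_J]) auto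
  finally show ?thesis .
qed

lemma integral_av_powr_le:
  assumes r: "1 < r" and m: "(\<lambda>x. indicator (cell 0 a) x * av N x powr r) \<in> borel_measurable lebesgue"
  shows "integrable lebesgue (\<lambda>x. indicator (cell 0 a) x * av N x powr r)"
    "(\<integral>x. indicator (cell 0 a) x * av N x powr r \<partial>lebesgue) \<le> \<theta> powr r * energy r"
proof -
  let ?S = "\<lambda>x. \<Sum>X\<in>J. \<theta> powr r * t (lev X) powr r * indicator (cel X) x"
  have i1: "integrable lebesgue (\<lambda>x. \<theta> powr r * t (lev X) powr r * indicator (cel X) x)" if "X \<in> J" for X
    using int_1[of "gen X" "rep X"] J_rep(2)[OF that] by (intro integrable_mult_right) simp
  have iS: "integrable lebesgue ?S" by (rule Bochner_Integration.integrable_sum[OF i1])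
  have S0: "0 \<le> ?S x" for x by (intro sum_nonneg) auto
  have le: "indicator (cell 0 a) x * av N x powr r \<le> ?S x" for x
    using av_powr_le[OF _ r, of x] S0[of x] by (auto simp: indicator_def)
  show int: "integrable lebesgue (\<lambda>x. indicator (cell 0 a) x * av N x powr r)"
  proof (rule Bochner_Integration.integrable_bound[OF iS])
    show "(\<lambda>x. indicator (cell 0 a) x * av N x powr r) \<in> borel_measurable lebesgue" by (rule m)
    show "AE x in lebesgue. norm (indicator (cell 0 a) x * av N x powr r) \<le> norm (?S x)"
    proof (rule AE_I2)
      fix x show "norm (indicator (cell 0 a) x * av N x powr r) \<le> norm (?S x)"
        using le[of x] S0[of x] by (simp add: abs_mult)
    qed
  qed
  have "(\<integral>x. indicator (cell 0 a) x * av N x powr r \<partial>lebesgue) \<le> (\<integral>x. ?S x \<partial>lebesgue)"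
    by (intro integral_mono int iS le)
  also have "\<dots> = (\<Sum>X\<in>J. \<integral>x. \<theta> powr r * t (lev X) powr r * indicator (cel X) x \<partial>lebesgue)"
    by (rule Bochner_Integration.integral_sum[OF i1])
  also have "\<dots> = (\<Sum>X\<in>J. \<theta> powr r * (t (lev X) powr r * side (gen X) ^ DIM('a)))"
    using J_sets measure_cel by (intro sum.cong) (auto simp: mult.assoc)
  also have "\<dots> = \<theta> powr r * energy r" by (simp only: energy_def sum_distrib_left)
  finally show "(\<integral>x. indicator (cell 0 a) x * av N x powr r \<partial>lebesgue) \<le> \<theta> powr r * energy r" .
qed

end

section \<open>Convergence of dyadic means\<close>

text \<open>Truncation comes first, so that continuous functions converging almost everywhere to the
  truncated function can be clamped to its range; dominated convergence then applies in both
  steps.\<close>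

lemma continuous_L1_approx:
  fixes h :: "'a::euclidean_space \<Rightarrow> real"
  assumes h: "h \<in> borel_measurable lebesgue" "\<And>x. 0 \<le> h x" and B: "compact B"
    and int: "integrable lebesgue (\<lambda>x. indicator B x * h x)" and e: "0 < e"
  obtains g where "continuous_on UNIV g" "(\<integral>x. indicator B x * \<bar>h x - g x\<bar> \<partial>lebesgue) < e"
proof -
  have Bm: "(indicator B :: 'a \<Rightarrow> real) \<in> borel_measurable lebesgue"
    by (intro borel_measurable_indicator sets_lebesgue_compact B)
  have iB: "integrable lebesgue (indicator B :: 'a \<Rightarrow> real)" by (rule integrable_indicator_compact[OF B])
  have "(\<lambda>n. \<integral>x. indicator B x * \<bar>h x - min (h x) (real n)\<bar> \<partial>lebesgue) \<longlonglongrightarrow> integral\<^sup>L lebesgue (\<lambda>x::'a. 0)"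
  proof (rule integral_dominated_convergence[where w = "\<lambda>x. indicator B x * h x"])
    show "AE x in lebesgue. (\<lambda>n. indicator B x * \<bar>h x - min (h x) (real n)\<bar>) \<longlonglongrightarrow> 0"
    proof (rule AE_I2, rule tendsto_eventually)
      fix x
      obtain n0 :: nat where "h x \<le> real n0" using real_arch_simple by blast
      then show "\<forall>\<^sub>F n in sequentially. indicator B x * \<bar>h x - min (h x) (real n)\<bar> = 0"
        by (intro eventually_sequentiallyI[of n0]) auto
    qed
    show "AE x in lebesgue. norm (indicator B x * \<bar>h x - min (h x) (real n)\<bar>) \<le> indicator B x * h x" for n
      using h(2) by (intro AE_I2) (auto simp: indicator_def min_def)
  qed (use h Bm int in auto)
  then have "\<forall>\<^sub>F n in sequentially. (\<integral>x. indicator B x * \<bar>h x - min (h x) (real n)\<bar> \<partial>lebesgue) < e / 2"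
    using e by (intro order_tendstoD(2)) auto
  then obtain n where n: "(\<integral>x. indicator B x * \<bar>h x - min (h x) (real n)\<bar> \<partial>lebesgue) < e / 2"
    by (auto simp: eventually_sequentially)
  define v where "v x = min (h x) (real n)" for x
  have v: "v \<in> borel_measurable lebesgue" "\<And>x. 0 \<le> v x" "\<And>x. v x \<le> real n"
    unfolding v_def using h by auto
  obtain Z g where Z: "negligible Z" and g: "\<And>k. continuous_on UNIV (g k)"
    and lim: "\<And>x. x \<notin> Z \<Longrightarrow> (\<lambda>k. g k x) \<longlonglongrightarrow> v x"
    using lebesgue_measurable_imp_measurable_on_nnreal_UNIV[OF v(1,2)] unfolding measurable_on_def by auto
  define w where "w k x = max 0 (min (g k x) (real n))" for k :: nat and x
  have w: "continuous_on UNIV (w k)" for k unfolding w_def using g by (intro continuous_intros)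
  have wn: "0 \<le> w k x" "w k x \<le> real n" for k x by (auto simp: w_def)
  have wm: "w k \<in> borel_measurable lebesgue" for k by (rule borel_measurable_lebesgue_continuous[OF w])
  have "(\<lambda>k. \<integral>x. indicator B x * \<bar>v x - w k x\<bar> \<partial>lebesgue) \<longlonglongrightarrow> integral\<^sup>L lebesgue (\<lambda>x::'a. 0)"
  proof (rule integral_dominated_convergence[where w = "\<lambda>x. 2 * real n * indicator B x"])
    show "AE x in lebesgue. (\<lambda>k. indicator B x * \<bar>v x - w k x\<bar>) \<longlonglongrightarrow> 0"
    proof (rule AE_I')
      show "Z \<in> null_sets lebesgue" using Z by (simp add: negligible_iff_null_sets)
      show "{x \<in> space lebesgue. \<not> (\<lambda>k. indicator B x * \<bar>v x - w k x\<bar>) \<longlonglongrightarrow> 0} \<subseteq> Z"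
      proof (rule ccontr)
        assume "\<not> ?thesis"
        then obtain x where x: "x \<notin> Z" "\<not> (\<lambda>k. indicator B x * \<bar>v x - w k x\<bar>) \<longlonglongrightarrow> 0" by auto
        have "(\<lambda>k. w k x) \<longlonglongrightarrow> max 0 (min (v x) (real n))"
          unfolding w_def by (intro tendsto_intros lim x)
        then have "(\<lambda>k. w k x) \<longlonglongrightarrow> v x" using v(2,3)[of x] by simp
        then have "(\<lambda>k. indicator B x * \<bar>v x - w k x\<bar>) \<longlonglongrightarrow> indicator B x * \<bar>v x - v x\<bar>"
          by (intro tendsto_intros)
        with x(2) show False by simp
      qed
    qed
    show "AE x in lebesgue. norm (indicator B x * \<bar>v x - w k x\<bar>) \<le> 2 * real n * indicator B x" for k
    proof (rule AE_I2)
      fix x show "norm (indicator B x * \<bar>v x - w k x\<bar>) \<le> 2 * real n * indicator B x"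
        using v(2,3)[of x] wn[of k x] by (auto simp: indicator_def)
    qed
  qed (use v(1) wm Bm iB in auto)
  then have "\<forall>\<^sub>F k in sequentially. (\<integral>x. indicator B x * \<bar>v x - w k x\<bar> \<partial>lebesgue) < e / 2"
    using e by (intro order_tendstoD(2)) auto
  then obtain k where k: "(\<integral>x. indicator B x * \<bar>v x - w k x\<bar> \<partial>lebesgue) < e / 2"
    by (auto simp: eventually_sequentially)
  have i1: "integrable lebesgue (\<lambda>x. indicator B x * \<bar>h x - v x\<bar>)"
  proof (rule Bochner_Integration.integrable_bound[OF int])
    show "AE x in lebesgue. norm (indicator B x * \<bar>h x - v x\<bar>) \<le> norm (indicator B x * h x)"
      using h(2) by (intro AE_I2) (auto simp: indicator_def v_def min_def)
  qed (use h v Bm in auto)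
  have i2: "integrable lebesgue (\<lambda>x. indicator B x * \<bar>v x - w k x\<bar>)"
  proof (rule Bochner_Integration.integrable_bound)
    show "integrable lebesgue (\<lambda>x. 2 * real n * indicator B x)" using iB by simp
    show "AE x in lebesgue. norm (indicator B x * \<bar>v x - w k x\<bar>) \<le> norm (2 * real n * indicator B x :: real)"
    proof (rule AE_I2)
      fix x show "norm (indicator B x * \<bar>v x - w k x\<bar>) \<le> norm (2 * real n * indicator B x :: real)"
        using v(2,3)[of x] wn[of k x] by (auto simp: indicator_def)
    qed
  qed (use v wm Bm in auto)
  have i3: "integrable lebesgue (\<lambda>x. indicator B x * \<bar>h x - w k x\<bar>)"
  proof (rule Bochner_Integration.integrable_bound[OF Bochner_Integration.integrable_add[OF i1 i2]])
    show "AE x in lebesgue. norm (indicator B x * \<bar>h x - w k x\<bar>)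
        \<le> norm (indicator B x * \<bar>h x - v x\<bar> + indicator B x * \<bar>v x - w k x\<bar>)"
      by (intro AE_I2) (auto simp: indicator_def)
  qed (use h wm Bm in auto)
  have "(\<integral>x. indicator B x * \<bar>h x - w k x\<bar> \<partial>lebesgue)
      \<le> (\<integral>x. indicator B x * \<bar>h x - v x\<bar> + indicator B x * \<bar>v x - w k x\<bar> \<partial>lebesgue)"
    by (intro integral_mono i3 Bochner_Integration.integrable_add i1 i2) (auto simp: indicator_def)
  also have "\<dots> = (\<integral>x. indicator B x * \<bar>h x - v x\<bar> \<partial>lebesgue) + (\<integral>x. indicator B x * \<bar>v x - w k x\<bar> \<partial>lebesgue)"
    by (rule Bochner_Integration.integral_add[OF i1 i2])
  also have "\<dots> < e" using n k unfolding v_def by linarith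
  finally show ?thesis using that[of "w k"] w by blast
qed

section \<open>Cellwise constant functions and dyadic means\<close>

context dyadic
begin

text \<open>On the top cell such a function is a finite combination of indicators, the chosen points
  only reading off the values. Measurability and the value of the integral follow at once.\<close>

lemma cellwise_eq:
  fixes \<psi> :: "'a \<Rightarrow> real"
  assumes "\<And>x y. y \<in> cell j x \<Longrightarrow> \<psi> y = \<psi> x"
  shows "indicator (cell 0 a) x * \<psi> x = (\<Sum>Q\<in>cell j ` cell 0 a. indicator Q x * \<psi> (SOME z. z \<in> Q))"
proof -
  have eq: "indicator Q x * \<psi> (SOME z. z \<in> Q) = (if Q = cell j x then \<psi> x else 0)" if "Q \<in> cell j ` cell 0 a" for Q
  proof (cases "x \<in> Q")
    case True
    then have Q: "Q = cell j x" using that cell_eq by auto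
    have "(SOME z. z \<in> cell j x) \<in> cell j x" by (rule someI[of _ x]) simp
    then show ?thesis using assms Q by simp
  next
    case False
    then show ?thesis by auto
  qed
  have "(\<Sum>Q\<in>cell j ` cell 0 a. indicator Q x * \<psi> (SOME z. z \<in> Q))
      = (\<Sum>Q\<in>cell j ` cell 0 a. if Q = cell j x then \<psi> x else 0)"
    by (rule sum.cong[OF refl eq])
  also have "\<dots> = (if cell j x \<in> cell j ` cell 0 a then \<psi> x else 0)"
    using finite_cells by (simp add: sum.delta)
  also have "cell j x \<in> cell j ` cell 0 a \<longleftrightarrow> x \<in> cell 0 a"
  proof
    assume "cell j x \<in> cell j ` cell 0 a"
    then obtain y where y: "y \<in> cell 0 a" "cell j x = cell j y" by auto
    then have "x \<in> cell j y" using mem_cell[of x j] by simp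
    then show "x \<in> cell 0 a" using y(1) by (rule mem_top)
  qed simp
  finally show ?thesis by (simp add: indicator_def)
qed

lemma cellwise_measurable:
  assumes "\<And>x y. y \<in> cell j x \<Longrightarrow> \<psi> y = (\<psi> x :: real)"
  shows "(\<lambda>x. indicator (cell 0 a) x * \<psi> x) \<in> borel_measurable lebesgue"
proof -
  have eq: "indicator (cell 0 a) x * \<psi> x = (\<Sum>Q\<in>cell j ` cell 0 a. indicator Q x * \<psi> (SOME z. z \<in> Q))" for x
    by (rule cellwise_eq) (rule assms)
  show ?thesis
    unfolding eq
    by (intro borel_measurable_sum borel_measurable_times borel_measurable_indicator borel_measurable_const) auto
qed

lemma cellwise_integral:
  assumes "\<And>x y. y \<in> cell j x \<Longrightarrow> \<psi> y = (\<psi> x :: real)"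
  shows "integrable lebesgue (\<lambda>x. indicator (cell 0 a) x * \<psi> x)"
    and "(\<integral>x. indicator (cell 0 a) x * \<psi> x \<partial>lebesgue) = (\<Sum>Q\<in>cell j ` cell 0 a. side j ^ DIM('a) * \<psi> (SOME z. z \<in> Q))"
proof -
  have i: "integrable lebesgue (\<lambda>x. indicator Q x * \<psi> (SOME z. z \<in> Q))" if "Q \<in> cell j ` cell 0 a" for Q
    using that cell_lmeasurable by (auto simp: fmeasurable_def)
  have eq: "indicator (cell 0 a) x * \<psi> x = (\<Sum>Q\<in>cell j ` cell 0 a. indicator Q x * \<psi> (SOME z. z \<in> Q))" for x
    by (rule cellwise_eq) (rule assms)
  show "integrable lebesgue (\<lambda>x. indicator (cell 0 a) x * \<psi> x)"
    unfolding eq by (rule Bochner_Integration.integrable_sum[OF i])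
  show "(\<integral>x. indicator (cell 0 a) x * \<psi> x \<partial>lebesgue) = (\<Sum>Q\<in>cell j ` cell 0 a. side j ^ DIM('a) * \<psi> (SOME z. z \<in> Q))"
    unfolding eq
  proof (subst Bochner_Integration.integral_sum[OF i], assumption, rule sum.cong[OF refl])
    fix Q assume "Q \<in> cell j ` cell 0 a"
    then show "(\<integral>x. indicator Q x * \<psi> (SOME z. z \<in> Q) \<partial>lebesgue) = side j ^ DIM('a) * \<psi> (SOME z. z \<in> Q)"
      using measure_cell by auto
  qed
qed

definition mean :: "('a \<Rightarrow> real) \<Rightarrow> nat \<Rightarrow> 'a \<Rightarrow> real" where
  "mean f j x = (\<integral>y. indicator (cell j x) y * f y \<partial>lebesgue) / side j ^ DIM('a)"

lemma mean_cong: "y \<in> cell j x \<Longrightarrow> mean f j y = mean f j x"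
  by (simp add: mean_def cell_eq)

lemma integrable_cell:
  assumes "integrable lebesgue (\<lambda>x. indicator (cell 0 a) x * f x)" "x \<in> cell 0 a"
  shows "integrable lebesgue (\<lambda>y. indicator (cell j x) y * (f y :: real))"
proof -
  have i: "integrable lebesgue (\<lambda>y. indicator (cell j x) y *\<^sub>R (indicator (cell 0 a) y * f y))"
    by (rule integrable_mult_indicator[OF cell_sets assms(1)])
  have "indicator (cell j x) y *\<^sub>R (indicator (cell 0 a) y * f y) = indicator (cell j x) y * f y" for y
    using mem_top[OF _ assms(2), of y j] by (auto simp: indicator_def)
  then show ?thesis using i by (simp only:)
qed

lemma mean_contraction:
  assumes f: "integrable lebesgue (\<lambda>x. indicator (cell 0 a) x * f x)"
  shows "(\<integral>x. indicator (cell 0 a) x * \<bar>mean f j x\<bar> \<partial>lebesgue) \<le> (\<integral>x. indicator (cell 0 a) x * \<bar>f x\<bar> \<partial>lebesgue)"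
proof -
  let ?C = "cell j ` cell 0 a"
  have s: "0 < side j ^ DIM('a)" using side_pos by simp
  have fa: "integrable lebesgue (\<lambda>x. indicator (cell 0 a) x * \<bar>f x\<bar>)"
    using integrable_abs[OF f] by (simp add: abs_mult)
  have "(\<integral>x. indicator (cell 0 a) x * \<bar>mean f j x\<bar> \<partial>lebesgue) = (\<Sum>Q\<in>?C. side j ^ DIM('a) * \<bar>mean f j (SOME z. z \<in> Q)\<bar>)"
    by (rule cellwise_integral(2)) (simp add: mean_cong)
  also have "\<dots> \<le> (\<Sum>Q\<in>?C. \<integral>x. indicator Q x * \<bar>f x\<bar> \<partial>lebesgue)"
  proof (rule sum_mono)
    fix Q assume "Q \<in> ?C"
    then obtain x where x: "x \<in> cell 0 a" "Q = cell j x" by auto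
    have "(SOME z. z \<in> Q) \<in> cell j x" unfolding x(2) by (rule someI[of _ x]) simp
    then have "side j ^ DIM('a) * \<bar>mean f j (SOME z. z \<in> Q)\<bar> = side j ^ DIM('a) * \<bar>mean f j x\<bar>"
      by (simp add: mean_cong)
    also have "\<dots> = \<bar>\<integral>y. indicator Q y * f y \<partial>lebesgue\<bar>"
      using s side_pos[of j] by (simp add: mean_def x(2) abs_mult)
    also have "\<dots> \<le> (\<integral>x. indicator Q x * \<bar>f x\<bar> \<partial>lebesgue)"
      using integral_abs_bound[of lebesgue "\<lambda>x. indicator Q x * f x"] by (simp add: abs_mult)
    finally show "side j ^ DIM('a) * \<bar>mean f j (SOME z. z \<in> Q)\<bar> \<le> (\<integral>x. indicator Q x * \<bar>f x\<bar> \<partial>lebesgue)" .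
  qed
  also have "\<dots> \<le> (\<integral>x. indicator (cell 0 a) x * \<bar>f x\<bar> \<partial>lebesgue)"
  proof (rule sum_integral_disjoint_le[OF finite_cells])
    show "disjoint_family_on (\<lambda>Q. Q) ?C"
      unfolding disjoint_family_on_def using cell_eq by blast
    show "Q \<subseteq> cell 0 a" if "Q \<in> ?C" for Q using that mem_top by blast
    show "Q \<in> sets lebesgue" if "Q \<in> ?C" for Q using that by auto
  qed (simp_all add: fa)
  finally show ?thesis .
qed

text \<open>For continuous \<open>g\<close> the means converge uniformly on the top cell, and by
  \<open>mean_contraction\<close> passing from \<open>h\<close> to \<open>g\<close> costs at most
  their L^1 distance, once for the means and once for the functions: three contributions of e/4.
  Convergence in L^1 is enough later, as Fatou's lemma asks only for an almost everywhere convergent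
  subsequence.\<close>

lemma mean_tendsto_L1:
  assumes h: "h \<in> borel_measurable lebesgue" "\<And>x. 0 \<le> h x"
    and int: "\<And>B. compact B \<Longrightarrow> integrable lebesgue (\<lambda>x. indicator B x * h x)"
  shows "(\<lambda>j. \<integral>x. indicator (cell 0 a) x * \<bar>mean h j x - h x\<bar> \<partial>lebesgue) \<longlonglongrightarrow> 0"
proof (rule LIMSEQ_I)
  fix e :: real assume e: "0 < e"
  define B where "B = cbox (low 0 a) (low 0 a + side 0 *\<^sub>R One)"
  have B: "compact B" "cell 0 a \<subseteq> B" unfolding B_def using cell_subset_cbox by auto
  define s where "s = side 0 ^ DIM('a)"
  have s: "0 < s" using side_pos by (simp add: s_def)
  obtain g where g: "continuous_on UNIV g" "(\<integral>x. indicator B x * \<bar>h x - g x\<bar> \<partial>lebesgue) < e / 4"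
    using continuous_L1_approx[OF h B(1) int[OF B(1)], of "e / 4"] e by auto
  have iB: "integrable lebesgue (\<lambda>x. indicator B x * f x)" if "continuous_on UNIV f" for f :: "'a \<Rightarrow> real"
  proof -
    have "compact (f ` B)" by (intro compact_continuous_image continuous_on_subset[OF that] B) simp
    from compact_imp_bounded[OF this] obtain M where M: "\<forall>y\<in>f ` B. norm y \<le> M" by (auto simp: bounded_iff)
    show ?thesis
    proof (rule Bochner_Integration.integrable_bound)
      show "integrable lebesgue (\<lambda>x. M * indicator B x)"
        by (intro integrable_mult_right integrable_indicator_compact B)
      show "(\<lambda>x. indicator B x * f x) \<in> borel_measurable lebesgue"
        by (intro borel_measurable_times borel_measurable_indicator sets_lebesgue_compact B
            borel_measurable_lebesgue_continuous that)
      show "AE x in lebesgue. norm (indicator B x * f x) \<le> norm (M * indicator B x)"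
        using M by (intro AE_I2) (auto simp: indicator_def)
    qed
  qed
  have sub: "integrable lebesgue (\<lambda>x. indicator (cell 0 a) x * f x)" if "integrable lebesgue (\<lambda>x. indicator B x * f x)" for f :: "'a \<Rightarrow> real"
  proof -
    have i: "integrable lebesgue (\<lambda>x. indicator (cell 0 a) x *\<^sub>R (indicator B x * f x))"
      by (rule integrable_mult_indicator[OF cell_sets that])
    have "indicator (cell 0 a) x *\<^sub>R (indicator B x * f x) = indicator (cell 0 a) x * f x" for x
      using B(2) by (auto simp: indicator_def)
    then show ?thesis using i by (simp only:)
  qed
  have ih: "integrable lebesgue (\<lambda>x. indicator (cell 0 a) x * h x)" by (rule sub[OF int[OF B(1)]])
  have ig: "integrable lebesgue (\<lambda>x. indicator (cell 0 a) x * g x)" by (rule sub[OF iB[OF g(1)]])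
  have ihgB: "integrable lebesgue (\<lambda>x. indicator B x * (h x - g x))"
    unfolding right_diff_distrib by (intro Bochner_Integration.integrable_diff int[OF B(1)] iB[OF g(1)])
  have ihg: "integrable lebesgue (\<lambda>x. indicator (cell 0 a) x * (h x - g x))" by (rule sub[OF ihgB])
  have ihg': "integrable lebesgue (\<lambda>x. indicator (cell 0 a) x * \<bar>h x - g x\<bar>)"
    using integrable_abs[OF ihg] by (simp add: abs_mult)
  have "(\<integral>x. indicator (cell 0 a) x * \<bar>h x - g x\<bar> \<partial>lebesgue) \<le> (\<integral>x. indicator B x * \<bar>h x - g x\<bar> \<partial>lebesgue)"
    using B(2) integrable_abs[OF ihgB] by (intro integral_mono ihg') (auto simp: abs_mult indicator_def)
  then have hg: "(\<integral>x. indicator (cell 0 a) x * \<bar>h x - g x\<bar> \<partial>lebesgue) < e / 4" using g(2) by linarith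
  have "uniformly_continuous_on B g"
    by (intro compact_uniformly_continuous continuous_on_subset[OF g(1)] B) simp
  then obtain d where d: "0 < d" "\<And>x y. x \<in> B \<Longrightarrow> y \<in> B \<Longrightarrow> dist y x < d \<Longrightarrow> dist (g y) (g x) < e / (4 * s)"
    unfolding uniformly_continuous_on_def using e s by (metis divide_pos_pos mult_pos_pos zero_less_numeral)
  have "(\<lambda>j. 2 * real DIM('a) * side j) \<longlonglongrightarrow> 2 * real DIM('a) * 0"
    unfolding side_def by (intro tendsto_intros LIMSEQ_divide_realpow_zero) simp
  then have "\<forall>\<^sub>F j in sequentially. 2 * real DIM('a) * side j < d"
    using d(1) by (intro order_tendstoD(2)) auto
  then obtain j0 where j0: "\<And>j. j0 \<le> j \<Longrightarrow> 2 * real DIM('a) * side j < d" by (auto simp: eventually_sequentially)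
  have "(\<integral>x. indicator (cell 0 a) x * \<bar>mean h j x - h x\<bar> \<partial>lebesgue) < e" if j: "j0 \<le> j" for j
  proof -
    have sj: "0 < side j ^ DIM('a)" using side_pos by simp
    have lin: "mean h j x = mean (\<lambda>y. h y - g y) j x + mean g j x" if "x \<in> cell 0 a" for x
      unfolding mean_def right_diff_distrib add_divide_distrib[symmetric]
      by (subst Bochner_Integration.integral_diff[OF integrable_cell[OF ih that] integrable_cell[OF ig that]]) simp
    have mg: "\<bar>mean g j x - g x\<bar> \<le> e / (4 * s)" if x: "x \<in> cell 0 a" for x
    proof -
      have ic: "integrable lebesgue (\<lambda>y. indicator (cell j x) y * c)" for c :: real
        using cell_lmeasurable[of j x] by (auto simp: fmeasurable_def)
      have ic': "(\<integral>y. indicator (cell j x) y * c \<partial>lebesgue) = c * side j ^ DIM('a)" for c :: real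
        using measure_cell[of j x] by simp
      have "(mean g j x - g x) * side j ^ DIM('a) = (\<integral>y. indicator (cell j x) y * g y \<partial>lebesgue) - (\<integral>y. indicator (cell j x) y * g x \<partial>lebesgue)"
        unfolding ic' using side_pos[of j] by (simp add: mean_def left_diff_distrib)
      also have "\<dots> = (\<integral>y. indicator (cell j x) y * (g y - g x) \<partial>lebesgue)"
        unfolding right_diff_distrib by (rule Bochner_Integration.integral_diff[symmetric, OF integrable_cell[OF ig x] ic])
      finally have "\<bar>(mean g j x - g x) * side j ^ DIM('a)\<bar> \<le> (\<integral>y. indicator (cell j x) y * \<bar>g y - g x\<bar> \<partial>lebesgue)"
        using integral_abs_bound[of lebesgue "\<lambda>y. indicator (cell j x) y * (g y - g x)"] by (simp add: abs_mult)
      also have "\<dots> \<le> (\<integral>y. indicator (cell j x) y * (e / (4 * s)) \<partial>lebesgue)"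
      proof (intro integral_mono ic)
        have "integrable lebesgue (\<lambda>y. indicator (cell j x) y * (g y - g x))"
          unfolding right_diff_distrib by (intro Bochner_Integration.integrable_diff integrable_cell[OF ig x] ic)
        from integrable_abs[OF this] show "integrable lebesgue (\<lambda>y. indicator (cell j x) y * \<bar>g y - g x\<bar>)" by (simp add: abs_mult)
        fix y
        show "indicator (cell j x) y * \<bar>g y - g x\<bar> \<le> indicator (cell j x) y * (e / (4 * s))"
        proof (cases "y \<in> cell j x")
          case True
          have "dist y x \<le> dist (centre j x) y + dist (centre j x) x" using dist_triangle[of y x "centre j x"] by (simp add: dist_commute)
          also have "\<dots> \<le> 2 * real DIM('a) * side j" using dist_centre_le[OF True] dist_centre_le[of x j x] by simp
          also have "\<dots> < d" by (rule j0[OF j])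
          finally have "dist (g y) (g x) < e / (4 * s)" using d(2)[of x y] x True mem_top[OF True x] B(2) by auto
          then show ?thesis using True by (simp add: dist_real_def)
        qed simp
      qed
      also have "\<dots> = e / (4 * s) * side j ^ DIM('a)" by (rule ic')
      finally have "\<bar>mean g j x - g x\<bar> * side j ^ DIM('a) \<le> e / (4 * s) * side j ^ DIM('a)"
        using sj by (simp add: abs_mult)
      then show ?thesis using sj by (rule mult_right_le_imp_le)
    qed
    have im: "integrable lebesgue (\<lambda>x. indicator (cell 0 a) x * \<bar>mean (\<lambda>y. h y - g y) j x\<bar>)"
      by (rule cellwise_integral(1)[where j = j]) (simp add: mean_cong)
    have ie: "integrable lebesgue (\<lambda>x. indicator (cell 0 a) x * (e / (4 * s)))"
      using cell_lmeasurable[of 0 a] by (auto simp: fmeasurable_def)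
    have imh: "integrable lebesgue (\<lambda>x. indicator (cell 0 a) x * \<bar>mean h j x - h x\<bar>)"
    proof -
      have "integrable lebesgue (\<lambda>x. indicator (cell 0 a) x * (mean h j x - h x))"
        unfolding right_diff_distrib
        by (intro Bochner_Integration.integrable_diff ih cellwise_integral(1)[where j = j]) (simp add: mean_cong)
      from integrable_abs[OF this] show ?thesis by (simp add: abs_mult)
    qed
    have "(\<integral>x. indicator (cell 0 a) x * \<bar>mean h j x - h x\<bar> \<partial>lebesgue)
        \<le> (\<integral>x. (indicator (cell 0 a) x * \<bar>mean (\<lambda>y. h y - g y) j x\<bar> + indicator (cell 0 a) x * (e / (4 * s)))
            + indicator (cell 0 a) x * \<bar>h x - g x\<bar> \<partial>lebesgue)"
    proof (intro integral_mono imh Bochner_Integration.integrable_add im ie ihg')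
      fix x
      show "indicator (cell 0 a) x * \<bar>mean h j x - h x\<bar> \<le> (indicator (cell 0 a) x * \<bar>mean (\<lambda>y. h y - g y) j x\<bar> + indicator (cell 0 a) x * (e / (4 * s)))
            + indicator (cell 0 a) x * \<bar>h x - g x\<bar>"
      proof (cases "x \<in> cell 0 a")
        case True
        have "\<bar>mean h j x - h x\<bar> \<le> \<bar>mean (\<lambda>y. h y - g y) j x\<bar> + e / (4 * s) + \<bar>h x - g x\<bar>"
          using lin[OF True] mg[OF True] by linarith
        then show ?thesis using True by simp
      qed simp
    qed
    also have "\<dots> = (\<integral>x. indicator (cell 0 a) x * \<bar>mean (\<lambda>y. h y - g y) j x\<bar> \<partial>lebesgue)
        + (\<integral>x. indicator (cell 0 a) x * (e / (4 * s)) \<partial>lebesgue) + (\<integral>x. indicator (cell 0 a) x * \<bar>h x - g x\<bar> \<partial>lebesgue)"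
      by (simp only: Bochner_Integration.integral_add[OF Bochner_Integration.integrable_add[OF im ie] ihg']
          Bochner_Integration.integral_add[OF im ie])
    also have "(\<integral>x. indicator (cell 0 a) x * (e / (4 * s)) \<partial>lebesgue) = e / 4"
      using measure_cell[of 0 a] s side_pos[of 0] by (simp add: s_def)
    finally show ?thesis using mean_contraction[OF ihg, of j] hg e by linarith
  qed
  moreover have "0 \<le> (\<integral>x. indicator (cell 0 a) x * \<bar>mean h j x - h x\<bar> \<partial>lebesgue)" for j
    by (intro Bochner_Integration.integral_nonneg) auto
  ultimately show "\<exists>no. \<forall>j\<ge>no. norm ((\<integral>x. indicator (cell 0 a) x * \<bar>mean h j x - h x\<bar> \<partial>lebesgue) - 0) < e"
    by (intro exI[of _ j0]) auto
qed

end

section \<open>Global integrability\<close>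

context dyadic_oscillation
begin

text \<open>Listing \<open>J\<close> by decreasing side turns the condition on generations in
  \<open>J_ball_carleson\<close> into j \<ge> i. As the energy is finite and positive, its power 1 -
  1/r may be cancelled from E \<le> D E^(1-1/r), leaving E \<le> D^r with \<open>D\<close> free of
  the truncation and of the cube.\<close>

lemma energy_bound:
  assumes r: "1 < r" and \<kappa>: "0 \<le> \<kappa>"
    and est: "oscillation_estimate b r \<kappa> (2 * unit_ball_vol (real DIM('a)) * (2 * \<kappa> + 3 * real DIM('a)) ^ DIM('a)) C"
  shows "energy r \<le> (6 * \<theta> powr (r - 1) * \<bar>C\<bar>) powr r"
proof -
  obtain f where f: "bij_betw f {..<card J} J"
    and mono: "\<And>i j. i \<le> j \<Longrightarrow> j < card J \<Longrightarrow> side (gen (f j)) \<le> side (gen (f i))"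
  proof -
    show ?thesis
      by (rule enumerate_antimono[OF finite_J, of "\<lambda>X. side (gen X)"]) (erule that, blast)
  qed
  have fJ: "f i \<in> J" if "i < card J" for i using f that by (auto simp: bij_betw_def)
  have inj: "inj_on f {..<card J}" using f by (simp add: bij_betw_def)
  have gen: "gen (f i) \<le> gen (f j)" if "i \<le> j" "j < card J" for i j
  proof (rule ccontr)
    assume "\<not> gen (f i) \<le> gen (f j)"
    then have "side (gen (f i)) < side (gen (f j))"
      using L unfolding side_def by (intro divide_strict_left_mono power_strict_increasing mult_pos_pos zero_less_power) auto
    with mono[OF that] show False by simp
  qed
  have 1: "\<forall>i<card J. 0 < side (gen (f i)) \<and> 0 \<le> t (lev (f i)) \<and> cel (f i) \<in> sets lebesgue
      \<and> cel (f i) \<subseteq> cube (ctr (f i)) (side (gen (f i)))"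
    using side_pos t_pos J_sets cel_subset_cube fJ by (simp add: less_imp_le)
  have 2: "(\<Sum>j\<in>{j\<in>{i..<card J}. cball (ctr (f j)) (\<kappa> * side (gen (f j))) \<inter> cball (ctr (f i)) (\<kappa> * side (gen (f i))) \<noteq> {}}. side (gen (f j)) ^ DIM('a))
      \<le> (2 * unit_ball_vol (real DIM('a)) * (2 * \<kappa> + 3 * real DIM('a)) ^ DIM('a)) * side (gen (f i)) ^ DIM('a)"
    if i: "i < card J" for i
  proof -
    let ?A = "{j\<in>{i..<card J}. cball (ctr (f j)) (\<kappa> * side (gen (f j))) \<inter> cball (ctr (f i)) (\<kappa> * side (gen (f i))) \<noteq> {}}"
    let ?B = "{Y\<in>J. gen (f i) \<le> gen Y \<and> cball (ctr Y) (\<kappa> * side (gen Y)) \<inter> cball (ctr (f i)) (\<kappa> * side (gen (f i))) \<noteq> {}}"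
    have "inj_on f ?A" by (rule inj_on_subset[OF inj]) auto
    then have "(\<Sum>j\<in>?A. side (gen (f j)) ^ DIM('a)) = (\<Sum>Y\<in>f ` ?A. side (gen Y) ^ DIM('a))"
      by (simp add: sum.reindex)
    also have "\<dots> \<le> (\<Sum>Y\<in>?B. side (gen Y) ^ DIM('a))"
    proof (rule sum_mono2)
      show "finite ?B" using finite_J by simp
      show "f ` ?A \<subseteq> ?B"
      proof (rule image_subsetI)
        fix j assume "j \<in> ?A"
        then show "f j \<in> ?B" using fJ[of j] gen[of i j] by simp
      qed
      show "0 \<le> side (gen Y) ^ DIM('a)" for Y using side_n_pos[of "gen Y"] by simp
    qed
    also have "\<dots> \<le> 2 * unit_ball_vol (real DIM('a)) * (2 * \<kappa> + 3 * real DIM('a)) ^ DIM('a) * side (gen (f i)) ^ DIM('a)"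
      by (rule J_ball_carleson[OF fJ[OF i] \<kappa>])
    finally show ?thesis .
  qed
  from est[unfolded oscillation_estimate_def, rule_format, where N = "card J" and c = "\<lambda>i. ctr (f i)" and l = "\<lambda>i. side (gen (f i))"
      and t = "\<lambda>i. t (lev (f i))" and Q = "\<lambda>i. cel (f i)"] 1 2
  obtain \<alpha> where \<alpha>: "(\<Sum>i<card J. t (lev (f i)) powr (r - 1) * (\<integral>x. indicator (cel (f i)) x * \<bar>b x - \<alpha> i\<bar> \<partial>lebesgue))
          \<le> C * (\<Sum>i<card J. t (lev (f i)) powr r * side (gen (f i)) ^ DIM('a)) powr (1 - 1 / r)" by blast
  \<comment> \<open>The constants come indexed by position in the list; they are carried back to the
    cells.\<close>
  define \<alpha>' where "\<alpha>' X = \<alpha> (inv_into {..<card J} f X)" for X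
  have \<alpha>': "\<alpha>' (f i) = \<alpha> i" if "i < card J" for i using inj that by (simp add: \<alpha>'_def)
  have s1: "(\<Sum>X\<in>J. t (lev X) powr (r - 1) * (\<integral>x. indicator (cel X) x * \<bar>b x - \<alpha>' X\<bar> \<partial>lebesgue))
      = (\<Sum>i<card J. t (lev (f i)) powr (r - 1) * (\<integral>x. indicator (cel (f i)) x * \<bar>b x - \<alpha> i\<bar> \<partial>lebesgue))"
    by (subst sum.reindex_bij_betw[OF f, symmetric]) (simp add: \<alpha>')
  have s2: "energy r = (\<Sum>i<card J. t (lev (f i)) powr r * side (gen (f i)) ^ DIM('a))"
    unfolding energy_def by (rule sum.reindex_bij_betw[OF f, symmetric])
  define E where "E = energy r"
  have E: "0 < E" unfolding E_def by (rule energy_pos)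
  define D where "D = 6 * \<theta> powr (r - 1) * \<bar>C\<bar>"
  have "E \<le> 6 * \<theta> powr (r - 1) * (C * E powr (1 - 1 / r))"
    unfolding E_def using energy_le[OF r, of \<alpha>'] \<alpha> unfolding s1 s2[symmetric]
    by (rule order_trans[OF _ mult_left_mono]) auto
  also have "\<dots> \<le> 6 * \<theta> powr (r - 1) * (\<bar>C\<bar> * E powr (1 - 1 / r))"
    by (intro mult_left_mono mult_right_mono) auto
  finally have le: "E \<le> D * E powr (1 - 1 / r)" by (simp add: D_def mult.assoc)
  have "E = E powr (1 / r) * E powr (1 - 1 / r)" using E by (simp flip: powr_add)
  with le have "E powr (1 / r) * E powr (1 - 1 / r) \<le> D * E powr (1 - 1 / r)" by simp
  then have "E powr (1 / r) \<le> D" using E by (simp add: mult_le_cancel_right)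
  then have "(E powr (1 / r)) powr r \<le> D powr r" using r by (intro powr_mono2) auto
  then show ?thesis using E r by (simp add: powr_powr E_def D_def)
qed

end

lemma nn_integral_le_lim:
  fixes f :: "nat \<Rightarrow> 'b \<Rightarrow> real"
  assumes "\<And>n. f n \<in> borel_measurable M" "\<And>n. (\<integral>\<^sup>+x. ennreal (f n x) \<partial>M) \<le> D"
    and "AE x in M. (\<lambda>n. f n x) \<longlonglongrightarrow> g x"
  shows "(\<integral>\<^sup>+x. ennreal (g x) \<partial>M) \<le> D"
proof -
  have "(\<integral>\<^sup>+x. ennreal (g x) \<partial>M) \<le> (\<integral>\<^sup>+x. liminf (\<lambda>n. ennreal (f n x)) \<partial>M)"
  proof (rule nn_integral_mono_AE)
    show "AE x in M. ennreal (g x) \<le> liminf (\<lambda>n. ennreal (f n x))"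
      using assms(3)
    proof eventually_elim
      case (elim x)
      then have "(\<lambda>n. ennreal (f n x)) \<longlonglongrightarrow> ennreal (g x)" by (rule tendsto_ennrealI)
      from lim_imp_Liminf[OF sequentially_bot this] show ?case by simp
    qed
  qed
  also have "\<dots> \<le> liminf (\<lambda>n. \<integral>\<^sup>+x. ennreal (f n x) \<partial>M)"
    using assms(1) by (intro nn_integral_liminf) auto
  also have "\<dots> \<le> limsup (\<lambda>n. \<integral>\<^sup>+x. ennreal (f n x) \<partial>M)" by (rule Liminf_le_Limsup) simp
  also have "\<dots> \<le> D" using assms(2) by (intro Limsup_bounded) auto
  finally show ?thesis .
qed

text \<open>The bound depends on the dimension, \<open>r\<close> and \<open>C\<close> only.
  Independence of the number of generations permits the limit of the truncated bounds, independence
  of the cube the later exhaustion.\<close>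

lemma oscillation_Lr_bound:
  fixes b :: "'a::euclidean_space \<Rightarrow> real"
  assumes b: "in_Lp_loc 1 b" and r: "1 < r" and \<kappa>: "0 \<le> \<kappa>" and L: "0 < L"
    and est: "oscillation_estimate b r \<kappa> (2 * unit_ball_vol (real DIM('a)) * (2 * \<kappa> + 3 * real DIM('a)) ^ DIM('a)) C"
  defines "\<theta> \<equiv> 2 ^ Suc DIM('a)"
  shows "\<exists>\<beta>. (\<integral>\<^sup>+x. ennreal (indicator (dyadic.cell a L 0 a) x * \<bar>b x - \<beta>\<bar> powr r) \<partial>lebesgue)
    \<le> ennreal (\<theta> powr r * (6 * \<theta> powr (r - 1) * \<bar>C\<bar>) powr r)"
proof -
  interpret dyadic a L by unfold_locales (rule L)
  have bm: "b \<in> borel_measurable lebesgue" using b by (simp add: in_Lp_loc_def)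
  define \<beta> where "\<beta> = (\<integral>y. indicator (cell 0 a) y * b y \<partial>lebesgue) / side 0 ^ DIM('a)"
  define h where "h x = \<bar>b x - \<beta>\<bar>" for x
  have h: "h \<in> borel_measurable lebesgue" "\<And>x. 0 \<le> h x" unfolding h_def using bm by auto
  have inth: "integrable lebesgue (\<lambda>x. indicator B x * h x)" if B: "compact B" for B
  proof -
    have "integrable lebesgue (\<lambda>x. indicator B x * b x - \<beta> * indicator B x)"
      by (intro Bochner_Integration.integrable_diff integrable_mult_right in_Lp_loc_1_integrable[OF b] integrable_indicator_compact B)
    from integrable_abs[OF this]
    have i: "integrable lebesgue (\<lambda>x. \<bar>indicator B x * b x - \<beta> * indicator B x\<bar>)" .
    have "\<bar>indicator B x * b x - \<beta> * indicator B x\<bar> = indicator B x * h x" for x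
      by (auto simp: h_def indicator_def)
    then show ?thesis using i by (simp only:)
  qed
  have ih: "integrable lebesgue (\<lambda>x. indicator (cell 0 a) x * h x)"
  proof -
    have i: "integrable lebesgue (\<lambda>x. indicator (cell 0 a) x *\<^sub>R (indicator (cbox (low 0 a) (low 0 a + side 0 *\<^sub>R One)) x * h x))"
      by (rule integrable_mult_indicator[OF cell_sets inth[OF compact_cbox]])
    have "indicator (cell 0 a) x *\<^sub>R (indicator (cbox (low 0 a) (low 0 a + side 0 *\<^sub>R One)) x * h x) = indicator (cell 0 a) x * h x" for x
      using cell_subset_cbox[of 0 a] by (auto simp: indicator_def)
    then show ?thesis using i by (simp only:)
  qed
  have "(\<integral>\<^sup>+x. ennreal (indicator (cell 0 a) x * h x powr r) \<partial>lebesgue) \<le> ennreal (\<theta> powr r * (6 * \<theta> powr (r - 1) * \<bar>C\<bar>) powr r)"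
  proof (cases "(\<integral>x. indicator (cell 0 a) x * h x \<partial>lebesgue) = 0")
    \<comment> \<open>Vanishing oscillation, where all thresholds would be zero and no cells could
      be selected by height.\<close>
    case True
    then have "AE x in lebesgue. indicator (cell 0 a) x * h x = 0"
      using integral_nonneg_eq_0_iff_AE[OF ih] h(2) by simp
    then have "AE x in lebesgue. ennreal (indicator (cell 0 a) x * h x powr r) = 0"
      by eventually_elim (auto simp: indicator_def)
    then have "(\<integral>\<^sup>+x. ennreal (indicator (cell 0 a) x * h x powr r) \<partial>lebesgue) = integral\<^sup>N lebesgue (\<lambda>x::'a. 0)"
      by (rule nn_integral_cong_AE)
    then show ?thesis by simp
  next
    case False
    moreover have "0 \<le> (\<integral>x. indicator (cell 0 a) x * h x \<partial>lebesgue)"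
      using h(2) by (intro Bochner_Integration.integral_nonneg) auto
    ultimately have pos: "0 < (\<integral>x. indicator (cell 0 a) x * h x \<partial>lebesgue)" by linarith
    have osc: "dyadic_oscillation a L b"
      by unfold_locales (use b pos in \<open>simp_all add: h_def \<beta>_def\<close>)
    have bound: "(\<integral>\<^sup>+x. ennreal (indicator (cell 0 a) x * mean h N x powr r) \<partial>lebesgue)
        \<le> ennreal (\<theta> powr r * (6 * \<theta> powr (r - 1) * \<bar>C\<bar>) powr r)"
      and meas: "(\<lambda>x. indicator (cell 0 a) x * mean h N x powr r) \<in> borel_measurable lebesgue" for N
    proof -
      interpret O: dyadic_oscillation a L b N by (rule osc)
      have av: "O.av N x = mean h N x" for x
        by (simp add: O.av_def mean_def O.u_def O.b0_def h_def \<beta>_def)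
      have th: "O.\<theta> = \<theta>" by (simp add: O.\<theta>_def \<theta>_def)
      show m: "(\<lambda>x. indicator (cell 0 a) x * mean h N x powr r) \<in> borel_measurable lebesgue"
        by (rule cellwise_measurable[where j = N]) (simp add: mean_cong)
      note le = O.integral_av_powr_le[OF r, unfolded av, OF m]
      have "(\<integral>\<^sup>+x. ennreal (indicator (cell 0 a) x * mean h N x powr r) \<partial>lebesgue)
          = ennreal (\<integral>x. indicator (cell 0 a) x * mean h N x powr r \<partial>lebesgue)"
        by (intro nn_integral_eq_integral le(1) AE_I2) auto
      also have "\<dots> \<le> ennreal (\<theta> powr r * O.energy r)" using le(2) by (simp add: th ennreal_leI)
      also have "\<dots> \<le> ennreal (\<theta> powr r * (6 * \<theta> powr (r - 1) * \<bar>C\<bar>) powr r)"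
        using O.energy_bound[OF r \<kappa> est] by (intro ennreal_leI mult_left_mono) (simp_all add: th)
      finally show "(\<integral>\<^sup>+x. ennreal (indicator (cell 0 a) x * mean h N x powr r) \<partial>lebesgue)
        \<le> ennreal (\<theta> powr r * (6 * \<theta> powr (r - 1) * \<bar>C\<bar>) powr r)" .
    qed
    have id: "integrable lebesgue (\<lambda>x. indicator (cell 0 a) x * (mean h j x - h x))" for j
      unfolding right_diff_distrib
      by (intro Bochner_Integration.integrable_diff ih cellwise_integral(1)[where j = j]) (simp add: mean_cong)
    have "(\<lambda>j. \<integral>x. norm (indicator (cell 0 a) x * (mean h j x - h x)) \<partial>lebesgue) \<longlonglongrightarrow> 0"
      using mean_tendsto_L1[OF h inth] by (simp add: abs_mult)
    from tendsto_L1_AE_subseq[OF id this] obtain s :: "nat \<Rightarrow> nat" where s: "strict_mono s"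
      "AE x in lebesgue. (\<lambda>j. indicator (cell 0 a) x * (mean h (s j) x - h x)) \<longlonglongrightarrow> 0" by blast
    have mean0: "0 \<le> mean h j x" for j x
      unfolding mean_def using side_pos[of j] h(2) by (intro divide_nonneg_pos Bochner_Integration.integral_nonneg) auto
    show ?thesis
    proof (rule nn_integral_le_lim[OF meas bound])
      show "AE x in lebesgue. (\<lambda>j. indicator (cell 0 a) x * mean h (s j) x powr r) \<longlonglongrightarrow> indicator (cell 0 a) x * h x powr r"
        using s(2)
      proof eventually_elim
        case (elim x)
        show ?case
        proof (cases "x \<in> cell 0 a")
          case True
          then have "(\<lambda>j. mean h (s j) x - h x) \<longlonglongrightarrow> 0" using elim by simp
          then have "(\<lambda>j. mean h (s j) x) \<longlonglongrightarrow> h x" by (rule LIM_zero_cancel)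
          then have "(\<lambda>j. mean h (s j) x powr r) \<longlonglongrightarrow> h x powr r"
            using r mean0 by (intro tendsto_powr' tendsto_const) auto
          then show ?thesis by (intro tendsto_mult_left)
        qed simp
      qed
    qed
  qed
  then show ?thesis unfolding h_def by (rule exI)
qed

section \<open>Exhaustion of the space by cubes\<close>

lemma powr_abs_add_le:
  fixes x y r :: real
  assumes "0 < r"
  shows "\<bar>x + y\<bar> powr r \<le> 2 powr r * (\<bar>x\<bar> powr r + \<bar>y\<bar> powr r)"
proof -
  have "\<bar>x + y\<bar> powr r \<le> (2 * max \<bar>x\<bar> \<bar>y\<bar>) powr r" using assms by (intro powr_mono2) auto
  also have "\<dots> = 2 powr r * (max \<bar>x\<bar> \<bar>y\<bar>) powr r" by (simp add: powr_mult)
  also have "\<dots> \<le> 2 powr r * (\<bar>x\<bar> powr r + \<bar>y\<bar> powr r)" by (intro mult_left_mono) (auto simp: max_def)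
  finally show ?thesis .
qed

text \<open>All constants can be compared on the smallest cube \<open>Q 0\<close>, which lies in
  every \<open>Q k\<close>: the r-th power of |\<beta> k - \<beta> 0| times its volume is bounded by
  the two integrals. A convergent subsequence of the constants provides the final one, and Fatou's
  lemma along the growing cubes the global bound.\<close>

lemma in_dot_LpI:
  fixes b :: "'a::euclidean_space \<Rightarrow> real"
  assumes b: "b \<in> borel_measurable lebesgue" and r: "0 < r" and D: "0 \<le> D"
    and bound: "\<And>a L. 0 < L \<Longrightarrow> \<exists>\<beta>. (\<integral>\<^sup>+x. ennreal (indicator (dyadic.cell a L 0 a) x * \<bar>b x - \<beta>\<bar> powr r) \<partial>lebesgue) \<le> ennreal D"
  shows "in_dot_Lp r b"
proof -
  \<comment> \<open>Corner and side are chosen such that \<open>Q k\<close> is the half-open cube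
    from -2^k to 2^k in each coordinate.\<close>
  define A where "A k = - (2 ^ k) *\<^sub>R (One :: 'a)" for k :: nat
  define Q where "Q k = dyadic.cell (A k) (2 ^ Suc k) 0 (A k)" for k
  have dy: "dyadic (2 ^ Suc k)" for k by unfold_locales simp
  have Q: "x \<in> Q k \<longleftrightarrow> (\<forall>i\<in>Basis. - (2 ^ k) \<le> x \<bullet> i \<and> x \<bullet> i < 2 ^ k)" for x k
  proof -
    interpret dyadic "A k" "2 ^ Suc k" by (rule dy)
    have "low 0 (A k) \<bullet> i = - (2 ^ k)" if "i \<in> Basis" for i
      unfolding low_def using that by (simp add: idx_0_a inner_sum_left_Basis del: power_Suc) (simp add: A_def)
    moreover have "side 0 = 2 ^ k + 2 ^ k" unfolding side_def by simp
    ultimately show ?thesis unfolding Q_def cell_iff by simp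
  qed
  have Qs: "Q k \<in> sets lebesgue" for k
    unfolding Q_def by (rule dyadic.cell_sets[OF dy])
  have Q0: "measure lebesgue (Q 0) = 2 ^ DIM('a)" "Q 0 \<in> fmeasurable lebesgue"
  proof -
    show "measure lebesgue (Q 0) = 2 ^ DIM('a)"
      unfolding Q_def dyadic.measure_cell[OF dy] dyadic.side_def[OF dy] by simp
    show "Q 0 \<in> fmeasurable lebesgue" unfolding Q_def by (rule dyadic.cell_lmeasurable[OF dy])
  qed
  have Qmono: "Q 0 \<subseteq> Q k" for k
  proof
    fix x assume x: "x \<in> Q 0"
    have "(1::real) \<le> 2 ^ k" by simp
    then show "x \<in> Q k" unfolding Q
    proof (intro ballI)
      fix i :: 'a assume "i \<in> Basis"
      then have "- 1 \<le> x \<bullet> i" "x \<bullet> i < 1" using x by (auto simp: Q)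
      then show "- (2 ^ k) \<le> x \<bullet> i \<and> x \<bullet> i < 2 ^ k" using \<open>(1::real) \<le> 2 ^ k\<close> by linarith
    qed
  qed
  have "\<forall>k. \<exists>\<beta>. (\<integral>\<^sup>+x. ennreal (indicator (Q k) x * \<bar>b x - \<beta>\<bar> powr r) \<partial>lebesgue) \<le> ennreal D"
    unfolding Q_def using bound by simp
  from choice[OF this] obtain \<beta> where \<beta>: "\<And>k. (\<integral>\<^sup>+x. ennreal (indicator (Q k) x * \<bar>b x - \<beta> k\<bar> powr r) \<partial>lebesgue) \<le> ennreal D"
    by blast
  have meas: "(\<lambda>x. indicator (Q k) x * \<bar>b x - c\<bar> powr r) \<in> borel_measurable lebesgue" for k c
  proof -
    note Qs[measurable] b[measurable]
    show ?thesis by measurable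
  qed
  have bnd: "\<bar>\<beta> k - \<beta> 0\<bar> \<le> (2 powr r * (2 * D) / 2 ^ DIM('a)) powr (1 / r)" for k
  proof -
    define d where "d = \<bar>\<beta> k - \<beta> 0\<bar> powr r"
    have d: "0 \<le> d" by (simp add: d_def)
    have "ennreal (d * 2 ^ DIM('a)) = (\<integral>\<^sup>+x. ennreal d * indicator (Q 0) x \<partial>lebesgue)"
      using Q0 Qs[of 0] d by (simp add: nn_integral_cmult_indicator emeasure_eq_measure2 ennreal_mult)
    also have "\<dots> \<le> (\<integral>\<^sup>+x. ennreal (2 powr r) * (ennreal (indicator (Q k) x * \<bar>b x - \<beta> k\<bar> powr r) + ennreal (indicator (Q 0) x * \<bar>b x - \<beta> 0\<bar> powr r)) \<partial>lebesgue)"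
    proof (rule nn_integral_mono)
      fix x
      show "ennreal d * indicator (Q 0) x \<le> ennreal (2 powr r) * (ennreal (indicator (Q k) x * \<bar>b x - \<beta> k\<bar> powr r) + ennreal (indicator (Q 0) x * \<bar>b x - \<beta> 0\<bar> powr r))"
      proof (cases "x \<in> Q 0")
        case True
        then have "x \<in> Q k" using Qmono by blast
        have "d \<le> 2 powr r * (\<bar>\<beta> k - b x\<bar> powr r + \<bar>b x - \<beta> 0\<bar> powr r)"
          unfolding d_def using powr_abs_add_le[OF r, of "\<beta> k - b x" "b x - \<beta> 0"] by simp
        then show ?thesis using True \<open>x \<in> Q k\<close>
          by (simp add: ennreal_plus[symmetric] ennreal_mult[symmetric] abs_minus_commute[of "\<beta> k"] ennreal_leI del: ennreal_plus)
      qed simp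
    qed
    also have "\<dots> = ennreal (2 powr r) * ((\<integral>\<^sup>+x. ennreal (indicator (Q k) x * \<bar>b x - \<beta> k\<bar> powr r) \<partial>lebesgue)
        + (\<integral>\<^sup>+x. ennreal (indicator (Q 0) x * \<bar>b x - \<beta> 0\<bar> powr r) \<partial>lebesgue))"
      using meas by (subst nn_integral_cmult) (auto simp: nn_integral_add)
    also have "\<dots> \<le> ennreal (2 powr r) * (ennreal D + ennreal D)"
      by (intro mult_left_mono add_mono \<beta>) auto
    also have "\<dots> = ennreal (2 powr r * (2 * D))"
      using D by (simp add: ennreal_plus[symmetric] ennreal_mult[symmetric] del: ennreal_plus)
    finally have "d * 2 ^ DIM('a) \<le> 2 powr r * (2 * D)" using D by (simp add: ennreal_le_iff)
    then have "d \<le> 2 powr r * (2 * D) / 2 ^ DIM('a)" by (simp add: pos_le_divide_eq)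
    then have "d powr (1 / r) \<le> (2 powr r * (2 * D) / 2 ^ DIM('a)) powr (1 / r)"
      using d r by (intro powr_mono2) auto
    then show ?thesis using r by (simp add: d_def powr_powr)
  qed
  have "bounded (range \<beta>)"
  proof (rule boundedI)
    fix y assume "y \<in> range \<beta>"
    then obtain k where "y = \<beta> k" by blast
    then show "norm y \<le> \<bar>\<beta> 0\<bar> + (2 powr r * (2 * D) / 2 ^ DIM('a)) powr (1 / r)" using bnd[of k] by simp
  qed
  from bounded_imp_convergent_subsequence[OF this] obtain c s where s: "strict_mono (s :: nat \<Rightarrow> nat)" "(\<beta> \<circ> s) \<longlonglongrightarrow> c"
    by blast
  have fin: "(\<integral>\<^sup>+x. ennreal (\<bar>b x - c\<bar> powr r) \<partial>lebesgue) \<le> ennreal D"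
  proof (rule nn_integral_le_lim[OF meas \<beta>])
    show "AE x in lebesgue. (\<lambda>k. indicator (Q (s k)) x * \<bar>b x - \<beta> (s k)\<bar> powr r) \<longlonglongrightarrow> \<bar>b x - c\<bar> powr r"
    proof (rule AE_I2)
      fix x :: 'a
      obtain k0 where k0: "norm x < 2 ^ k0" using real_arch_pow[of 2 "norm x"] by auto
      have "x \<in> Q (s k)" if "k0 \<le> k" for k
        unfolding Q
      proof (intro ballI)
        fix i :: 'a assume "i \<in> Basis"
        then have "\<bar>x \<bullet> i\<bar> \<le> norm x" by (rule Basis_le_norm)
        moreover have "(2::real) ^ k0 \<le> 2 ^ s k"
          using that seq_suble[OF s(1), of k] by (intro power_increasing) auto
        ultimately show "- (2 ^ s k) \<le> x \<bullet> i \<and> x \<bullet> i < 2 ^ s k" using k0 by linarith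
      qed
      then have ev: "\<forall>\<^sub>F k in sequentially. \<bar>b x - \<beta> (s k)\<bar> powr r = indicator (Q (s k)) x * \<bar>b x - \<beta> (s k)\<bar> powr r"
        by (intro eventually_sequentiallyI[of k0]) simp
      have "(\<lambda>k. \<bar>b x - \<beta> (s k)\<bar>) \<longlonglongrightarrow> \<bar>b x - c\<bar>"
        using s(2) by (intro tendsto_intros) (simp add: o_def)
      then have "(\<lambda>k. \<bar>b x - \<beta> (s k)\<bar> powr r) \<longlonglongrightarrow> \<bar>b x - c\<bar> powr r"
        using r by (intro tendsto_powr' tendsto_const) auto
      then show "(\<lambda>k. indicator (Q (s k)) x * \<bar>b x - \<beta> (s k)\<bar> powr r) \<longlonglongrightarrow> \<bar>b x - c\<bar> powr r"
        by (rule Lim_transform_eventually[OF _ ev])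
    qed
  qed
  have "in_Lp r (\<lambda>x. b x - c)"
    using b le_less_trans[OF fin ennreal_less_top] by (simp add: in_Lp_def)
  \<comment> \<open>The local condition on \<open>b\<close> itself: \<open>b\<close> differs from an
    L^r function by a constant, which is harmless on compact sets.\<close>
  moreover have "(\<integral>\<^sup>+ x\<in>B. ennreal (norm (b x) powr r) \<partial>lebesgue) < \<infinity>" if B: "compact B" for B
  proof -
    have "(\<integral>\<^sup>+ x\<in>B. ennreal (norm (b x) powr r) \<partial>lebesgue)
        \<le> (\<integral>\<^sup>+x. ennreal (2 powr r) * (ennreal (\<bar>b x - c\<bar> powr r) + ennreal (\<bar>c\<bar> powr r) * indicator B x) \<partial>lebesgue)"
    proof (rule nn_integral_mono)
      fix x
      have "norm (b x) powr r \<le> 2 powr r * (\<bar>b x - c\<bar> powr r + \<bar>c\<bar> powr r)"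
        using powr_abs_add_le[OF r, of "b x - c" c] by simp
      then show "ennreal (norm (b x) powr r) * indicator B x
          \<le> ennreal (2 powr r) * (ennreal (\<bar>b x - c\<bar> powr r) + ennreal (\<bar>c\<bar> powr r) * indicator B x)"
        by (cases "x \<in> B")
          (simp_all add: ennreal_plus[symmetric] ennreal_mult[symmetric] ennreal_leI del: ennreal_plus)
    qed
    also have "\<dots> = ennreal (2 powr r) * ((\<integral>\<^sup>+x. ennreal (\<bar>b x - c\<bar> powr r) \<partial>lebesgue) + ennreal (\<bar>c\<bar> powr r) * emeasure lebesgue B)"
    proof -
      note b[measurable]
      have m1: "(\<lambda>x. ennreal (\<bar>b x - c\<bar> powr r)) \<in> borel_measurable lebesgue" by measurable
      have m2: "(\<lambda>x. ennreal (\<bar>c\<bar> powr r) * indicator B x) \<in> borel_measurable lebesgue"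
        using sets_lebesgue_compact[OF B] by measurable
      show ?thesis
        using m1 m2 sets_lebesgue_compact[OF B]
        by (subst nn_integral_cmult) (auto simp: nn_integral_add nn_integral_cmult_indicator)
    qed
    also have "\<dots> < \<infinity>"
      using le_less_trans[OF fin ennreal_less_top] emeasure_compact_finite[OF B] B
      by (simp add: ennreal_mult_less_top borel_compact)
    finally show ?thesis .
  qed
  ultimately show ?thesis using b by (auto simp: in_dot_Lp_def in_Lp_loc_def)
qed

theorem theorem3p3:
  fixes m :: nat and p q :: real and ps :: "nat \<Rightarrow> real"
    and qs :: "nat \<Rightarrow> ereal" and s :: real
    and T :: "(nat \<Rightarrow> 'a::euclidean_space \<Rightarrow> complex) \<Rightarrow> 'a \<Rightarrow> complex"
    and K :: "'a \<Rightarrow> (nat \<Rightarrow> 'a) \<Rightarrow> complex" and \<omega> :: "real \<Rightarrow> real"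
    and b :: "'a \<Rightarrow> real"
  assumes "2 \<le> m"
    and "1 < q" and "q < p"
    and "\<forall>i<m. 1 < ps i"
    and "1 / p = (\<Sum>i<m. 1 / ps i)"
    and "nondeg_mCZO m qs s T K \<omega>"
    and "kernel_rep_L1c m T K"
    and "in_Lp_loc 1 b"
    and "comm_bounded m ps q b T"
  shows "in_dot_Lp (1 / (1 / q - 1 / p)) b"
proof -
  have kern: "mCZ_kernel m K \<omega>" and lin: "multilinear_op m T" and lim: "(\<omega> \<longlongrightarrow> 0) (at_right 0)"
    using assms(6) by (simp_all add: nondeg_mCZO_def mCZO_def)
  note kern' = kern[unfolded mCZ_kernel_def]
  have mod: "modulus \<omega>" by (rule kern'[THEN conjunct1])
  have cong: "\<forall>x y y'. (\<forall>i<m. y i = y' i) \<longrightarrow> K x y = K x y'"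
    by (rule kern'[THEN conjunct2, THEN conjunct1])
  from kern'[THEN conjunct2, THEN conjunct2] obtain C where C:
    "(\<forall>x y. off_diag m x y \<longrightarrow> norm (K x y) \<le> C / ssum_dist m x y ^ (m * DIM('a))) \<and>
     (\<forall>x y h. off_diag m x y \<longrightarrow> norm h \<le> 1/2 * Max ((\<lambda>i. dist x (y i)) ` {..<m}) \<longrightarrow>
        norm (K (x + h) y - K x y) + (\<Sum>i<m. norm (K x (y(i := y i + h)) - K x y))
          \<le> C / ssum_dist m x y ^ (m * DIM('a)) * \<omega> (norm h / ssum_dist m x y))" ..
  note size = C[THEN conjunct1, rule_format]
  from assms(6)[unfolded nondeg_mCZO_def, THEN conjunct2, THEN conjunct2] obtain c0 where c0: "0 < c0"
    "\<forall>y \<rho>. 0 < \<rho> \<longrightarrow> (\<exists>x. dist x y \<ge> \<rho> \<and> norm (K x (\<lambda>_. y)) \<ge> 1 / (c0 * \<rho> ^ (m * DIM('a))))"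
    by blast
  have s0: "0 \<le> ssum_dist m x y" for x and y :: "nat \<Rightarrow> 'a" by (simp add: ssum_dist_def sum_nonneg)
  \<comment> \<open>Non-degeneracy yields a nonzero kernel value off the diagonal, which a negative
    constant in the size bound would not permit.\<close>
  have C0: "0 \<le> C"
  proof (rule ccontr)
    assume "\<not> 0 \<le> C"
    obtain x where x: "1 \<le> dist x (0::'a)" "1 / (c0 * 1 ^ (m * DIM('a))) \<le> norm (K x (\<lambda>_. 0))" using c0(2)[rule_format, of 1 0] by auto
    have "off_diag m x (\<lambda>_. 0)" using x(1) assms(1) by (auto simp: off_diag_def intro!: exI[of _ 0])
    from size[OF this] have "norm (K x (\<lambda>_. 0)) \<le> 0"
      using \<open>\<not> 0 \<le> C\<close> zero_le_power[OF s0[of x "\<lambda>_. 0"], of "m * DIM('a)"]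
      by (smt (verit) divide_nonpos_nonneg)
    moreover have "0 < 1 / (c0 * 1 ^ (m * DIM('a)))" using c0(1) by simp
    ultimately show False using x(2) by linarith
  qed
  interpret cz_commutator m K \<omega> C T b
  proof unfold_locales
    show "0 < m" using assms(1) by simp
    show "modulus \<omega>" "(\<omega> \<longlongrightarrow> 0) (at_right 0)" "0 \<le> C" "multilinear_op m T" "kernel_rep_L1c m T K" "in_Lp_loc 1 b"
      by (fact mod lim C0 lin assms(7) assms(8))+
    show "K x y = K x y'" if "\<And>i. i < m \<Longrightarrow> y i = y' i" for x y y'
      using cong that by blast
  qed (rule C[THEN conjunct1, rule_format] C[THEN conjunct2, rule_format]; assumption)+
  define r where "r = 1 / (1 / q - 1 / p)"
  have qp: "1 / q - 1 / p < 1" "0 < 1 / q - 1 / p"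
  proof -
    have "1 / p < 1 / q" "1 / q < 1" "0 < 1 / p" using assms(2,3) by (auto intro!: divide_strict_left_mono)
    then show "1 / q - 1 / p < 1" "0 < 1 / q - 1 / p" by linarith+
  qed
  have r: "1 < r" "1 / r = 1 / q - 1 / p" using qp by (simp_all add: r_def)
  define \<theta> :: real where "\<theta> = 2 ^ Suc DIM('a)"
  show ?thesis
    unfolding r_def[symmetric]
  proof (rule main_estimate[OF assms(2,3) _ assms(5,9) c0(1) _ r(2)])
    show "1 < ps i" if "i < m" for i using assms(4) that by blast
    show "\<exists>x. dist x y \<ge> \<rho> \<and> norm (K x (\<lambda>_. y)) \<ge> 1 / (c0 * \<rho> ^ (m * DIM('a)))" if "0 < \<rho>" for y \<rho>
      using c0(2) that by blast
  next
    fix \<kappa> :: real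
    assume \<kappa>: "real DIM('a) \<le> \<kappa>" and est: "\<And>\<Lambda>. 0 \<le> \<Lambda> \<Longrightarrow> \<exists>C. oscillation_estimate b r \<kappa> \<Lambda> C"
    have \<kappa>0: "0 \<le> \<kappa>" using \<kappa> by (meson of_nat_0_le_iff order_trans)
    have \<Lambda>: "0 \<le> 2 * unit_ball_vol (real DIM('a)) * (2 * \<kappa> + 3 * real DIM('a)) ^ DIM('a)"
      using \<kappa>0 by (intro mult_nonneg_nonneg zero_le_power) auto
    \<comment> \<open>With \<kappa> known, \<Lambda> is taken as the packing constant of
      \<open>J_ball_carleson\<close>.\<close>
    from est[OF \<Lambda>] obtain C' where C': "oscillation_estimate b r \<kappa> (2 * unit_ball_vol (real DIM('a)) * (2 * \<kappa> + 3 * real DIM('a)) ^ DIM('a)) C'" ..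
    show "in_dot_Lp r b"
    proof (rule in_dot_LpI)
      show "b \<in> borel_measurable lebesgue" using assms(8) by (simp add: in_Lp_loc_def)
      show "0 < r" using r(1) by simp
      show "\<exists>\<beta>. (\<integral>\<^sup>+x. ennreal (indicator (dyadic.cell a L 0 a) x * \<bar>b x - \<beta>\<bar> powr r) \<partial>lebesgue)
          \<le> ennreal ((2 ^ Suc DIM('a)) powr r * (6 * (2 ^ Suc DIM('a)) powr (r - 1) * \<bar>C'\<bar>) powr r)" if "0 < L" for a L
        by (rule oscillation_Lr_bound[OF assms(8) r(1) \<kappa>0 that C'])
    qed simp
  qed
qed

end
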